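(* Let $N\ge 1$ be an integer, $\lambda>0$ a real number and $\mathbf n\in\mathbb Z^N$. Define $$P_{\mathbf n}=\sum_{\mathbf m\in\mathbb Z^N}\alpha_{\mathbf n}(\mathbf m)\,f_{\mathbf m},$$ where the functions $f_{\mathbf m}$ are as in the context and $$\alpha_{\mathbf n}(\mathbf m)=\delta_{\mathbf n}(\mathbf m)+\sum_{s=1}^\infty\frac{1}{4^s s!}\sum_{j_1\le k_1}\cdots\sum_{j_s\le k_s}\ \sum_{\nu_1,\dots,\nu_s=0}^\infty \delta_{\mathbf n}\Bigl(\mathbf m+\sum_{r=1}^s\mathbf E_{j_rk_r}^{\nu_r}\Bigr)\prod_{r=1}^s g_{j_rk_r}\Bigl(\nu_r;\ \mathbf n-\sum_{\ell=1}^r\mathbf E_{j_\ell k_\ell}^{\nu_\ell}\Bigr),$$ each sum $\sum_{j_r\le k_r}$ being over $1\le j_r\le k_r\le N$, with $$g_{jk}(\nu;\mathbf m)=2\lambda(\lambda-1)\,\nu\,(1-\delta_{jk})-\tilde m_j(\tilde m_j+1)\,\delta_{\nu 0}\,\delta_{jk},\qquad \tilde m_j=m_j+\lambda(N+1-j),$$ $$\mathbf E_{jk}^\nu=(1-\nu)\mathbf e_j+(1+\nu)\mathbf e_k .$$ (For each $\mathbf m$ only finitely many terms of the sum defining $\alpha_{\mathbf n}(\mathbf m)$ are non-zero, and only finitely many terms $\alpha_{\mathbf n}(\mathbf m)f_{\mathbf m}$ are non-zero.) Then $P_{\mathbf n}$ is a reduced polynomial eigenfunction of the Calogero model with eigenvalue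 $E_{\mathbf n}=2(n_1+\cdots+n_N)+N(1+\lambda(N-1))$; that is, $P_{\mathbf n}$ is a symmetric polynomial in $x_1,\dots,x_N$ and $$H(\psi_0P_{\mathbf n})=E_{\mathbf n}\,\psi_0P_{\mathbf n}.$$
   Context: The Calogero Hamiltonian is the differential operator $$H=\sum_{j=1}^N\left(-\partial_{x_j}^2+x_j^2\right)+2\lambda(\lambda-1)\sum_{1\le j<k\le N}\frac{1}{(x_j-x_k)^2},$$ and $$\psi_0(\mathbf x)=\prod_{j=1}^N e^{-\frac12x_j^2}\prod_{1\le j<k\le N}(x_k-x_j)^\lambda .$$ The eigenvalue equation is a differential identity at points $\mathbf x\in\mathbb R^N$ with pairwise distinct coordinates; one may take the region $x_1<x_2<\cdots<x_N$, where $\psi_0>0$. $\mathbf e_j$ is the $j$-th standard basis vector, $(\mathbf e_j)_k=\delta_{jk}$, and $\delta_{\mathbf n}(\mathbf m)=\delta_{\mathbf n,\mathbf m}$ is the Kronecker delta ($1$ if $\mathbf m=\mathbf n$ and $0$ otherwise). For $\mathbf n\in\mathbb Z^N$, $\mathbf x\in\mathbb R^N$ and $\epsilon>0$ let $\mathcal C_j$ ($j=1,\dots,N$) be the positively oriented circle in the complex plane centred at $0$ of radius $\max_{1\le k\le N}|x_k|+\epsilon j$, and let $$f_{\mathbf n}(\mathbf x)=\prod_{j=1}^N\left(\oint_{\mathcal C_j}\frac{dy_j}{2\pi i\,y_j}\,y_j^{n_j}\right)\frac{\prod_{1\le j<k\le N}(1-y_j/y_k)^\lambda}{\prod_{j,k=1}^N(1-x_j/y_k)^\lambda},$$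 where powers are given by the principal branch (equivalently, by the binomial series in $y_j/y_k$, $j<k$, and in $x_j/y_k$, which converge on the contours). The functions $f_{\mathbf n}$ do not depend on $\epsilon$. "Reduced polynomial eigenfunction with eigenvalue $E$" means a symmetric polynomial $P$ with $H(\psi_0P)=E\psi_0P$; non-vanishing of $P$ is not part of the assertion. *)

theory Defs
  imports "HOL-Complex_Analysis.Complex_Analysis" "HOL-Combinatorics.Permutations"
begin

text \<open>
  The coordinates are indexed by the natural numbers \<open>1, \<dots>, N\<close>. A point of \<open>\<real>\<^sup>N\<close> is given by a
  function \<open>x :: nat \<Rightarrow> real\<close>, of which only the values at \<open>1, \<dots>, N\<close> are ever used.
  Elements of \<open>\<int>\<^sup>N\<close>, over which sums are taken, are normalised to vanish at all other indices, so
  that equality of functions is equality in \<open>\<int>\<^sup>N\<close>.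
\<close>

definition int_lattice :: "nat \<Rightarrow> (nat \<Rightarrow> int) set" where
  "int_lattice N = {m. \<forall>j. j \<notin> {1..N} \<longrightarrow> m j = 0}"


subsection \<open>The Calogero model\<close>

definition partial_deriv :: "nat \<Rightarrow> ((nat \<Rightarrow> real) \<Rightarrow> complex) \<Rightarrow> (nat \<Rightarrow> real) \<Rightarrow> complex" where
  "partial_deriv j F x = vector_derivative (\<lambda>t. F (x(j := t))) (at (x j))"

definition calogero_H ::
  "nat \<Rightarrow> real \<Rightarrow> ((nat \<Rightarrow> real) \<Rightarrow> complex) \<Rightarrow> (nat \<Rightarrow> real) \<Rightarrow> complex" where
  "calogero_H N lam F x =
     (\<Sum>j=1..N. - partial_deriv j (partial_deriv j F) x + of_real ((x j)\<^sup>2) * F x)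
     + of_real (2 * lam * (lam - 1) * (\<Sum>j=1..N. \<Sum>k\<in>{j<..N}. 1 / (x j - x k)\<^sup>2)) * F x"

text \<open>
  The power is the principal one. On the region \<open>x 1 < \<dots> < x N\<close> the function below is therefore
  the positive ground state; on the other components of the set of points with pairwise distinct
  coordinates, each factor carries the constant phase \<open>1\<close> or \<open>exp (\<i> * pi * lam)\<close>.
\<close>

definition psi0 :: "nat \<Rightarrow> real \<Rightarrow> (nat \<Rightarrow> real) \<Rightarrow> complex" where
  "psi0 N lam x =
     (\<Prod>j=1..N. of_real (exp (- (x j)\<^sup>2 / 2)))
     * (\<Prod>j=1..N. \<Prod>k\<in>{j<..N}. of_real (x k - x j) powr of_real lam)"

text \<open>A polynomial function in \<open>x 1, \<dots>, x N\<close>: a finite linear combination of monomials, where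
  \<open>A\<close> is a finite set of exponent vectors.\<close>

definition polynomial_in :: "nat \<Rightarrow> ((nat \<Rightarrow> real) \<Rightarrow> complex) \<Rightarrow> bool" where
  "polynomial_in N P \<longleftrightarrow>
     (\<exists>(A :: (nat \<Rightarrow> nat) set) (c :: (nat \<Rightarrow> nat) \<Rightarrow> complex). finite A \<and>
        (\<forall>x. P x = (\<Sum>a\<in>A. c a * (\<Prod>j=1..N. of_real (x j) ^ a j))))"

definition symmetric_polynomial_in :: "nat \<Rightarrow> ((nat \<Rightarrow> real) \<Rightarrow> complex) \<Rightarrow> bool" where
  "symmetric_polynomial_in N P \<longleftrightarrow>
     polynomial_in N P \<and> (\<forall>\<sigma> x. \<sigma> permutes {1..N} \<longrightarrow> P (x \<circ> \<sigma>) = P x)"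

definition reduced_polynomial_eigenfunction ::
  "nat \<Rightarrow> real \<Rightarrow> real \<Rightarrow> ((nat \<Rightarrow> real) \<Rightarrow> complex) \<Rightarrow> bool" where
  "reduced_polynomial_eigenfunction N lam E P \<longleftrightarrow>
     symmetric_polynomial_in N P \<and>
     (\<forall>x. inj_on x {1..N} \<longrightarrow>
        calogero_H N lam (\<lambda>x. psi0 N lam x * P x) x = of_real E * (psi0 N lam x * P x))"


subsection \<open>The functions \<open>f\<^sub>n\<close>\<close>

text \<open>The iterated integral of \<open>F y\<close> against \<open>dy\<^sub>j / (2 \<pi> \<i> y\<^sub>j) y\<^sub>j\<^bsup>n\<^sub>j\<^esup>\<close> over the circles
  \<open>\<bar>y\<^sub>j\<bar> = R j\<close> for \<open>j = 1, \<dots>, k\<close>; the value \<open>0\<close> at the other indices is a dummy.\<close>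

fun circle_integrals ::
  "(nat \<Rightarrow> real) \<Rightarrow> (nat \<Rightarrow> int) \<Rightarrow> nat \<Rightarrow> ((nat \<Rightarrow> complex) \<Rightarrow> complex) \<Rightarrow> complex" where
  "circle_integrals R n 0 F = F (\<lambda>_. 0)"
| "circle_integrals R n (Suc k) F =
     circle_integrals R n k
       (\<lambda>y. contour_integral (circlepath 0 (R (Suc k)))
              (\<lambda>z. 1 / (2 * of_real pi * \<i> * z) * z powi n (Suc k) * F (y(Suc k := z))))"

definition contour_radius :: "nat \<Rightarrow> real \<Rightarrow> (nat \<Rightarrow> real) \<Rightarrow> nat \<Rightarrow> real" where
  "contour_radius N \<epsilon> x j = Max ((\<lambda>k. \<bar>x k\<bar>) ` {1..N}) + \<epsilon> * real j"

definition f_fun ::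
  "nat \<Rightarrow> real \<Rightarrow> real \<Rightarrow> (nat \<Rightarrow> int) \<Rightarrow> (nat \<Rightarrow> real) \<Rightarrow> complex" where
  "f_fun N lam \<epsilon> n x =
     circle_integrals (contour_radius N \<epsilon> x) n N
       (\<lambda>y. (\<Prod>j=1..N. \<Prod>k\<in>{j<..N}. (1 - y j / y k) powr of_real lam)
            / (\<Prod>j=1..N. \<Prod>k=1..N. (1 - of_real (x j) / y k) powr of_real lam))"


subsection \<open>The coefficients \<open>\<alpha>\<^sub>n(m)\<close>\<close>

definition E_vec :: "nat \<Rightarrow> nat \<Rightarrow> nat \<Rightarrow> nat \<Rightarrow> int" where
  "E_vec j k \<nu> i = (1 - int \<nu>) * of_bool (i = j) + (1 + int \<nu>) * of_bool (i = k)"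

definition m_tilde :: "nat \<Rightarrow> real \<Rightarrow> (nat \<Rightarrow> int) \<Rightarrow> nat \<Rightarrow> real" where
  "m_tilde N lam m j = of_int (m j) + lam * (real N + 1 - real j)"

definition g_coeff :: "nat \<Rightarrow> real \<Rightarrow> nat \<Rightarrow> nat \<Rightarrow> nat \<Rightarrow> (nat \<Rightarrow> int) \<Rightarrow> real" where
  "g_coeff N lam j k \<nu> m =
     2 * lam * (lam - 1) * real \<nu> * (1 - of_bool (j = k))
     - m_tilde N lam m j * (m_tilde N lam m j + 1) * of_bool (\<nu> = 0) * of_bool (j = k)"

definition index_pairs :: "nat \<Rightarrow> (nat \<times> nat) set" where
  "index_pairs N = {(j, k). 1 \<le> j \<and> j \<le> k \<and> k \<le> N}"

text \<open>The summation indices \<open>(j\<^sub>r, k\<^sub>r)\<close> and \<open>\<nu>\<^sub>r\<close>, \<open>r = 1, \<dots>, s\<close>, are the values \<open>p r\<close> and \<open>v r\<close>.\<close>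

definition E_sum :: "(nat \<Rightarrow> nat \<times> nat) \<Rightarrow> (nat \<Rightarrow> nat) \<Rightarrow> nat \<Rightarrow> nat \<Rightarrow> int" where
  "E_sum p v r i = (\<Sum>l=1..r. E_vec (fst (p l)) (snd (p l)) (v l) i)"

definition alpha_term ::
  "nat \<Rightarrow> real \<Rightarrow> (nat \<Rightarrow> int) \<Rightarrow> (nat \<Rightarrow> int) \<Rightarrow> nat \<Rightarrow> (nat \<Rightarrow> nat \<times> nat) \<Rightarrow> (nat \<Rightarrow> nat) \<Rightarrow> real" where
  "alpha_term N lam n m s p v =
     of_bool ((\<lambda>i. m i + E_sum p v s i) = n)
     * (\<Prod>r=1..s. g_coeff N lam (fst (p r)) (snd (p r)) (v r) (\<lambda>i. n i - E_sum p v r i))"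

definition alpha :: "nat \<Rightarrow> real \<Rightarrow> (nat \<Rightarrow> int) \<Rightarrow> (nat \<Rightarrow> int) \<Rightarrow> real" where
  "alpha N lam n m =
     of_bool (m = n)
     + (\<Sum>\<^sub>\<infinity>s\<in>{1..}. 1 / (4 ^ s * fact s)
          * (\<Sum>p\<in>{1..s} \<rightarrow>\<^sub>E index_pairs N. \<Sum>\<^sub>\<infinity>v\<in>{1..s} \<rightarrow>\<^sub>E UNIV. alpha_term N lam n m s p v))"


subsection \<open>The functions \<open>P\<^sub>n\<close>\<close>

definition P_fun ::
  "nat \<Rightarrow> real \<Rightarrow> real \<Rightarrow> (nat \<Rightarrow> int) \<Rightarrow> (nat \<Rightarrow> real) \<Rightarrow> complex" where
  "P_fun N lam \<epsilon> n x =
     (\<Sum>\<^sub>\<infinity>m\<in>int_lattice N. of_real (alpha N lam n m) * f_fun N lam \<epsilon> m x)"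

definition eigenvalue :: "nat \<Rightarrow> real \<Rightarrow> (nat \<Rightarrow> int) \<Rightarrow> real" where
  "eigenvalue N lam n =
     2 * of_int (\<Sum>j=1..N. n j) + real N * (1 + lam * (real N - 1))"

end

theory Submission
  imports Defs "HOL-Library.Poly_Mapping"
begin

text \<open>
  Expanding the integrand of \<open>f\<^sub>n\<close> in the small quantities \<open>1 / y\<^sub>1\<close> and
  \<open>y\<^sub>k / y\<^bsub>k+1\<^esub>\<close> identifies \<open>f\<^sub>n(x)\<close> with the coefficient of
  \<open>\<Prod>\<^sub>k y\<^sub>k\<^bsup>-n\<^sub>k\<^esup>\<close> in a formal power series \<open>F\<close>, so that all \<open>f\<^sub>n\<close> are symmetric
  polynomials. Up to powers of the \<open>y\<^sub>k\<close>, \<open>F\<close> is the kernel function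
  \<open>\<Prod>(y\<^sub>k - y\<^sub>j)\<^sup>\<lambda> / \<Prod>(y\<^sub>k - x\<^sub>j)\<^sup>\<lambda>\<close>, which intertwines
  \<open>D = \<Sum>\<^sub>i \<partial>\<^sub>i\<^sup>2 + 2\<lambda> \<Sum>\<^bsub>i\<noteq>j\<^esub> (x\<^sub>i - x\<^sub>j)\<^sup>-\<^sup>1 \<partial>\<^sub>i\<close> in \<open>x\<close> with a Calogero operator in \<open>y\<close>.
  Comparing coefficients gives \<open>- D f\<^sub>n = \<Sum> g\<^bsub>jk\<^esub>(\<nu>; n - E) f\<^bsub>n-E\<^esub>\<close> with \<open>E = E\<^sub>j\<^sub>k\<^sup>\<nu>\<close>, and \<open>\<alpha>\<^sub>n\<close> is
  made such that \<open>P\<^sub>n = exp(- D / 4) f\<^sub>n\<close>. Since \<open>f\<^sub>n\<close> is homogeneous, \<open>P\<^sub>n\<close> is an eigenfunction of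
  \<open>\<psi>\<^sub>0\<^sup>-\<^sup>1 H \<psi>\<^sub>0 = E\<^sub>0 + 2 \<Sum>\<^sub>i x\<^sub>i \<partial>\<^sub>i - D\<close>.
\<close>

section \<open>Power series in several variables\<close>

text \<open>The powers to \<lambda> are multivalued, and 1 / (y_k - y_l) depends on the region of
  expansion. Among formal series in z_i = y_{i-1} / y_i and z_0 = 1 / y_0, with y_0 a dummy, each of
  these is one fixed element, derivations act coefficientwise, and convergence is no issue once the
  integrals are identified with coefficients. The exponent of z_l in the monomial belonging to f_m
  is the tail m_l + ... + m_N. Hence f_m = 0 unless all tails of m are nonnegative, while
  \<alpha>_n(m) = 0 unless they are at most those of n. This confines every sum to a finite box. The
  constant 4: let A be the sum of x_i d/dx_i. Since D lowers degrees by 2, [A, D] = - 2 D and (2 A -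
  D) exp(- D / 4) = exp(- D / 4) 2 A. As f_n has degree n_1 + ... + n_N, the eigenvalue is E_0 plus
  twice that. The exponential itself is never formed: a recurrence for \<alpha>_n expresses the same
  commutation, and a summation by parts over m transfers it to P_n.\<close>

type_synonym exponent = "nat \<Rightarrow>\<^sub>0 nat"

definition decompositions :: "exponent \<Rightarrow> (exponent \<times> exponent) set" where
  "decompositions c = {(a, b). a + b = c}"

text \<open>Both summands are pointwise at most c, so the first ones, read as functions, lie among
  the finitely many bounded functions on the keys of c; the second is then c - a.\<close>

lemma finite_decompositions: "finite (decompositions c)"
proof -
  let ?F = "{f. (\<forall>i. (i \<in> Poly_Mapping.keys c \<longrightarrow> f i \<in> {..Max (Poly_Mapping.lookup c `
      Poly_Mapping.keys c)}) \<and> (i \<notin> Poly_Mapping.keys c \<longrightarrow> f i = (0::nat)))}"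
  have fin: "finite ?F"
    by (rule finite_set_of_finite_funs) auto
  have sub: "Poly_Mapping.lookup a \<in> ?F" if "a + b = c" for a b
  proof -
    have le: "Poly_Mapping.lookup a i \<le> Poly_Mapping.lookup c i" for i
      unfolding that[symmetric] lookup_add by simp
    have "Poly_Mapping.lookup a i \<le> Max (Poly_Mapping.lookup c ` Poly_Mapping.keys c)"
      if "i \<in> Poly_Mapping.keys c" for i
      by (rule order_trans[OF le Max_ge]) (use that in simp_all)
    moreover have "Poly_Mapping.lookup a i = 0" if "i \<notin> Poly_Mapping.keys c" for i
      using le[of i] that by (simp add: in_keys_iff)
    ultimately show ?thesis by (simp del: Max_ge_iff Max_le_iff)
  qed
  have "finite (fst ` decompositions c)"
  proof (rule inj_on_finite[OF _ _ fin])
    show "inj_on Poly_Mapping.lookup (fst ` decompositions c)"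
      by (rule inj_onI) (simp add: poly_mapping_eqI)
    show "Poly_Mapping.lookup ` fst ` decompositions c \<subseteq> ?F"
    proof (rule image_subsetI)
      fix a assume "a \<in> fst ` decompositions c"
      then obtain b where "a + b = c" by (auto simp: decompositions_def)
      then show "Poly_Mapping.lookup a \<in> ?F" by (rule sub)
    qed
  qed
  moreover have "decompositions c \<subseteq> (\<lambda>a. (a, c - a)) ` fst ` decompositions c"
    by (force simp: decompositions_def)
  ultimately show ?thesis using finite_subset by blast
qed

text \<open>A type of its own, so that multiplication can be the Cauchy product and the ring
  simplification rules apply to series.\<close>

typedef mps = "UNIV :: (exponent \<Rightarrow> complex) set"
  morphisms coef Mps by simp

lemma coef_Mps [simp]: "coef (Mps f) = f"
  by (simp add: Mps_inverse)

lemma mps_eqI: "(\<And>t. coef P t = coef Q t) \<Longrightarrow> P = Q"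
  by (metis coef_inverse ext)

instantiation mps :: comm_ring_1
begin

definition "0 = Mps (\<lambda>_. 0)"
definition "1 = Mps (\<lambda>t. of_bool (t = 0))"
definition "P + Q = Mps (\<lambda>t. coef P t + coef Q t)"
definition "P - Q = Mps (\<lambda>t. coef P t - coef Q t)"
definition "- P = Mps (\<lambda>t. - coef P t)"
definition "P * Q = Mps (\<lambda>t. \<Sum>(a, b)\<in>decompositions t. coef P a * coef Q b)"

instance
proof
  fix P Q R :: mps
  show "P + Q + R = P + (Q + R)" "P + Q = Q + P" "0 + P = P" "- P + P = 0" "P - Q = P + - Q"
    by (auto intro!: mps_eqI simp: zero_mps_def plus_mps_def minus_mps_def uminus_mps_def)
  show "(0::mps) \<noteq> 1"
  proof
    assume "(0::mps) = 1"
    then have "coef 0 0 = coef 1 0" by simp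
    then show False by (simp add: zero_mps_def one_mps_def)
  qed
  show "P * Q = Q * P"
  proof (rule mps_eqI)
    fix t
    show "coef (P * Q) t = coef (Q * P) t"
      unfolding times_mps_def coef_Mps
      by (rule sum.reindex_bij_witness[of _ "\<lambda>(a,b). (b,a)" "\<lambda>(a,b). (b,a)"])
         (auto simp: decompositions_def add.commute mult.commute)
  qed
  show "1 * P = P"
  proof (rule mps_eqI)
    fix t
    have "coef (1 * P) t = (\<Sum>(a, b)\<in>{(0::exponent, t)}. of_bool (a = 0) * coef P b)"
      unfolding times_mps_def one_mps_def coef_Mps
      by (rule sum.mono_neutral_right[OF finite_decompositions]) (auto simp: decompositions_def)
    then show "coef (1 * P) t = coef P t" by simp
  qed
  show "(P + Q) * R = P * R + Q * R"
    by (rule mps_eqI)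
       (simp add: times_mps_def plus_mps_def case_prod_unfold ring_distribs sum.distrib)
  show "P * Q * R = P * (Q * R)"
  proof (rule mps_eqI)
    fix t
    let ?S1 = "Sigma (decompositions t) (\<lambda>(a, b). decompositions a)" and ?S2 = "Sigma
        (decompositions t) (\<lambda>(a, b). decompositions b)"
    have "coef (P * Q * R) t
        = (\<Sum>p\<in>decompositions t. \<Sum>q\<in>decompositions (fst p). coef P (fst q) * coef Q (snd q) * coef R
            (snd p))"
      by (simp add: times_mps_def case_prod_unfold sum_distrib_right)
    also have "\<dots> = (\<Sum>(p, q)\<in>?S1. coef P (fst q) * coef Q (snd q) * coef R (snd p))"
      by (subst sum.Sigma) (auto simp: finite_decompositions case_prod_unfold)
    also have "\<dots> = (\<Sum>(p, q)\<in>?S2. coef P (fst p) * (coef Q (fst q) * coef R (snd q)))"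
      by (rule sum.reindex_bij_witness[of _ "\<lambda>((d,u),(e,b)). ((d + e,b),(d,e))"
               "\<lambda>((a,b),(d,e)). ((d,e + b),(e,b))"])
         (auto simp: decompositions_def add.assoc mult.assoc)
    also have "\<dots> = (\<Sum>p\<in>decompositions t. \<Sum>q\<in>decompositions (snd p). coef P (fst p) * (coef Q (fst q)
        * coef R (snd q)))"
      by (subst sum.Sigma) (auto simp: finite_decompositions case_prod_unfold)
    also have "\<dots> = coef (P * (Q * R)) t"
      by (simp add: times_mps_def case_prod_unfold sum_distrib_left)
    finally show "coef (P * Q * R) t = coef (P * (Q * R)) t" .
  qed
qed

end

lemma coef_zero [simp]: "coef 0 t = 0"
  and coef_one: "coef 1 t = of_bool (t = 0)"
  and coef_add [simp]: "coef (P + Q) t = coef P t + coef Q t"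
  and coef_diff [simp]: "coef (P - Q) t = coef P t - coef Q t"
  and coef_minus [simp]: "coef (- P) t = - coef P t"
  and coef_mult: "coef (P * Q) t = (\<Sum>(a, b)\<in>decompositions t. coef P a * coef Q b)"
  by (simp_all add: zero_mps_def one_mps_def plus_mps_def minus_mps_def uminus_mps_def
      times_mps_def)

lemma coef_sum: "coef (sum f A) t = (\<Sum>i\<in>A. coef (f i) t)"
  by (induction A rule: infinite_finite_induct) auto

definition mon :: "exponent \<Rightarrow> mps" where
  "mon e = Mps (\<lambda>t. of_bool (t = e))"

definition cst :: "complex \<Rightarrow> mps" where
  "cst c = Mps (\<lambda>t. c * of_bool (t = 0))"

lemma coef_mon_mult_add [simp]: "coef (mon e * P) (e + t) = coef P t"
proof -
  have "coef (mon e * P) (e + t) = (\<Sum>(a, b)\<in>{(e, t)}. coef (mon e) a * coef P b)"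
    unfolding coef_mult
    by (rule sum.mono_neutral_right[OF finite_decompositions]) (auto simp: decompositions_def
        mon_def)
  then show ?thesis by (simp add: mon_def)
qed

lemma coef_mon_mult_eq_0: "(\<And>s. t \<noteq> e + s) \<Longrightarrow> coef (mon e * P) t = 0"
  unfolding coef_mult by (rule sum.neutral) (auto simp: decompositions_def mon_def)

lemma mon_0 [simp]: "mon 0 = 1"
  by (simp add: mon_def one_mps_def)

lemma mon_add: "mon (d + e) = mon d * mon e"
proof (rule mps_eqI)
  fix t
  show "coef (mon (d + e)) t = coef (mon d * mon e) t"
  proof (cases "\<exists>s. t = d + s")
    case True
    then show ?thesis by (auto simp: mon_def[of e] mon_def[of "d + e"])
  next
    case False
    then show ?thesis using coef_mon_mult_eq_0[of t d] by (auto simp: mon_def[of "d + e"])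
  qed
qed

lemma coef_cst_mult [simp]: "coef (cst c * P) t = c * coef P t"
proof -
  have "coef (cst c * P) t = (\<Sum>(a, b)\<in>{(0, t)}. coef (cst c) a * coef P b)"
    unfolding coef_mult
    by (rule sum.mono_neutral_right[OF finite_decompositions]) (auto simp: decompositions_def
        cst_def)
  then show ?thesis by (simp add: cst_def)
qed

lemma cst_0 [simp]: "cst 0 = 0" and cst_1 [simp]: "cst 1 = 1"
  and cst_add: "cst (c + d) = cst c + cst d" and cst_diff: "cst (c - d) = cst c - cst d"
  and cst_minus: "cst (- c) = - cst c"
  by (auto intro!: mps_eqI simp: cst_def coef_one algebra_simps)

lemma cst_mult: "cst (c * d) = cst c * cst d"
  by (rule mps_eqI) (simp, simp add: cst_def)

lemma cst_of_nat: "cst (of_nat n) = of_nat n"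
  by (induction n) (auto simp: cst_add)

lemma cst_cancel: "c \<noteq> 0 \<Longrightarrow> cst c * P = 0 \<Longrightarrow> P = 0"
  by (rule mps_eqI) (metis coef_cst_mult coef_zero mult_eq_0_iff)

section \<open>Substituting a monomial into a power series in one variable\<close>

primrec mul :: "nat \<Rightarrow> exponent \<Rightarrow> exponent" where
  "mul 0 e = 0"
| "mul (Suc a) e = e + mul a e"

lemma lookup_mul: "Poly_Mapping.lookup (mul a e) i = a * Poly_Mapping.lookup e i"
  by (induction a) (auto simp: lookup_add)

lemma mul_add: "mul (a + b) e = mul a e + mul b e"
  by (induction a) (auto simp: add.assoc)

lemma mul_inject: "e \<noteq> 0 \<Longrightarrow> mul a e = mul b e \<longleftrightarrow> a = b"
  by (metis lookup_mul lookup_zero mult_cancel2 poly_mapping_eqI)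

lemma mon_mul: "mon (mul a e) = mon e ^ a"
  by (induction a) (auto simp: mon_add)

text \<open>This is F at the monomial with exponent e. For e \<noteq> 0 the index set has at most
  one element by \<open>mul_inject\<close>; writing a sum spares a case distinction and makes
  linearity immediate.\<close>

definition ev :: "complex fps \<Rightarrow> exponent \<Rightarrow> mps" where
  "ev F e = Mps (\<lambda>t. \<Sum>a | mul a e = t. fps_nth F a)"

lemma coef_ev_mul: "e \<noteq> 0 \<Longrightarrow> coef (ev F e) (mul a e) = fps_nth F a"
  by (simp add: ev_def mul_inject)

lemma coef_ev_eq_0: "(\<And>a. t \<noteq> mul a e) \<Longrightarrow> coef (ev F e) t = 0"
  by (auto simp: ev_def intro!: sum.neutral)

lemma ev_eqI:
  assumes "e \<noteq> 0" "\<And>a. coef P (mul a e) = fps_nth F a" "\<And>t. (\<And>a. t \<noteq> mul a e) \<Longrightarrow> coef P t = 0"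
  shows "ev F e = P"
  by (rule mps_eqI) (metis assms coef_ev_mul coef_ev_eq_0)

text \<open>Nonzero coefficients sit at multiples of e only, so the decompositions of
  \<open>mul n e\<close> that contribute are the pairs \<open>(mul i e, mul (n - i) e)\<close>. This
  is the Cauchy product in one variable.\<close>

lemma ev_mult:
  assumes e: "e \<noteq> 0"
  shows "ev (F * G) e = ev F e * ev G e"
proof (rule ev_eqI[OF e])
  fix n
  have inj: "inj_on (\<lambda>i. (mul i e, mul (n - i) e)) {0..n}"
    by (auto intro!: inj_onI simp: mul_inject e)
  have "coef (ev F e * ev G e) (mul n e)
      = (\<Sum>(a, b)\<in>(\<lambda>i. (mul i e, mul (n - i) e)) ` {0..n}. coef (ev F e) a * coef (ev G e) b)"
    unfolding coef_mult
  proof (rule sum.mono_neutral_right[OF finite_decompositions])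
    show "(\<lambda>i. (mul i e, mul (n - i) e)) ` {0..n} \<subseteq> decompositions (mul n e)"
      by (auto simp: decompositions_def mul_add[symmetric])
    show "\<forall>p\<in>decompositions (mul n e) - (\<lambda>i. (mul i e, mul (n - i) e)) ` {0..n}.
            (case p of (a, b) \<Rightarrow> coef (ev F e) a * coef (ev G e) b) = 0"
    proof clarsimp
      fix a b
      assume ab: "(a, b) \<in> decompositions (mul n e)" and nin: "(a, b) \<notin> (\<lambda>i. (mul i e, mul (n
          - i) e)) ` {0..n}"
        and nz: "coef (ev G e) b \<noteq> 0"
      obtain j where j: "b = mul j e" using nz coef_ev_eq_0 by metis
      show "coef (ev F e) a = 0"
      proof (rule coef_ev_eq_0)
        fix i
        show "a \<noteq> mul i e"
        proof
          assume i: "a = mul i e"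
          with ab j e have "i + j = n" by (auto simp: decompositions_def mul_add[symmetric]
              mul_inject)
          with nin i j show False by force
        qed
      qed
    qed
  qed
  also have "\<dots> = (\<Sum>i=0..n. fps_nth F i * fps_nth G (n - i))"
    by (simp add: sum.reindex[OF inj] coef_ev_mul e)
  finally show "coef (ev F e * ev G e) (mul n e) = fps_nth (F * G) n"
    by (simp add: fps_mult_nth)
next
  fix t assume nt: "\<And>a. t \<noteq> mul a e"
  show "coef (ev F e * ev G e) t = 0"
    unfolding coef_mult
  proof (rule sum.neutral, clarsimp)
    fix a b
    assume ab: "(a, b) \<in> decompositions t" and nz: "coef (ev G e) b \<noteq> 0"
    obtain j where j: "b = mul j e" using nz coef_ev_eq_0 by metis
    show "coef (ev F e) a = 0"
    proof (rule coef_ev_eq_0)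
      fix i
      show "a \<noteq> mul i e"
        using nt[of "i + j"] ab j by (auto simp: decompositions_def mul_add)
    qed
  qed
qed

lemma ev_add: "ev (F + G) e = ev F e + ev G e"
  and ev_diff: "ev (F - G) e = ev F e - ev G e"
  by (auto intro!: mps_eqI simp: ev_def sum.distrib sum_subtractf)

lemma ev_const_mult: "ev (fps_const c * F) e = cst c * ev F e"
  by (rule mps_eqI) (simp, simp add: ev_def sum_distrib_left)

lemma mul_eq_0_iff: "e \<noteq> 0 \<Longrightarrow> mul a e = 0 \<longleftrightarrow> a = 0"
  using mul_inject[of e a 0] by simp

lemma ev_1 [simp]: "e \<noteq> 0 \<Longrightarrow> ev 1 e = 1"
proof (rule ev_eqI)
  fix t assume "\<And>a. t \<noteq> mul a e"
  from this[of 0] show "coef 1 t = 0" by (simp add: coef_one)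
qed (simp_all add: coef_one mul_eq_0_iff)

lemma ev_X [simp]: "e \<noteq> 0 \<Longrightarrow> ev fps_X e = mon e"
proof (rule ev_eqI)
  fix t assume "\<And>a. t \<noteq> mul a e"
  from this[of "Suc 0"] show "coef (mon e) t = 0" by (simp add: mon_def)
next
  fix a assume "e \<noteq> 0"
  then show "coef (mon e) (mul a e) = fps_nth fps_X a"
    using mul_inject[of e a 1] by (simp add: mon_def fps_X_def)
qed

lemma ev_power: "e \<noteq> 0 \<Longrightarrow> ev (F ^ a) e = ev F e ^ a"
  by (induction a) (auto simp: ev_mult)

lemma ev_sum: "ev (sum f A) e = (\<Sum>i\<in>A. ev (f i) e)"
  by (induction A rule: infinite_finite_induct) (auto simp: ev_add, auto intro!: mps_eqI simp:
      ev_def)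

text \<open>Writing \<open>1 / y\<^sub>k = z\<^sub>0 \<cdots> z\<^sub>k\<close> for the variables \<open>z\<^sub>i\<close> of the series, the monomial with
    exponent
  \<open>t\<close> in the \<open>z\<^sub>i\<close> is the Laurent monomial \<open>\<Prod>\<^sub>k y\<^sub>k\<close> to the power \<open>- weight t k\<close>,
      and \<open>cf P n\<close> is the
  coefficient of \<open>P\<close> at \<open>\<Prod>\<^sub>k y\<^sub>k\<close> to the power \<open>- n k\<close>.\<close>

definition weight :: "exponent \<Rightarrow> nat \<Rightarrow> int" where
  "weight t k = int (Poly_Mapping.lookup t k) - int (Poly_Mapping.lookup t (Suc k))"

lemma weight_add: "weight (a + b) k = weight a k + weight b k"
  by (simp add: weight_def lookup_add)

lemma weight_mul: "weight (mul a e) k = int a * weight e k"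
  by (simp add: weight_def lookup_mul right_diff_distrib)

text \<open>Weights are consecutive differences, so their sum telescopes; exponents vanish far out
  because a monomial involves finitely many variables. Since exponents are nonnegative, so are the
  tails of every index with a nonzero coefficient, and all later truncations rest on this.\<close>

lemma lookup_eq_sum_weight:
  assumes "\<And>i. i > M \<Longrightarrow> weight t i = 0"
  shows "int (Poly_Mapping.lookup t l) = (\<Sum>i=l..M. weight t i)"
proof -
  have step: "int (Poly_Mapping.lookup t l) = int (Poly_Mapping.lookup t (Suc (l + d))) +
      (\<Sum>i=l..l+d. weight t i)" for l d
    by (induction d) (auto simp: weight_def)
  have zero: "Poly_Mapping.lookup t l = 0" if "l > M" for l
  proof -
    obtain B where B: "Poly_Mapping.keys t \<subseteq> {..<B}"
      using finite_nat_iff_bounded[of "Poly_Mapping.keys t"] by auto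
    have "int (Poly_Mapping.lookup t l) = int (Poly_Mapping.lookup t (Suc (l + B))) +
        (\<Sum>i=l..l+B. weight t i)" by (rule step)
    also have "(\<Sum>i=l..l+B. weight t i) = 0" using that assms by (intro sum.neutral) auto
    also have "Poly_Mapping.lookup t (Suc (l + B)) = 0" using B by (auto simp: in_keys_iff)
    finally show ?thesis by simp
  qed
  show ?thesis
  proof (cases "l \<le> M")
    case True
    then show ?thesis using step[of l "M - l"] zero[of "Suc M"] by simp
  qed (simp add: zero)
qed

lemma inj_weight: "inj weight"
proof (rule injI)
  fix s t assume eq: "weight s = weight t"
  obtain B where B: "Poly_Mapping.keys s \<union> Poly_Mapping.keys t \<subseteq> {..<B}"
    using finite_nat_iff_bounded[of "Poly_Mapping.keys s \<union> Poly_Mapping.keys t"] by auto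
  then have z: "Poly_Mapping.lookup s i = 0" "Poly_Mapping.lookup t i = 0" if "i \<ge> B" for i
    using that by (metis UnI1 UnI2 in_keys_iff lessThan_iff linorder_not_le subsetD)+
  have w: "weight s i = 0" "weight t i = 0" if "i > B" for i
    using z[of i] z[of "Suc i"] that by (auto simp: weight_def)
  show "s = t"
    using lookup_eq_sum_weight[of B s] lookup_eq_sum_weight[of B t] w eq
    by (intro poly_mapping_eqI) (metis of_nat_eq_iff)
qed

definition cf :: "mps \<Rightarrow> (nat \<Rightarrow> int) \<Rightarrow> complex" where
  "cf P n = (\<Sum>t | weight t = n. coef P t)"

lemma cf_weight [simp]: "cf P (weight t) = coef P t"
proof -
  have "{s. weight s = weight t} = {t}" using injD[OF inj_weight] by auto
  then show ?thesis by (simp add: cf_def)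
qed

lemma cf_eq_0: "n \<notin> range weight \<Longrightarrow> cf P n = 0"
  by (auto simp: cf_def intro!: sum.neutral)

lemma cf_linear:
  "cf (P + Q) n = cf P n + cf Q n" "cf (P - Q) n = cf P n - cf Q n" "cf (cst c * P) n = c * cf P n"
  "cf (sum f A) n = (\<Sum>i\<in>A. cf (f i) n)" "cf 0 n = 0"
  by (cases "n \<in> range weight"; auto simp: cf_eq_0 coef_sum)+

text \<open>If the shifted index is no weight, then no exponent of weight n has e as a summand, and
  both sides vanish.\<close>

lemma cf_mon_mult: "cf (mon e * P) n = cf P (\<lambda>i. n i - weight e i)"
proof (cases "(\<lambda>i. n i - weight e i) \<in> range weight")
  case True
  then obtain t where t: "(\<lambda>i. n i - weight e i) = weight t" by auto
  have "n = weight (e + t)"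
    using fun_cong[OF t] by (intro ext) (simp add: weight_add algebra_simps)
  then have "cf (mon e * P) n = coef P t" by simp
  then show ?thesis by (simp add: t)
next
  case False
  show ?thesis
  proof (cases "n \<in> range weight")
    case True
    then obtain t where t: "n = weight t" by auto
    have "coef (mon e * P) t = 0"
    proof (rule coef_mon_mult_eq_0)
      fix s show "t \<noteq> e + s"
        using False t by (auto simp: weight_add image_iff)
    qed
    then show ?thesis by (simp add: t cf_eq_0[OF False[unfolded t]])
  qed (simp add: cf_eq_0 False)
qed

text \<open>F is its first M + 1 terms plus a multiple of X^(M + 1). That multiple contributes a
  coefficient at n shifted by M + 1 copies of e, where by \<open>out\<close> there is no monomial.
  Thus an infinite expansion becomes a finite sum at each index n.\<close>

lemma cf_ev_mult:
  assumes e: "e \<noteq> 0" and out: "(\<lambda>i. n i - int (Suc M) * weight e i) \<notin> range weight"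
  shows "cf (ev F e * P) n = (\<Sum>a\<le>M. fps_nth F a * cf P (\<lambda>i. n i - int a * weight e i))"
proof -
  have "F = (\<Sum>a\<le>M. fps_const (fps_nth F a) * fps_X ^ a) + fps_X ^ Suc M * fps_shift (Suc M) F"
    by (rule fps_ext)
       (simp add: fps_sum_nth fps_X_power_mult_nth fps_X_power_nth if_distrib not_less
           less_Suc_eq_le
             del: power_Suc cong: if_cong)
  then have "ev F e = ev (\<Sum>a\<le>M. fps_const (fps_nth F a) * fps_X ^ a) e
      + ev (fps_X ^ Suc M * fps_shift (Suc M) F) e"
    by (metis ev_add)
  also have "ev (\<Sum>a\<le>M. fps_const (fps_nth F a) * fps_X ^ a) e = (\<Sum>a\<le>M. cst (fps_nth F a) * mon
      (mul a e))"
    by (simp add: ev_sum ev_const_mult ev_power e mon_mul)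
  also have "ev (fps_X ^ Suc M * fps_shift (Suc M) F) e = mon (mul (Suc M) e) * ev (fps_shift
      (Suc M) F) e"
    by (simp add: ev_mult ev_power e mon_mul del: power_Suc mul.simps)
  finally have "ev F e = (\<Sum>a\<le>M. cst (fps_nth F a) * mon (mul a e))
      + mon (mul (Suc M) e) * ev (fps_shift (Suc M) F) e" .
  then have "cf (ev F e * P) n = (\<Sum>a\<le>M. fps_nth F a * cf (mon (mul a e) * P) n)
      + cf (mon (mul (Suc M) e) * (ev (fps_shift (Suc M) F) e * P)) n"
    by (simp add: ring_distribs sum_distrib_right cf_linear mult.assoc del: mul.simps)
  also have "cf (mon (mul (Suc M) e) * (ev (fps_shift (Suc M) F) e * P)) n = 0"
    by (subst cf_mon_mult, rule cf_eq_0) (use out in \<open>simp add: weight_mul del: mul.simps\<close>)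
  finally show ?thesis by (simp add: cf_mon_mult weight_mul)
qed

section \<open>Euler operators as derivations of the ring of series\<close>

definition euler :: "nat \<Rightarrow> mps \<Rightarrow> mps" where
  "euler k P = Mps (\<lambda>t. of_int (weight t k) * coef P t)"

lemma cf_euler: "cf (euler k P) n = of_int (n k) * cf P n"
  by (cases "n \<in> range weight") (auto simp: cf_eq_0 euler_def)

lemma euler_add: "euler k (P + Q) = euler k P + euler k Q"
  and euler_diff: "euler k (P - Q) = euler k P - euler k Q"
  and euler_minus: "euler k (- P) = - euler k P"
  and euler_0 [simp]: "euler k 0 = 0"
  by (auto intro!: mps_eqI simp: euler_def algebra_simps)

lemma euler_sum: "euler k (sum f A) = (\<Sum>i\<in>A. euler k (f i))"
  by (induction A rule: infinite_finite_induct) (auto simp: euler_add)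

lemma euler_mult: "euler k (P * Q) = euler k P * Q + P * euler k Q"
proof (rule mps_eqI)
  fix t
  have "of_int (weight t k) * (coef P a * coef Q b)
      = of_int (weight a k) * coef P a * coef Q b + coef P a * (of_int (weight b k) * coef Q b)"
    if "(a, b) \<in> decompositions t" for a b
    using that by (auto simp: decompositions_def weight_add algebra_simps)
  then show "coef (euler k (P * Q)) t = coef (euler k P * Q + P * euler k Q) t"
    by (simp add: euler_def coef_mult sum_distrib_left case_prod_unfold sum.distrib[symmetric])
qed

lemma euler_cst [simp]: "euler k (cst c) = 0"
  by (rule mps_eqI) (auto simp: euler_def cst_def weight_def)

lemma euler_1 [simp]: "euler k 1 = 0"
  using euler_cst[of k 1] by simp

lemma euler_ev:
  assumes "e \<noteq> 0"
  shows "euler k (ev F e) = cst (of_int (weight e k)) * ev (fps_X * fps_deriv F) e"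
proof (rule mps_eqI)
  fix t
  show "coef (euler k (ev F e)) t = coef (cst (of_int (weight e k)) * ev (fps_X * fps_deriv F) e) t"
  proof (cases "\<exists>a. t = mul a e")
    case True
    then obtain a where "t = mul a e" by auto
    then show ?thesis using assms
      by (cases a) (auto simp: euler_def coef_ev_mul weight_mul simp del: mul.simps)
  next
    case False
    then show ?thesis by (simp add: euler_def coef_ev_eq_0)
  qed
qed

lemma euler_mon: "e \<noteq> 0 \<Longrightarrow> euler k (mon e) = cst (of_int (weight e k)) * mon e"
  using euler_ev[of e k fps_X] by simp

text \<open>Writing each derivative as a multiple of its factor makes logarithmic derivatives add up
  without dividing by a series.\<close>

lemma euler_prod:
  assumes "finite I" "\<And>i. i \<in> I \<Longrightarrow> euler k (f i) = f i * g i"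
  shows "euler k (prod f I) = prod f I * sum g I"
  using assms by (induction I rule: finite_induct) (auto simp: euler_mult algebra_simps)

section \<open>The kernel_series function identity\<close>

text \<open>The binomial series of (1 - c X) to the power \<mu>.\<close>

definition bps :: "complex \<Rightarrow> complex \<Rightarrow> complex fps" where
  "bps c \<mu> = Abs_fps (\<lambda>a. (\<mu> gchoose a) * (- c) ^ a)"

lemma ev_const: "e \<noteq> 0 \<Longrightarrow> ev (fps_const c) e = cst c"
  using ev_const_mult[of c 1 e] by simp

lemma bps_mult: "bps c a * bps c b = bps c (a + b)"
proof (rule fps_ext)
  fix n
  have "fps_nth (bps c a * bps c b) n
      = (\<Sum>k=0..n. (a gchoose k) * (b gchoose (n - k)) * ((- c) ^ k * (- c) ^ (n - k)))"
    by (simp add: fps_mult_nth bps_def mult_ac)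
  also have "\<dots> = (\<Sum>k=0..n. (a gchoose k) * (b gchoose (n - k))) * (- c) ^ n"
    unfolding sum_distrib_right by (rule sum.cong) (auto simp: power_add[symmetric])
  finally show "fps_nth (bps c a * bps c b) n = fps_nth (bps c (a + b)) n"
    by (simp add: gbinomial_Vandermonde bps_def)
qed

lemma bps_0 [simp]: "bps c 0 = 1"
proof (rule fps_ext)
  fix n show "fps_nth (bps c 0) n = fps_nth 1 n" by (cases n) (auto simp: bps_def)
qed

lemma bps_1: "bps c 1 = 1 - fps_const c * fps_X"
proof (rule fps_ext)
  fix n
  have "(1::complex) gchoose n = of_nat (1 choose n)" by (metis binomial_gbinomial of_nat_1)
  then show "fps_nth (bps c 1) n = fps_nth (1 - fps_const c * fps_X) n"
    by (cases n; cases "n - 1") (auto simp: bps_def fps_X_def)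
qed

lemma fps_X_deriv_bps: "fps_X * fps_deriv (bps c \<mu>) = fps_const (- \<mu> * c) * (fps_X * bps c (\<mu> - 1))"
proof (rule fps_ext)
  fix n
  show "fps_nth (fps_X * fps_deriv (bps c \<mu>)) n = fps_nth (fps_const (- \<mu> * c) * (fps_X * bps c (\<mu>
      - 1))) n"
  proof (cases n)
    case (Suc m)
    have "of_nat (Suc m) * (\<mu> gchoose Suc m) = \<mu> * ((\<mu> - 1) gchoose m)"
      using gbinomial_absorption[of m \<mu>] by simp
    then have "(1 + of_nat m) * ((\<mu> gchoose Suc m) * ((- c) * (- c) ^ m)) = \<mu> * ((\<mu> - 1) gchoose m)
        * ((- c) * (- c) ^ m)"
      by (metis (no_types, lifting) mult.assoc of_nat_Suc)
    then show ?thesis using Suc by (simp add: bps_def algebra_simps)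
  qed simp
qed

definition expT :: "nat \<Rightarrow> exponent" where
  "expT k = Abs_poly_mapping (\<lambda>i. of_bool (i \<le> k))"

text \<open>The product of z_{j+1}, ..., z_k is the quotient of 1 / y_k by 1 / y_j, that is y_j /
  y_k.\<close>

definition expR :: "nat \<Rightarrow> nat \<Rightarrow> exponent" where
  "expR j k = Abs_poly_mapping (\<lambda>i. of_bool (j < i \<and> i \<le> k))"

lemma lookup_expT: "Poly_Mapping.lookup (expT k) i = of_bool (i \<le> k)"
  unfolding expT_def by (subst Abs_poly_mapping_inverse) auto

lemma lookup_expR: "Poly_Mapping.lookup (expR j k) i = of_bool (j < i \<and> i \<le> k)"
  unfolding expR_def by (subst Abs_poly_mapping_inverse) (auto intro: finite_subset[of _ "{..k}"])

lemma expT_nz [simp]: "expT k \<noteq> 0"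
  by (metis lookup_expT lookup_zero le_refl of_bool_eq(2) zero_neq_one)

lemma expR_nz [simp]: "j < k \<Longrightarrow> expR j k \<noteq> 0"
  by (metis lookup_expR lookup_zero le_refl of_bool_eq(2) zero_neq_one)

lemma expR_add: "j < k \<Longrightarrow> k < l \<Longrightarrow> expR j k + expR k l = expR j l"
  by (rule poly_mapping_eqI) (auto simp: lookup_add lookup_expR)

lemma expT_expR: "j < k \<Longrightarrow> expT j + expR j k = expT k"
  by (rule poly_mapping_eqI) (auto simp: lookup_add lookup_expR lookup_expT)

lemma weight_expT: "weight (expT k) i = of_bool (i = k)"
  by (auto simp: weight_def lookup_expT)

lemma weight_expR: "j < k \<Longrightarrow> weight (expR j k) i = of_bool (i = k) - of_bool (i = j)"
  by (auto simp: weight_def lookup_expR)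

text \<open>In terms of the integration variables, \<open>yinv k\<close> is \<open>1 / y\<^sub>k\<close>, \<open>yquot j k\<close> is \<open>y\<^sub>j / y\<^sub>k\<close>,
  \<open>ydiff_inv k l\<close> is \<open>1 / (y\<^sub>k - y\<^sub>l)\<close> and \<open>xdiff_inv x k i\<close> is \<open>1 / (y\<^sub>k - x\<^sub>i)\<close>;
  \<open>euler k\<close> is \<open>- y\<^sub>k \<partial>/\<partial>y\<^sub>k\<close>, so \<open>yinv k * euler k P\<close> is \<open>- \<partial>P/\<partial>y\<^sub>k\<close>.\<close>

definition yinv :: "nat \<Rightarrow> mps" where "yinv k = mon (expT k)"
definition yquot :: "nat \<Rightarrow> nat \<Rightarrow> mps" where "yquot j k = mon (expR j k)"
definition yquot_geom :: "nat \<Rightarrow> nat \<Rightarrow> mps" where "yquot_geom j k = ev (bps 1 (- 1)) (expR j k)"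
definition xgeom :: "(nat \<Rightarrow> complex) \<Rightarrow> nat \<Rightarrow> nat \<Rightarrow> mps" where
  "xgeom x i k = ev (bps (x i) (- 1)) (expT k)"
definition ydiff_inv :: "nat \<Rightarrow> nat \<Rightarrow> mps" where
  "ydiff_inv k l = (if l < k then yinv k * yquot_geom l k
     else if k < l then - (yinv l * yquot_geom k l) else 0)"
definition xdiff_inv :: "(nat \<Rightarrow> complex) \<Rightarrow> nat \<Rightarrow> nat \<Rightarrow> mps" where
  "xdiff_inv x k i = yinv k * xgeom x i k"

definition Rpow :: "complex \<Rightarrow> nat \<Rightarrow> nat \<Rightarrow> mps" where
  "Rpow \<mu> j k = ev (bps 1 \<mu>) (expR j k)"
definition Tpow :: "complex \<Rightarrow> (nat \<Rightarrow> complex) \<Rightarrow> nat \<Rightarrow> nat \<Rightarrow> mps" where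
  "Tpow \<mu> x i k = ev (bps (x i) \<mu>) (expT k)"

text \<open>The number K of integration variables is kept apart from the number N of coordinates, so
  that the integrals can be evaluated by induction on K. The series F of the overview is the case K
  = N.\<close>

definition kernel_series :: "nat \<Rightarrow> complex \<Rightarrow> (nat \<Rightarrow> complex) \<Rightarrow> nat \<Rightarrow> mps" where
  "kernel_series N \<mu> x K = (\<Prod>k=1..K. (\<Prod>j\<in>{1..<k}. Rpow \<mu> j k) * (\<Prod>i=1..N. Tpow (- \<mu>) x i k))"

lemma yquot_geom_inverse: "j < k \<Longrightarrow> yquot_geom j k * (1 - yquot j k) = 1"
proof -
  assume jk: "j < k"
  have "ev (bps 1 (- 1) * bps 1 1) (expR j k) = 1"
    by (simp add: bps_mult jk)
  then show ?thesis by (simp add: yquot_geom_def yquot_def bps_1 ev_mult jk ev_diff)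
qed

lemma xgeom_inverse: "xgeom x i k * (1 - cst (x i) * yinv k) = 1"
proof -
  have "ev (bps (x i) (- 1) * bps (x i) 1) (expT k) = 1"
    by (simp add: bps_mult)
  then show ?thesis by (simp add: xgeom_def yinv_def bps_1 ev_mult ev_diff ev_const_mult)
qed

lemma yquot_yquot_geom: "j < k \<Longrightarrow> yquot j k * yquot_geom j k = yquot_geom j k - 1"
  using yquot_geom_inverse[of j k] by (simp add: algebra_simps)

lemma yinv_xgeom: "cst (x i) * (yinv k * xgeom x i k) = xgeom x i k - 1"
  using xgeom_inverse[of x i k] by (simp add: algebra_simps)

lemma yinv_yquot: "j < k \<Longrightarrow> yinv j * yquot j k = yinv k"
  by (simp add: yinv_def yquot_def mon_add[symmetric] expT_expR)

lemma yquot_yquot: "j < k \<Longrightarrow> k < l \<Longrightarrow> yquot j k * yquot k l = yquot j l"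
  by (simp add: yquot_def mon_add[symmetric] expR_add)

lemma euler_yinv: "euler l (yinv k) = of_bool (l = k) * yinv k"
  by (simp add: yinv_def euler_mon weight_expT)

lemma euler_Rpow:
  "j < k \<Longrightarrow> euler l (Rpow \<mu> j k) = Rpow \<mu> j k * ((of_bool (l = j) - of_bool (l = k)) * (cst \<mu> *
      (yquot j k * yquot_geom j k)))"
proof -
  assume jk: "j < k"
  have "bps 1 (\<mu> - 1) = bps 1 \<mu> * bps 1 (- 1)"
    by (simp add: bps_mult)
  then show ?thesis using jk
    by (auto simp: Rpow_def euler_ev weight_expR fps_X_deriv_bps ev_const_mult ev_mult yquot_def
        yquot_geom_def cst_minus
        simp del: minus_mult_minus)
qed

lemma euler_Tpow:
  "euler l (Tpow \<mu> x i k) = Tpow \<mu> x i k * (of_bool (l = k) * (cst (- \<mu>) * (cst (x i) * (yinv k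
      * xgeom x i k))))"
proof -
  have "bps (x i) (\<mu> - 1) = bps (x i) \<mu> * bps (x i) (- 1)"
    by (simp add: bps_mult)
  then show ?thesis
    by (auto simp: Tpow_def euler_ev weight_expT fps_X_deriv_bps ev_const_mult ev_mult yinv_def
        xgeom_def cst_minus cst_mult ev_const mult_ac)
qed

lemma yquot_geom_Rpow: "yquot_geom j k = Rpow (- 1) j k" and xgeom_Tpow: "xgeom x i k = Tpow
    (- 1) x i k"
  by (simp_all add: yquot_geom_def xgeom_def Rpow_def Tpow_def)

lemma euler_yquot_geom: "j < k \<Longrightarrow> euler l (yquot_geom j k) = (of_bool (l = k) - of_bool (l = j)) *
    (yquot j k * yquot_geom j k * yquot_geom j k)"
  by (auto simp: euler_Rpow yquot_geom_Rpow cst_minus)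

lemma euler_xgeom: "euler l (xgeom x i k) = of_bool (l = k) * (cst (x i) * yinv k * xgeom x i k
    * xgeom x i k)"
  by (auto simp: euler_Tpow xgeom_Tpow cst_minus)

lemma ydiff_inv_same [simp]: "ydiff_inv k k = 0" and ydiff_inv_antisym: "ydiff_inv k l =
    - ydiff_inv l k"
  by (auto simp: ydiff_inv_def)

text \<open>With \<open>yinv k * euler k\<close> read as - d/dy_k, this is the derivative of 1 /
  (y_k - y_l). The two orders of k and l are computed separately because only the ratio with the
  smaller index on top is a monomial of the ring.\<close>

lemma yinv_euler_ydiff_inv: "yinv k * euler k (ydiff_inv k l) = ydiff_inv k l * ydiff_inv k l"
proof -
  consider "l < k" | "k < l" | "k = l" by linarith
  then show ?thesis
  proof cases
    case 1
    then have "yinv k * euler k (ydiff_inv k l) = yinv k * (yinv k * yquot_geom l k + yinv k *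
        ((yquot l k * yquot_geom l k) * yquot_geom l k))"
      by (simp add: ydiff_inv_def euler_mult euler_yinv euler_yquot_geom)
    then show ?thesis using 1 by (simp add: yquot_yquot_geom ydiff_inv_def algebra_simps)
  next
    case 2
    then have "yinv k * euler k (ydiff_inv k l) = (yinv k * yquot k l) * yinv l * (yquot_geom k l
        * yquot_geom k l)"
      by (simp add: ydiff_inv_def euler_mult euler_yinv euler_yquot_geom euler_minus algebra_simps)
    then show ?thesis using 2 by (simp add: yinv_yquot ydiff_inv_def algebra_simps)
  qed simp
qed

lemma yinv_euler_xdiff_inv: "yinv k * euler k (xdiff_inv x k i) = xdiff_inv x k i * xdiff_inv x k i"
proof -
  have "yinv k * euler k (xdiff_inv x k i) = yinv k * (yinv k * xgeom x i k + yinv k * ((cst (x i) *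
      (yinv k * xgeom x i k)) * xgeom x i k))"
    by (simp add: xdiff_inv_def euler_mult euler_yinv euler_xgeom algebra_simps)
  then show ?thesis unfolding yinv_xgeom by (simp add: xdiff_inv_def algebra_simps)
qed

text \<open>The partial fraction identity that removes three-body terms. As the ring has no
  division, denominators are not cleared; each product is multiplied by the missing factor
  \<open>yquot_geom * (1 - yquot)\<close>, which is 1, and then everything expands to 0.\<close>

lemma ydiff_inv_three_ordered:
  assumes "i < j" "j < k"
  shows "ydiff_inv i j * ydiff_inv i k + ydiff_inv j i * ydiff_inv j k + ydiff_inv k i
      * ydiff_inv k j = 0"
proof -
  have eq: "yquot_geom i j * (1 - yquot i j) = 1" "yquot_geom j k * (1 - yquot j k)
      = 1" "yquot_geom i k * (1 - yquot i j * yquot j k) = 1"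
    using assms yquot_geom_inverse[of i k] by (simp_all add: yquot_geom_inverse yquot_yquot)
  have "yquot_geom i j * yquot_geom i k - yquot_geom i j * yquot_geom j k + yquot j k *
      (yquot_geom i k * yquot_geom j k)
      = yquot_geom i j * yquot_geom i k * (yquot_geom j k * (1 - yquot j k)) - yquot_geom i j
          * yquot_geom j k * (yquot_geom i k * (1 - yquot i j * yquot j k))
        + yquot j k * (yquot_geom i k * yquot_geom j k) * (yquot_geom i j * (1 - yquot i j))"
    by (simp only: eq mult_1_right)
  also have "\<dots> = 0" by (simp add: algebra_simps)
  finally have "yinv j * (yinv j * yquot j k) * (yquot_geom i j * yquot_geom i k - yquot_geom i j
      * yquot_geom j k + yquot j k * (yquot_geom i k * yquot_geom j k)) = 0"
    by simp
  then show ?thesis using assms yinv_yquot[of j k, symmetric] by (simp add: ydiff_inv_def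
      algebra_simps)
qed

lemma ydiff_inv_three:
  assumes "i \<noteq> j" "j \<noteq> k" "i \<noteq> k"
  shows "ydiff_inv i j * ydiff_inv i k + ydiff_inv j i * ydiff_inv j k + ydiff_inv k i
      * ydiff_inv k j = 0"
proof -
  consider "i < j" "j < k" | "i < k" "k < j" | "j < i" "i < k" | "j < k" "k < i" | "k < i" "i < j" |
      "k < j" "j < i"
    using assms by (metis nat_neq_iff)
  then show ?thesis
    by cases (use ydiff_inv_three_ordered[of i j k] ydiff_inv_three_ordered[of i k j]
        ydiff_inv_three_ordered[of j i k]
      ydiff_inv_three_ordered[of j k i] ydiff_inv_three_ordered[of k i j] ydiff_inv_three_ordered[of
          k j i] in \<open>simp_all add: algebra_simps\<close>)
qed

lemma xdiff_inv_xdiff_inv_ordered: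
  assumes "l < k"
  shows "xdiff_inv x k i * xdiff_inv x l i = ydiff_inv k l * (xdiff_inv x l i - xdiff_inv x k i)"
proof -
  let ?k = "xgeom x i k" and ?l = "xgeom x i l"
  have "yinv l * ?l - yinv k * ?k = yinv l * ?l * (?k * (1 - cst (x i) * yinv k)) - yinv k * ?k *
      (?l * (1 - cst (x i) * yinv l))"
    by (simp only: xgeom_inverse mult_1_right)
  also have "\<dots> = ?k * ?l * (yinv l - yinv k)" by (simp add: algebra_simps)
  also have "yinv l - yinv k = yinv l * (1 - yquot l k)" using yinv_yquot[OF assms] by
      (simp add: algebra_simps)
  finally have "ydiff_inv k l * (xdiff_inv x l i - xdiff_inv x k i) = yinv k * ?k * (yinv l * ?l) *
      (yquot_geom l k * (1 - yquot l k))"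
    using assms by (simp add: ydiff_inv_def xdiff_inv_def mult_ac)
  then show ?thesis using yquot_geom_inverse[OF assms] by (simp add: xdiff_inv_def)
qed

lemma xdiff_inv_xdiff_inv: 
  assumes "l \<noteq> k" shows "xdiff_inv x k i * xdiff_inv x l i = - ydiff_inv k l * xdiff_inv x k i
      - ydiff_inv l k * xdiff_inv x l i"
proof (cases "l < k")
  case True
  then show ?thesis using xdiff_inv_xdiff_inv_ordered[OF True, of x i] ydiff_inv_antisym[of k l] by
      (simp add: algebra_simps)
next
  case False
  then have "k < l" using assms by simp
  then show ?thesis using xdiff_inv_xdiff_inv_ordered[OF \<open>k < l\<close>, of x i] ydiff_inv_antisym[of k l]
      by (simp add: algebra_simps)
qed

lemma xdiff_inv_diff: "cst (x i - x j) * (xdiff_inv x k i * xdiff_inv x k j) = xdiff_inv x k i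
    - xdiff_inv x k j"
proof -
  let ?i = "xgeom x i k" and ?j = "xgeom x j k"
  have "xdiff_inv x k i - xdiff_inv x k j
      = yinv k * (?i * (?j * (1 - cst (x j) * yinv k))) - yinv k * (?j * (?i * (1 - cst (x i)
          * yinv k)))"
    by (simp only: xgeom_inverse xdiff_inv_def mult_1_right)
  also have "\<dots> = cst (x i - x j) * (xdiff_inv x k i * xdiff_inv x k j)"
    by (simp add: xdiff_inv_def cst_diff algebra_simps)
  finally show ?thesis by simp
qed

text \<open>The off-diagonal part X of the squares is a sum over triples. Renaming the indices
  cyclically gives three copies of X whose summands add up to the three-term identity, so 3 X = 0.
  The ring is arbitrary because the lemma serves both the series 1 / (y_k - y_l) and, for the ground
  state, the numbers 1 / (x_j - x_k).\<close>

lemma sum_square_of_pair_sum: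
  fixes a :: "'i \<Rightarrow> 'i \<Rightarrow> 'a::comm_ring_1"
  assumes same: "\<And>k. a k k = 0"
    and three: "\<And>k l m. k \<in> I \<Longrightarrow> l \<in> I \<Longrightarrow> m \<in> I \<Longrightarrow> k \<noteq> l \<Longrightarrow> l \<noteq> m \<Longrightarrow> k \<noteq> m \<Longrightarrow>
                  a k l * a k m + a l k * a l m + a m k * a m l = 0"
    and cancel: "\<And>z::'a. 3 * z = 0 \<Longrightarrow> z = 0" and fin: "finite I"
  shows "(\<Sum>k\<in>I. (\<Sum>l\<in>I. a k l)\<^sup>2) = (\<Sum>k\<in>I. \<Sum>l\<in>I. (a k l)\<^sup>2)"
proof -
  define t where "t k l m = (if l = m then 0 else a k l * a k m)" for k l m
  define X where "X = (\<Sum>k\<in>I. \<Sum>l\<in>I. \<Sum>m\<in>I. t k l m)"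
  have square: "(\<Sum>l\<in>I. a k l)\<^sup>2 = (\<Sum>l\<in>I. (a k l)\<^sup>2) + (\<Sum>l\<in>I. \<Sum>m\<in>I. t k l m)" for k
  proof -
    have "(\<Sum>m\<in>I. a k l * a k m) = (a k l)\<^sup>2 + (\<Sum>m\<in>I. t k l m)" if "l \<in> I" for l
    proof -
      have "(\<Sum>m\<in>I - {l}. t k l m) = (\<Sum>m\<in>I - {l}. a k l * a k m)"
        by (rule sum.cong) (auto simp: t_def)
      then show ?thesis using that fin by (simp add: sum.remove[of I l] t_def power2_eq_square)
    qed
    then show ?thesis by (simp add: power2_eq_square sum_product sum.distrib)
  qed
  have X2: "X = (\<Sum>k\<in>I. \<Sum>l\<in>I. \<Sum>m\<in>I. t l m k)"
    unfolding X_def by (subst sum.swap, subst (2) sum.swap, rule refl)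
  have X3: "X = (\<Sum>k\<in>I. \<Sum>l\<in>I. \<Sum>m\<in>I. t m k l)"
    unfolding X2 by (subst sum.swap, subst (2) sum.swap, rule refl)
  have "3 * X = X + X + X" by simp
  also have "\<dots> = (\<Sum>k\<in>I. \<Sum>l\<in>I. \<Sum>m\<in>I. t k l m + t l m k + t m k l)"
    by (subst (3) X3, subst (2) X2, simp add: X_def sum.distrib)
  also have "\<dots> = 0"
  proof (intro sum.neutral ballI)
    fix k l m assume "k \<in> I" "l \<in> I" "m \<in> I"
    then show "t k l m + t l m k + t m k l = 0"
      using three[of k l m] by (auto simp: t_def same mult.commute)
  qed
  finally have "X = 0" by (rule cancel)
  then show ?thesis by (simp add: square sum.distrib X_def)
qed

text \<open>For a k l = 1 / (y_k - y_l) and b k i = 1 / (y_k - x_i) this compares the squared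
  logarithmic gradients of the kernel in y and in x. Expanding the x-squares by \<open>bb\<close>
  yields mixed products of a and b, and these are exactly the cross terms of the y-squares. The sum
  over i \<noteq> j is left for the first-order part of D, the squares of a for the
  potential.\<close>

lemma kernel_sum_identity:
  fixes a :: "'k \<Rightarrow> 'k \<Rightarrow> 'a::comm_ring_1" and b :: "'k \<Rightarrow> 'i \<Rightarrow> 'a"
  assumes same: "\<And>k. a k k = 0"
    and three: "\<And>k l m. k \<in> K \<Longrightarrow> l \<in> K \<Longrightarrow> m \<in> K \<Longrightarrow> k \<noteq> l \<Longrightarrow> l \<noteq> m \<Longrightarrow> k \<noteq> m \<Longrightarrow>
                  a k l * a k m + a l k * a l m + a m k * a m l = 0"
    and bb: "\<And>k l i. k \<in> K \<Longrightarrow> l \<in> K \<Longrightarrow> k \<noteq> l \<Longrightarrow> b k i * b l i = - a k l * b k i - a l k * b l i"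
    and cancel: "\<And>z::'a. 3 * z = 0 \<Longrightarrow> z = 0" and fin: "finite I" "finite K"
  shows "(\<Sum>k\<in>K. ((\<Sum>i\<in>I. b k i) - (\<Sum>l\<in>K. a k l))\<^sup>2)
       = (\<Sum>i\<in>I. (\<Sum>k\<in>K. b k i)\<^sup>2) + (\<Sum>k\<in>K. \<Sum>i\<in>I. \<Sum>j\<in>I - {i}. b k i * b k j)
         + (\<Sum>k\<in>K. \<Sum>l\<in>K. (a k l)\<^sup>2)"
proof -
  have sqI: "(\<Sum>i\<in>I. b k i)\<^sup>2 = (\<Sum>i\<in>I. (b k i)\<^sup>2) + (\<Sum>i\<in>I. \<Sum>j\<in>I - {i}. b k i * b k j)" for k
  proof -
    have "(\<Sum>j\<in>I. b k i * b k j) = (b k i)\<^sup>2 + (\<Sum>j\<in>I - {i}. b k i * b k j)" if "i \<in> I" for i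
      using that fin by (simp add: sum.remove[of I i] power2_eq_square)
    then show ?thesis by (simp add: power2_eq_square sum_product sum.distrib)
  qed
  have sqK: "(\<Sum>k\<in>K. b k i)\<^sup>2 = (\<Sum>k\<in>K. (b k i)\<^sup>2) + (\<Sum>k\<in>K. \<Sum>l\<in>K. - a k l * b k i - a l k
      * b l i)" for i
  proof -
    have "(\<Sum>l\<in>K. b k i * b l i) = (b k i)\<^sup>2 + (\<Sum>l\<in>K. - a k l * b k i - a l k * b l i)" if "k
        \<in> K" for k
    proof -
      have "(\<Sum>l\<in>K. b k i * b l i) = (b k i)\<^sup>2 + (\<Sum>l\<in>K - {k}. b k i * b l i)"
        using that fin by (simp add: sum.remove[of K k] power2_eq_square)
      also have "(\<Sum>l\<in>K - {k}. b k i * b l i) = (\<Sum>l\<in>K - {k}. - a k l * b k i - a l k * b l i)"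
        using that by (intro sum.cong bb) auto
      also have "\<dots> = (\<Sum>l\<in>K. - a k l * b k i - a l k * b l i)"
        using that fin by (simp add: sum.remove[of K k] same)
      finally show ?thesis .
    qed
    then show ?thesis by (simp add: power2_eq_square sum_product sum.distrib)
  qed
  have sym: "(\<Sum>i\<in>I. \<Sum>k\<in>K. \<Sum>l\<in>K. a l k * b l i) = (\<Sum>i\<in>I. \<Sum>k\<in>K. \<Sum>l\<in>K. a k l * b k i)"
    by (rule sum.cong[OF refl]) (rule sum.swap)
  have cross: "(\<Sum>k\<in>K. (\<Sum>i\<in>I. b k i) * (\<Sum>l\<in>K. a k l)) = (\<Sum>i\<in>I. \<Sum>k\<in>K. \<Sum>l\<in>K. a k l * b k i)"
  proof -
    have "(\<Sum>k\<in>K. (\<Sum>i\<in>I. b k i) * (\<Sum>l\<in>K. a k l)) = (\<Sum>k\<in>K. \<Sum>i\<in>I. \<Sum>l\<in>K. a k l * b k i)"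
      by (simp add: sum_product mult.commute)
    then show ?thesis by (subst sum.swap)
  qed
  have "(\<Sum>k\<in>K. ((\<Sum>i\<in>I. b k i) - (\<Sum>l\<in>K. a k l))\<^sup>2)
      = (\<Sum>k\<in>K. (\<Sum>i\<in>I. b k i)\<^sup>2) + (\<Sum>k\<in>K. (\<Sum>l\<in>K. a k l)\<^sup>2) - 2 * (\<Sum>k\<in>K. (\<Sum>i\<in>I. b k i) *
          (\<Sum>l\<in>K. a k l))"
    by (simp add: power2_diff sum.distrib sum_subtractf sum_distrib_left[of 2 _ K] mult.assoc)
  also have "(\<Sum>k\<in>K. (\<Sum>l\<in>K. a k l)\<^sup>2) = (\<Sum>k\<in>K. \<Sum>l\<in>K. (a k l)\<^sup>2)"
    by (rule sum_square_of_pair_sum[OF same three cancel fin(2)])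
  also have "(\<Sum>k\<in>K. (\<Sum>i\<in>I. b k i)\<^sup>2) = (\<Sum>i\<in>I. \<Sum>k\<in>K. (b k i)\<^sup>2) + (\<Sum>k\<in>K. \<Sum>i\<in>I. \<Sum>j\<in>I - {i}. b k i
      * b k j)"
    by (subst sum.swap) (simp add: sqI sum.distrib)
  also have "(\<Sum>i\<in>I. \<Sum>k\<in>K. (b k i)\<^sup>2) = (\<Sum>i\<in>I. (\<Sum>k\<in>K. b k i)\<^sup>2) + 2 * (\<Sum>k\<in>K. (\<Sum>i\<in>I. b k i) *
      (\<Sum>l\<in>K. a k l))"
    unfolding cross by (simp add: sqK sum.distrib sum_subtractf sum_negf sym)
  finally show ?thesis by (simp add: algebra_simps)
qed

lemma mps_3_cancel: "3 * z = 0 \<Longrightarrow> z = (0::mps)"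
  using cst_cancel[of 3 z] cst_of_nat[of 3] by simp

section \<open>The Calogero operator in the integration variables\<close>

definition K_shift :: "nat \<Rightarrow> complex \<Rightarrow> nat \<Rightarrow> complex" where
  "K_shift N \<mu> k = \<mu> * (of_nat N + 1 - of_nat k)"

text \<open>In the kernel, y_k can be pulled out of k - 1 factors of the numerator and N of the
  denominator, so the kernel is F times the product of the powers y_k^(- K_shift). Conjugating - y_k
  d/dy_k by this power adds \<open>K_shift\<close>, the same shift as in \<open>m_tilde\<close>. If
  T denotes the result, (T T + T) / y_k^2 is the conjugated second derivative in y_k.\<close>

definition tilde :: "nat \<Rightarrow> complex \<Rightarrow> nat \<Rightarrow> mps \<Rightarrow> mps" where
  "tilde N \<mu> k P = euler k P + cst (K_shift N \<mu> k) * P"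

definition logd :: "nat \<Rightarrow> complex \<Rightarrow> (nat \<Rightarrow> complex) \<Rightarrow> nat \<Rightarrow> nat \<Rightarrow> mps" where
  "logd N \<mu> x K k = cst \<mu> * ((\<Sum>j\<in>{k<..K}. yquot k j * yquot_geom k j) - (\<Sum>j\<in>{1..<k}. yquot j k
      * yquot_geom j k)
       + (\<Sum>i=1..N. cst (x i) * xdiff_inv x k i))"

lemma euler_kernel:
  assumes "k \<in> {1..K}"
  shows "euler k (kernel_series N \<mu> x K) = kernel_series N \<mu> x K * logd N \<mu> x K k"
proof -
  let ?gR = "\<lambda>j l. (of_bool (k = j) - of_bool (k = l)) * (cst \<mu> * (yquot j l * yquot_geom j l))"
  let ?gT = "\<lambda>i l. of_bool (k = l) * (cst \<mu> * (cst (x i) * (yinv l * xgeom x i l)))"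
  have inner: "euler k ((\<Prod>j\<in>{1..<l}. Rpow \<mu> j l) * (\<Prod>i=1..N. Tpow (- \<mu>) x i l))
      = ((\<Prod>j\<in>{1..<l}. Rpow \<mu> j l) * (\<Prod>i=1..N. Tpow (- \<mu>) x i l))
        * ((\<Sum>j\<in>{1..<l}. ?gR j l) + (\<Sum>i=1..N. ?gT i l))" for l
  proof -
    have "euler k (\<Prod>j\<in>{1..<l}. Rpow \<mu> j l) = (\<Prod>j\<in>{1..<l}. Rpow \<mu> j l) * (\<Sum>j\<in>{1..<l}. ?gR j l)"
      by (rule euler_prod) (auto simp: euler_Rpow)
    moreover have "euler k (\<Prod>i=1..N. Tpow (- \<mu>) x i l) = (\<Prod>i=1..N. Tpow (- \<mu>) x i l) *
        (\<Sum>i=1..N. ?gT i l)"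
      by (rule euler_prod) (auto simp: euler_Tpow)
    ultimately show ?thesis by (simp add: euler_mult algebra_simps)
  qed
  have "euler k (kernel_series N \<mu> x K) = kernel_series N \<mu> x K * (\<Sum>l=1..K. (\<Sum>j\<in>{1..<l}. ?gR j l) +
      (\<Sum>i=1..N. ?gT i l))"
    unfolding kernel_series_def by (rule euler_prod) (simp_all only: finite_atLeastAtMost inner)
  also have "(\<Sum>l=1..K. (\<Sum>j\<in>{1..<l}. ?gR j l) + (\<Sum>i=1..N. ?gT i l)) = logd N \<mu> x K k"
  proof -
    have gT: "(\<Sum>l=1..K. \<Sum>i=1..N. ?gT i l) = cst \<mu> * (\<Sum>i=1..N. cst (x i) * xdiff_inv x k i)"
    proof -
      have "(\<Sum>l=1..K. \<Sum>i=1..N. ?gT i l) = (\<Sum>l\<in>{k}. \<Sum>i=1..N. ?gT i l)"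
        using assms by (intro sum.mono_neutral_right) auto
      then show ?thesis by (simp add: xdiff_inv_def sum_distrib_left)
    qed
    have gR: "(\<Sum>l=1..K. \<Sum>j\<in>{1..<l}. ?gR j l)
        = cst \<mu> * (\<Sum>j\<in>{k<..K}. yquot k j * yquot_geom k j) - cst \<mu> * (\<Sum>j\<in>{1..<k}. yquot j k
            * yquot_geom j k)"
    proof -
      have "(\<Sum>l=1..K. \<Sum>j\<in>{1..<l}. ?gR j l)
          = (\<Sum>l=1..K. \<Sum>j\<in>{1..<l}. of_bool (k = j) * (cst \<mu> * (yquot j l * yquot_geom j l)))
          - (\<Sum>l=1..K. \<Sum>j\<in>{1..<l}. of_bool (k = l) * (cst \<mu> * (yquot j l * yquot_geom j l)))"
        by (simp add: sum_subtractf left_diff_distrib)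
      also have "(\<Sum>l=1..K. \<Sum>j\<in>{1..<l}. of_bool (k = l) * (cst \<mu> * (yquot j l * yquot_geom j l)))
          = (\<Sum>l\<in>{k}. \<Sum>j\<in>{1..<l}. of_bool (k = l) * (cst \<mu> * (yquot j l * yquot_geom j l)))"
        using assms by (intro sum.mono_neutral_right) auto
      also have "\<dots> = cst \<mu> * (\<Sum>j\<in>{1..<k}. yquot j k * yquot_geom j k)" by (simp add: sum_distrib_left)
      also have "(\<Sum>l=1..K. \<Sum>j\<in>{1..<l}. of_bool (k = j) * (cst \<mu> * (yquot j l * yquot_geom j l)))
          = (\<Sum>l\<in>{k<..K}. \<Sum>j\<in>{1..<l}. of_bool (k = j) * (cst \<mu> * (yquot j l * yquot_geom j l)))"
        using assms by (intro sum.mono_neutral_right) (auto intro!: sum.neutral)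
      also have "\<dots> = (\<Sum>l\<in>{k<..K}. \<Sum>j\<in>{k}. of_bool (k = j) * (cst \<mu> * (yquot j l * yquot_geom j l)))"
        using assms by (intro sum.cong[OF refl] sum.mono_neutral_right) auto
      also have "\<dots> = cst \<mu> * (\<Sum>j\<in>{k<..K}. yquot k j * yquot_geom k j)" by (simp add: sum_distrib_left)
      finally show ?thesis .
    qed
    show ?thesis unfolding sum.distrib gR gT logd_def by (simp add: algebra_simps)
  qed
  finally show ?thesis .
qed

lemma yinv_tilde_log:
  assumes "k \<in> {1..K}"
  shows "yinv k * (logd N \<mu> x K k + cst (K_shift N \<mu> k))
       = cst \<mu> * ((\<Sum>i=1..N. xdiff_inv x k i) - (\<Sum>l=1..K. ydiff_inv k l))"
proof -
  have K: "cst (K_shift N \<mu> k) = cst \<mu> * (of_nat N - of_nat (k - 1))"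
  proof -
    have "K_shift N \<mu> k = \<mu> * (of_nat N - of_nat (k - 1))"
      using assms by (simp add: K_shift_def of_nat_diff)
    then show ?thesis by (simp only: cst_mult cst_diff cst_of_nat)
  qed
  have 1: "yinv k * (of_nat N + (\<Sum>i=1..N. cst (x i) * xdiff_inv x k i)) =
      (\<Sum>i=1..N. xdiff_inv x k i)"
  proof -
    have "yinv k * (1 + cst (x i) * xdiff_inv x k i) = xdiff_inv x k i" for i
      by (simp add: xdiff_inv_def yinv_xgeom distrib_left)
    moreover have "of_nat N + (\<Sum>i=1..N. cst (x i) * xdiff_inv x k i) = (\<Sum>i=1..N. 1 + cst (x i)
        * xdiff_inv x k i)"
      by (simp add: sum.distrib)
    ultimately show ?thesis by (simp add: sum_distrib_left)
  qed
  have 2: "yinv k * (of_nat (k - 1) + (\<Sum>j\<in>{1..<k}. yquot j k * yquot_geom j k)) =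
      (\<Sum>l\<in>{1..<k}. ydiff_inv k l)"
  proof -
    have "yinv k * (1 + yquot j k * yquot_geom j k) = ydiff_inv k j" if "j < k" for j
      using that by (simp add: ydiff_inv_def yquot_yquot_geom)
    moreover have "of_nat (k - 1) + (\<Sum>j\<in>{1..<k}. yquot j k * yquot_geom j k) = (\<Sum>j\<in>{1..<k}. 1
        + yquot j k * yquot_geom j k)"
      by (simp add: sum.distrib)
    ultimately show ?thesis by (simp add: sum_distrib_left)
  qed
  have 3: "yinv k * (\<Sum>j\<in>{k<..K}. yquot k j * yquot_geom k j) = - (\<Sum>l\<in>{k<..K}. ydiff_inv k l)"
  proof -
    have "yinv k * (yquot k j * yquot_geom k j) = - ydiff_inv k j" if "k < j" for j
      using yinv_yquot[OF that] that by (simp add: ydiff_inv_def) (metis mult.assoc)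
    then show ?thesis by (simp add: sum_distrib_left sum_negf[symmetric])
  qed
  have "{1..K} = insert k ({1..<k} \<union> {k<..K})" using assms by auto
  then have 4: "(\<Sum>l=1..K. ydiff_inv k l) = (\<Sum>l\<in>{1..<k}. ydiff_inv k l) + (\<Sum>l\<in>{k<..K}. ydiff_inv k
      l)"
    by simp (subst sum.union_disjoint, auto)
  show ?thesis unfolding K logd_def 4 1[symmetric] 2[symmetric] using 3
    by (simp add: algebra_simps)
qed

text \<open>The left side is D F with the poles at x_i = x_j already divided out. On the right, a
  second derivative is F times a squared logarithmic gradient plus a derivative of that gradient.
  \<open>kernel_sum_identity\<close> matches the squares; they leave \<mu>^2 copies of 1 / (y_k -
  y_l)^2 and the derivatives take away \<mu>, hence the coupling \<mu> (\<mu> - 1).\<close>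

theorem kernel_function_identity:
  "kernel_series N \<mu> x K
     * ((\<Sum>i=1..N. (cst \<mu> * (\<Sum>k=1..K. xdiff_inv x k i))\<^sup>2 + cst \<mu> * (\<Sum>k=1..K. (xdiff_inv x k i)\<^sup>2))
        + (cst \<mu>)\<^sup>2 * (\<Sum>k=1..K. \<Sum>i=1..N. \<Sum>j\<in>{1..N} - {i}. xdiff_inv x k i * xdiff_inv x k j))
   = (\<Sum>k=1..K. yinv k * yinv k * (tilde N \<mu> k (tilde N \<mu> k (kernel_series N \<mu> x K)) + tilde N \<mu> k
       (kernel_series N \<mu> x K)))
     - cst (\<mu> * (\<mu> - 1)) * (\<Sum>k=1..K. \<Sum>l=1..K. (ydiff_inv k l)\<^sup>2) * kernel_series N \<mu> x K"
proof -
  define F where "F = kernel_series N \<mu> x K"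
  define H where "H k = (\<Sum>i=1..N. xdiff_inv x k i) - (\<Sum>l=1..K. ydiff_inv k l)" for k
  have main: "yinv k * yinv k * (tilde N \<mu> k (tilde N \<mu> k F) + tilde N \<mu> k F)
     = F * ((cst \<mu>)\<^sup>2 * (H k)\<^sup>2 + cst \<mu> * ((\<Sum>i=1..N. (xdiff_inv x k i)\<^sup>2) - (\<Sum>l=1..K.
         (ydiff_inv k l)\<^sup>2)))"
    if k: "k \<in> {1..K}" for k
  proof -
    define g where "g = logd N \<mu> x K k"
    define c where "c = cst (K_shift N \<mu> k)"
    have eF: "euler k F = F * g" using euler_kernel[OF k] by (simp add: F_def g_def)
    have ec: "euler k c = 0" by (simp add: c_def)
    have Th: "yinv k * (g + c) = cst \<mu> * H k"
      using yinv_tilde_log[OF k, of N \<mu> x] by (simp add: g_def c_def H_def)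
    have eT: "euler k (yinv k) = yinv k" by (simp add: euler_yinv)
    have "yinv k * euler k (yinv k * (g + c)) = cst \<mu> * (yinv k * euler k (H k))"
      unfolding Th by (simp add: euler_mult mult_ac)
    also have "yinv k * euler k (H k) = (\<Sum>i=1..N. (xdiff_inv x k i)\<^sup>2) - (\<Sum>l=1..K.
        (ydiff_inv k l)\<^sup>2)"
      by (simp add: H_def euler_diff euler_sum right_diff_distrib sum_distrib_left
          yinv_euler_ydiff_inv yinv_euler_xdiff_inv
          power2_eq_square)
    finally have TeT: "yinv k * euler k (yinv k * (g + c)) = cst \<mu> * ((\<Sum>i=1..N. (xdiff_inv x k i)\<^sup>2)
        - (\<Sum>l=1..K. (ydiff_inv k l)\<^sup>2))" .
    \<comment> \<open>The Euler operator also hits the prefactor \<open>yinv k\<close>; this extra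
      term accounts for the single \<open>tilde\<close> beside the double one.\<close>
    have eTh: "euler k (yinv k * (g + c)) = yinv k * (g + c) + yinv k * euler k g"
      by (simp add: euler_mult euler_add ec eT)
    have t1: "tilde N \<mu> k P = euler k P + c * P" for P by (simp add: tilde_def c_def)
    have "yinv k * yinv k * (tilde N \<mu> k (tilde N \<mu> k F) + tilde N \<mu> k F)
        = F * ((yinv k * (g + c))\<^sup>2 + yinv k * euler k (yinv k * (g + c)))"
      unfolding eTh t1 by (simp add: eF euler_add euler_mult ec power2_eq_square algebra_simps)
    then show ?thesis by (simp only: TeT, simp only: Th power_mult_distrib)
  qed
  have "(\<Sum>k=1..K. yinv k * yinv k * (tilde N \<mu> k (tilde N \<mu> k F) + tilde N \<mu> k F))
      = F * ((cst \<mu>)\<^sup>2 * (\<Sum>k=1..K. (H k)\<^sup>2)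
        + cst \<mu> * ((\<Sum>k=1..K. \<Sum>i=1..N. (xdiff_inv x k i)\<^sup>2) - (\<Sum>k=1..K. \<Sum>l=1..K.
            (ydiff_inv k l)\<^sup>2)))"
    by (simp add: main sum_distrib_left[symmetric] sum.distrib sum_subtractf)
  also have "(\<Sum>k=1..K. (H k)\<^sup>2)
      = (\<Sum>i=1..N. (\<Sum>k=1..K. xdiff_inv x k i)\<^sup>2) + (\<Sum>k=1..K. \<Sum>i=1..N. \<Sum>j\<in>{1..N}
          - {i}. xdiff_inv x k i * xdiff_inv x k j)
         + (\<Sum>k=1..K. \<Sum>l=1..K. (ydiff_inv k l)\<^sup>2)"
    unfolding H_def
  proof (rule kernel_sum_identity)
    show "ydiff_inv k l * ydiff_inv k m + ydiff_inv l k * ydiff_inv l m + ydiff_inv m k * ydiff_inv m l = 0"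
      if "k \<noteq> l" "l \<noteq> m" "k \<noteq> m" for k l m
      using that by (rule ydiff_inv_three)
    show "xdiff_inv x k i * xdiff_inv x l i = - ydiff_inv k l * xdiff_inv x k i - ydiff_inv l k * xdiff_inv x l i"
      if "k \<noteq> l" for k l i
      using that[symmetric] by (rule xdiff_inv_xdiff_inv)
    show "z = 0" if "3 * z = 0" for z :: mps using that by (rule mps_3_cancel)
  qed simp_all
  also have "(\<Sum>k=1..K. \<Sum>i=1..N. (xdiff_inv x k i)\<^sup>2) = (\<Sum>i=1..N. \<Sum>k=1..K. (xdiff_inv x k i)\<^sup>2)"
    by (rule sum.swap)
  finally show ?thesis
    by (simp add: F_def cst_mult cst_diff sum.distrib power_mult_distrib sum_distrib_left[symmetric]
        power2_eq_square algebra_simps)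
qed

section \<open>The contour integrals as coefficients of the kernel_series function\<close>

definition torus :: "(nat \<Rightarrow> real) \<Rightarrow> nat \<Rightarrow> (nat \<Rightarrow> complex) set" where
  "torus r k = {y. \<forall>j\<in>{1..k}. cmod (y j) = r j}"

text \<open>Unlike the total function \<open>circle_integrals\<close>, the relation asserts that
  every inner integral exists, so linearity holds without integrability conditions. G has to be the
  inner integral only where the remaining variables lie on their circles, since the expansions are
  valid there.\<close>

fun has_circle_integrals ::
  "(nat \<Rightarrow> real) \<Rightarrow> (nat \<Rightarrow> int) \<Rightarrow> nat \<Rightarrow> ((nat \<Rightarrow> complex) \<Rightarrow> complex) \<Rightarrow> complex \<Rightarrow> bool" where
  "has_circle_integrals r n 0 F v \<longleftrightarrow> F (\<lambda>_. 0) = v"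
| "has_circle_integrals r n (Suc k) F v \<longleftrightarrow>
     (\<exists>G. (\<forall>y\<in>torus r k. ((\<lambda>z. 1 / (2 * of_real pi * \<i> * z) * z powi n (Suc k) * F (y(Suc k := z)))
             has_contour_integral G y) (circlepath 0 (r (Suc k)))) \<and> has_circle_integrals r n k G
               v)"

lemma torus_upd: "y \<in> torus r k \<Longrightarrow> cmod z = r (Suc k) \<Longrightarrow> y(Suc k := z) \<in> torus r (Suc k)"
  by (auto simp: torus_def)

lemma has_circle_integrals_cong:
  assumes "\<And>j. j \<in> {1..k} \<Longrightarrow> r j > 0" "\<And>y. y \<in> torus r k \<Longrightarrow> F y = G y"
    "\<And>j. j \<in> {1..k} \<Longrightarrow> n j = n' j"
    "has_circle_integrals r n k F v"
  shows "has_circle_integrals r n' k G v"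
  using assms
proof (induction k arbitrary: F G)
  case 0
  have "(\<lambda>_. 0) \<in> torus r 0" by (simp add: torus_def)
  then show ?case using 0 by simp
next
  case (Suc k)
  obtain H where H: "\<And>y. y \<in> torus r k \<Longrightarrow> ((\<lambda>z. 1 / (2 * of_real pi * \<i> * z) * z powi n (Suc k) * F
      (y(Suc k := z)))
             has_contour_integral H y) (circlepath 0 (r (Suc k)))" "has_circle_integrals r n k H v"
    using Suc.prems(4) by auto
  have "((\<lambda>z. 1 / (2 * of_real pi * \<i> * z) * z powi n' (Suc k) * G (y(Suc k := z)))
             has_contour_integral H y) (circlepath 0 (r (Suc k)))" if y: "y \<in> torus r k" for y
  proof -
    have "F (y(Suc k := z)) = G (y(Suc k := z))" if "z \<in> path_image (circlepath 0 (r
        (Suc k)))" for z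
      using that Suc.prems(1)[of "Suc k"] by (intro Suc.prems(2) torus_upd y) auto
    then show ?thesis
      using H(1)[OF y] Suc.prems(3)[of "Suc k"] by (subst has_contour_integral_cong[OF _ refl refl])
          auto
  qed
  moreover have "has_circle_integrals r n' k H v"
    by (rule Suc.IH[OF _ _ _ H(2)]) (use Suc.prems in auto)
  ultimately show ?case by auto
qed

lemma circle_integrals_unique:
  assumes "\<And>j. j \<in> {1..k} \<Longrightarrow> r j > 0" "has_circle_integrals r n k F v"
  shows "circle_integrals r n k F = v"
  using assms
proof (induction k arbitrary: F)
  case (Suc k)
  obtain H where H: "\<And>y. y \<in> torus r k \<Longrightarrow> ((\<lambda>z. 1 / (2 * of_real pi * \<i> * z) * z powi n (Suc k) * F
      (y(Suc k := z)))
             has_contour_integral H y) (circlepath 0 (r (Suc k)))" "has_circle_integrals r n k H v"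
    using Suc.prems(2) by auto
  have "has_circle_integrals r n k (\<lambda>y. contour_integral (circlepath 0 (r (Suc k)))
      (\<lambda>z. 1 / (2 * of_real pi * \<i> * z) * z powi n (Suc k) * F (y(Suc k := z)))) v"
    by (rule has_circle_integrals_cong[OF _ _ refl H(2)])
       (use Suc.prems(1) contour_integral_unique[OF H(1)] in auto)
  then show ?case using Suc by simp
qed simp

lemma has_circle_integrals_0: "has_circle_integrals r n k (\<lambda>_. 0) 0"
proof (induction k)
  case (Suc k)
  then show ?case by (auto intro!: exI[of _ "\<lambda>_. 0"] has_contour_integral_is_0)
qed simp

lemma has_circle_integrals_add:
  "has_circle_integrals r n k F v \<Longrightarrow> has_circle_integrals r n k G w \<Longrightarrow>
   has_circle_integrals r n k (\<lambda>y. F y + G y) (v + w)"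
proof (induction k arbitrary: F G)
  case (Suc k)
  then obtain H I where "has_circle_integrals r n k H v" "has_circle_integrals r n k I w"
    and "\<And>y. y \<in> torus r k \<Longrightarrow> ((\<lambda>z. 1 / (2 * of_real pi * \<i> * z) * z powi n (Suc k) * F
        (y(Suc k := z)))
             has_contour_integral H y) (circlepath 0 (r (Suc k)))"
    "\<And>y. y \<in> torus r k \<Longrightarrow> ((\<lambda>z. 1 / (2 * of_real pi * \<i> * z) * z powi n (Suc k) * G (y(Suc k := z)))
             has_contour_integral I y) (circlepath 0 (r (Suc k)))" by auto
  then show ?case unfolding has_circle_integrals.simps
    by (intro exI[of _ "\<lambda>y. H y + I y"])
       (auto intro: Suc.IH simp: distrib_left intro!: has_contour_integral_add)
qed simp

lemma has_circle_integrals_cmult: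
  "has_circle_integrals r n k F v \<Longrightarrow> has_circle_integrals r n k (\<lambda>y. c * F y) (c * v)"
proof (induction k arbitrary: F)
  case (Suc k)
  then obtain H where H: "has_circle_integrals r n k H v"
    and c: "\<And>y. y \<in> torus r k \<Longrightarrow> ((\<lambda>z. 1 / (2 * of_real pi * \<i> * z) * z powi n (Suc k) * F
        (y(Suc k := z)))
             has_contour_integral H y) (circlepath 0 (r (Suc k)))" by auto
  have "((\<lambda>z. 1 / (2 * of_real pi * \<i> * z) * z powi n (Suc k) * (c * F (y(Suc k := z))))
             has_contour_integral (c * H y)) (circlepath 0 (r (Suc k)))" if "y \<in> torus r k" for y
    using has_contour_integral_lmul[OF c[OF that], of c] by (simp add: mult_ac)
  then show ?case unfolding has_circle_integrals.simps using Suc.IH[OF H]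
    by (intro exI[of _ "\<lambda>y. c * H y"]) simp
qed simp

lemma has_circle_integrals_sum:
  "finite I \<Longrightarrow> (\<And>i. i \<in> I \<Longrightarrow> has_circle_integrals r n k (F i) (v i)) \<Longrightarrow>
   has_circle_integrals r n k (\<lambda>y. \<Sum>i\<in>I. F i y) (\<Sum>i\<in>I. v i)"
  by (induction I rule: finite_induct) (auto intro: has_circle_integrals_0 has_circle_integrals_add)

lemma has_circle_integrals_monomial:
  assumes "\<And>j. j \<in> {1..k} \<Longrightarrow> r j > 0" "j \<in> {1..k}"
    "has_circle_integrals r (n(j := n j + int b)) k F v"
  shows "has_circle_integrals r n k (\<lambda>y. y j ^ b * F y) v"
  using assms
proof (induction k arbitrary: F)
  case (Suc k)
  let ?n = "n(j := n j + int b)"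
  obtain H where H: "has_circle_integrals r ?n k H v"
    and c: "\<And>y. y \<in> torus r k \<Longrightarrow> ((\<lambda>z. 1 / (2 * of_real pi * \<i> * z) * z powi ?n (Suc k) * F
        (y(Suc k := z)))
             has_contour_integral H y) (circlepath 0 (r (Suc k)))" using Suc.prems(3) unfolding
               has_circle_integrals.simps by blast
  show ?case
  proof (cases "j = Suc k")
    case True
    have "((\<lambda>z. 1 / (2 * of_real pi * \<i> * z) * z powi n (Suc k) * ((y(Suc k := z)) j ^ b * F
        (y(Suc k := z))))
             has_contour_integral H y) (circlepath 0 (r (Suc k)))" if y: "y \<in> torus r k" for y
    proof (rule iffD1[OF has_contour_integral_cong[OF _ refl refl] c[OF y]])
      fix z assume "z \<in> path_image (circlepath 0 (r (Suc k)))"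
      then have "z \<noteq> 0" using Suc.prems(1)[of "Suc k"] by auto
      then show "1 / (2 * of_real pi * \<i> * z) * z powi ?n (Suc k) * F (y(Suc k := z))
          = 1 / (2 * of_real pi * \<i> * z) * z powi n (Suc k) * ((y(Suc k := z)) j ^ b * F
              (y(Suc k := z)))"
        using True by (simp add: power_int_add)
    qed
    moreover have "has_circle_integrals r n k H v"
      by (rule has_circle_integrals_cong[OF _ refl _ H]) (use Suc.prems True in auto)
    ultimately show ?thesis by auto
  next
    case False
    have "((\<lambda>z. 1 / (2 * of_real pi * \<i> * z) * z powi n (Suc k) * ((y(Suc k := z)) j ^ b * F
        (y(Suc k := z))))
             has_contour_integral (y j ^ b * H y)) (circlepath 0 (r (Suc k)))" if "y
               \<in> torus r k" for y
      using has_contour_integral_lmul[OF c[OF that], of "y j ^ b"] False by (simp add: mult_ac)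
    moreover have "has_circle_integrals r n k (\<lambda>y. y j ^ b * H y) v"
    proof (rule Suc.IH)
      show "has_circle_integrals r (n(j := n j + int b)) k H v" by (rule H)
    qed (use Suc.prems False in auto)
    ultimately show ?thesis unfolding has_circle_integrals.simps
      by (intro exI[of _ "\<lambda>y. y j ^ b * H y"] conjI ballI)
  qed
qed simp

section \<open>Cauchy's coefficient formula in the variable 1 / z\<close>

lemma has_contour_integral_inversion:
  assumes f: "(f has_contour_integral c) (circlepath 0 (1 / r))" and r: "r > 0"
  shows "((\<lambda>z. f (1 / z) / z\<^sup>2) has_contour_integral c) (circlepath 0 r)"
proof -
  let ?g = "\<lambda>t. f (circlepath 0 (1 / r) t) * vector_derivative (circlepath 0 (1 / r)) (at t)"
  \<comment> \<open>Inversion reverses the orientation of the circle; replacing t by 1 - t restores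
    it, and the sign this costs cancels the one in d(1 / z) = - dz / z^2.\<close>
  have "((\<lambda>t. ?g (-1 * t + 1)) has_integral c) {0..1}"
    using has_integral_affinity01[OF f[unfolded has_contour_integral], of "-1" 1] by simp
  moreover have "?g (-1 * t + 1) = f (1 / circlepath 0 r t) / (circlepath 0 r t)\<^sup>2
      * vector_derivative (circlepath 0 r) (at t)"
    for t
  proof -
    define E where "E = exp (2 * of_real pi * \<i> * of_real t)"
    have E: "E \<noteq> 0" by (simp add: E_def)
    have "exp (2 * of_real pi * \<i> * of_real (1 - t)) = exp (2 * of_real pi * \<i> + - (2 * of_real pi
        * \<i> * of_real t))"
      by (simp add: algebra_simps)
    also have "\<dots> = 1 / E" unfolding exp_add exp_minus E_def by (simp add: inverse_eq_divide)
    finally have 1: "exp (2 * of_real pi * \<i> * of_real (1 - t)) = 1 / E" .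
    have c: "circlepath 0 (1 / r) (1 - t) = 1 / (of_real r * E)" "circlepath 0 r t = of_real r * E"
      using 1 by (simp_all add: circlepath E_def)
    have v: "vector_derivative (circlepath 0 (1 / r)) (at (1 - t)) = 2 * pi * \<i> * (1 / (of_real r
        * E))"
      "vector_derivative (circlepath 0 r) (at t) = 2 * pi * \<i> * (of_real r * E)"
      using 1 by (simp_all add: vector_derivative_circlepath E_def)
    show ?thesis using E r
      by (simp add: c v power2_eq_square field_simps)
  qed
  ultimately show ?thesis unfolding has_contour_integral by simp
qed

text \<open>In u = 1 / z the integrand becomes H(u) u^(- m - 1) / (2 pi \<i>). For m \<ge> 0 this is
  Cauchy's formula for a Taylor coefficient; for m < 0 it is holomorphic on the disc and integrates
  to 0.\<close>

lemma has_contour_integral_coefficient: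
  assumes H: "H holomorphic_on ball 0 \<rho>" and F: "H has_fps_expansion F" and r: "r > 0" "1 / r < \<rho>"
  shows "((\<lambda>z. 1 / (2 * of_real pi * \<i> * z) * z powi m * H (1 / z)) has_contour_integral
           (if m \<ge> 0 then fps_nth F (nat m) else 0)) (circlepath 0 r)"
proof -
  let ?C = "1 / (2 * of_real pi * \<i>) :: complex"
  have *: "((\<lambda>u. H u * u powi (- m - 1)) has_contour_integral
           (2 * of_real pi * \<i>) * (if m \<ge> 0 then fps_nth F (nat m) else 0)) (circlepath 0 (1 / r))"
  proof (cases "m \<ge> 0")
    case True
    then obtain k where k: "m = int k" using nonneg_int_cases by blast
    have "((\<lambda>u. H u / (u - 0) ^ Suc k) has_contour_integral (2 * pi * \<i>) / fact k *
        (deriv ^^ k) H 0) (circlepath 0 (1 / r))"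
      by (rule Cauchy_has_contour_integral_higher_derivative_circlepath)
         (use r in \<open>auto intro!: holomorphic_on_imp_continuous_on holomorphic_on_subset[OF H]\<close>)
    moreover have "u powi (- m - 1) = 1 / u ^ Suc k" for u :: complex
    proof -
      have "- m - 1 = - int (Suc k)" using k by simp
      then show ?thesis by (simp only: power_int_minus power_int_of_nat inverse_eq_divide)
    qed
    ultimately show ?thesis using k by (simp add: fps_nth_fps_expansion[OF F])
  next
    case False
    then obtain k where k: "- m - 1 = int k" by (metis add.commute add_0 diff_ge_0_iff_ge
        int_one_le_iff_zero_less le_minus_iff linorder_not_le minus_less_iff nonneg_int_cases
            zero_less_imp_eq_int neg_0_less_iff_less)
    have "((\<lambda>u. H u * u ^ k) has_contour_integral 0) (circlepath 0 (1 / r))"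
      by (rule Cauchy_theorem_convex_simple[of _ "ball 0 \<rho>"])
         (use r in \<open>auto intro!: holomorphic_intros H\<close>)
    then show ?thesis using False by (simp add: k)
  qed
  have "((\<lambda>z. ?C * (H (1 / z) * (1 / z) powi (- m - 1) / z\<^sup>2)) has_contour_integral
           ?C * ((2 * of_real pi * \<i>) * (if m \<ge> 0 then fps_nth F (nat m) else 0))) (circlepath 0 r)"
    by (intro has_contour_integral_lmul has_contour_integral_inversion * r)
  moreover have "?C * (H (1 / z) * (1 / z) powi (- m - 1) / z\<^sup>2) = 1 / (2 * of_real pi * \<i> * z)
      * z powi m * H (1 / z)"
    if "z \<in> path_image (circlepath 0 r)" for z
  proof -
    have "z \<noteq> 0" using that r by auto
    moreover have "(1 / z) powi (- m - 1) = z powi (m + 1)"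
      by (metis add_uminus_conv_diff inverse_eq_divide minus_add_distrib power_int_inverse
          power_int_minus inverse_inverse_eq)
    ultimately show ?thesis by (simp add: power_int_add power2_eq_square)
  qed
  ultimately show ?thesis by (subst (asm) has_contour_integral_cong[OF _ refl refl]) auto
qed

lemma has_fps_expansion_bps: "(\<lambda>w::complex. (1 - c * w) powr \<mu>) has_fps_expansion bps c \<mu>"
proof -
  have "((\<lambda>w. (1 + w) powr \<mu>) \<circ> (\<lambda>w. - c * w)) has_fps_expansion fps_compose (fps_binomial \<mu>)
      (fps_const (- c) * fps_X)"
    by (intro has_fps_expansion_compose fps_expansion_intros) simp
  moreover have "fps_compose (fps_binomial \<mu>) (fps_const (- c) * fps_X) = bps c \<mu>"
    by (simp only: fps_compose_linear) (simp add: bps_def fps_binomial_def mult.commute)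
  ultimately show ?thesis by (simp add: o_def)
qed

lemma holomorphic_on_bps:
  assumes "\<And>w::complex. w \<in> ball 0 \<rho> \<Longrightarrow> cmod (c * w) < 1"
  shows "(\<lambda>w::complex. (1 - c * w) powr \<mu>) holomorphic_on ball 0 \<rho>"
proof (intro holomorphic_intros)
  fix w :: complex assume "w \<in> ball 0 \<rho>"
  then have "cmod (c * w) < 1" by (rule assms)
  then have "Re (1 - c * w) > 0" using complex_Re_le_cmod[of "c * w"] by simp
  then show "1 - c * w \<notin> \<real>\<^sub>\<le>\<^sub>0" by (auto simp: complex_nonpos_Reals_iff)
qed

text \<open>The tail of n from k on is n k itself, and tails of weights are exponents.\<close>

lemma not_in_range_weight: "n k < 0 \<Longrightarrow> (\<And>i. i > k \<Longrightarrow> n i = 0) \<Longrightarrow> n \<notin> range weight"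
  using lookup_eq_sum_weight[of k _ k] by force

lemma ev_prod: "e \<noteq> 0 \<Longrightarrow> ev (prod f I) e = (\<Prod>i\<in>I. ev (f i) e)"
  by (induction I rule: infinite_finite_induct) (auto simp: ev_mult)

lemma euler_kernel_eq_0:
  assumes "k > K"
  shows "euler k (kernel_series N \<mu> x K) = 0"
proof -
  have "euler k ((\<Prod>j\<in>{1..<l}. Rpow \<mu> j l) * (\<Prod>i=1..N. Tpow (- \<mu>) x i l)) = 
        ((\<Prod>j\<in>{1..<l}. Rpow \<mu> j l) * (\<Prod>i=1..N. Tpow (- \<mu>) x i l)) * 0" if "l \<in> {1..K}" for l
  proof -
    have "euler k (\<Prod>j\<in>{1..<l}. Rpow \<mu> j l) = (\<Prod>j\<in>{1..<l}. Rpow \<mu> j l) * (\<Sum>j\<in>{1..<l}. 0)"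
      by (rule euler_prod) (use assms that in \<open>auto simp: euler_Rpow\<close>)
    moreover have "euler k (\<Prod>i=1..N. Tpow (- \<mu>) x i l) = (\<Prod>i=1..N. Tpow (- \<mu>) x i l) * (\<Sum>i=1..N. 0)"
      by (rule euler_prod) (use assms that in \<open>auto simp: euler_Tpow\<close>)
    ultimately show ?thesis by (simp add: euler_mult)
  qed
  then have "euler k (kernel_series N \<mu> x K) = kernel_series N \<mu> x K * (\<Sum>l=1..K. 0)"
    unfolding kernel_series_def by (intro euler_prod) auto
  then show ?thesis by simp
qed

lemma cf_kernel_eq_0: "k > K \<Longrightarrow> n k \<noteq> 0 \<Longrightarrow> cf (kernel_series N \<mu> x K) n = 0"
  using cf_euler[of k "kernel_series N \<mu> x K" n] by (simp add: euler_kernel_eq_0 cf_linear)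

section \<open>Integrating out one variable at a time\<close>

definition analytic_kernel ::
  "nat \<Rightarrow> complex \<Rightarrow> (nat \<Rightarrow> complex) \<Rightarrow> nat \<Rightarrow> (nat \<Rightarrow> complex) \<Rightarrow> complex" where
  "analytic_kernel N \<mu> x K y = (\<Prod>j=1..K. \<Prod>k\<in>{j<..K}. (1 - y j / y k) powr \<mu>)
            / (\<Prod>j=1..N. \<Prod>k=1..K. (1 - x j / y k) powr \<mu>)"

text \<open>The factors that a new variable y_{K+1} brings into the kernel, expanded in 1 / y_{K+1}.
  J counts the factors with y_1, ..., y_J taken in so far, for an induction that adds them
  singly.\<close>

definition column_series :: "nat \<Rightarrow> complex \<Rightarrow> (nat \<Rightarrow> complex) \<Rightarrow> nat \<Rightarrow> (nat \<Rightarrow> complex) \<Rightarrow> complex fps"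
    where
  "column_series N \<mu> x J y = (\<Prod>j=1..J. bps (y j) \<mu>) * (\<Prod>i=1..N. bps (x i) (- \<mu>))"

lemma analytic_kernel_Suc:
  "analytic_kernel N \<mu> x (Suc K) (y(Suc K := z))
   = analytic_kernel N \<mu> x K y * ((\<Prod>j=1..K. (1 - y j / z) powr \<mu>) * (\<Prod>i=1..N. (1 - x i / z) powr
       (- \<mu>)))"
proof -
  let ?y = "y(Suc K := z)"
  have "(\<Prod>k\<in>{j<..Suc K}. (1 - ?y j / ?y k) powr \<mu>) = (\<Prod>k\<in>{j<..K}. (1 - y j / y k) powr \<mu>) * (1
      - y j / z) powr \<mu>"
    if "j \<in> {1..K}" for j
  proof -
    have "{j<..Suc K} = insert (Suc K) {j<..K}" using that by auto
    moreover have "(\<Prod>k\<in>{j<..K}. (1 - ?y j / ?y k) powr \<mu>) = (\<Prod>k\<in>{j<..K}. (1 - y j / y k) powr \<mu>)"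
      using that by (intro prod.cong) auto
    ultimately show ?thesis using that by simp
  qed
  then have 1: "(\<Prod>j=1..Suc K. \<Prod>k\<in>{j<..Suc K}. (1 - ?y j / ?y k) powr \<mu>)
     = (\<Prod>j=1..K. \<Prod>k\<in>{j<..K}. (1 - y j / y k) powr \<mu>) * (\<Prod>j=1..K. (1 - y j / z) powr \<mu>)"
    by (simp add: prod.distrib)
  have "(\<Prod>k=1..K. (1 - x j / ?y k) powr \<mu>) = (\<Prod>k=1..K. (1 - x j / y k) powr \<mu>)" for j
    by (intro prod.cong) auto
  then have 2: "(\<Prod>j=1..N. \<Prod>k=1..Suc K. (1 - x j / ?y k) powr \<mu>)
     = (\<Prod>j=1..N. \<Prod>k=1..K. (1 - x j / y k) powr \<mu>) * (\<Prod>j=1..N. (1 - x j / z) powr \<mu>)"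
    by (simp add: prod.distrib)
  have 3: "(\<Prod>i=1..N. (1 - x i / z) powr (- \<mu>)) = inverse (\<Prod>j=1..N. (1 - x j / z) powr \<mu>)"
    by (simp add: powr_minus prod_inversef[symmetric] o_def)
  show ?thesis unfolding analytic_kernel_def 1 2 3 by (simp add: divide_inverse mult_ac)
qed

definition nested_contours :: "nat \<Rightarrow> (nat \<Rightarrow> real) \<Rightarrow> (nat \<Rightarrow> complex) \<Rightarrow> bool" where
  "nested_contours N r x \<longleftrightarrow> (\<forall>j. r j > 0) \<and> (\<forall>i j. i < j \<longrightarrow> r i < r j)
     \<and> (\<forall>i\<in>{1..N}. \<forall>j. cmod (x i) < r j)"

lemma nested_contoursD:
  assumes "nested_contours N r x"
  shows "r j > 0" "i < j \<Longrightarrow> r i < r j" "i \<in> {1..N} \<Longrightarrow> cmod (x i) < r j"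
  using assms by (simp_all add: nested_contours_def)

lemma inner_integral:
  assumes "nested_contours N r x" and y: "y \<in> torus r K"
  shows "((\<lambda>z. 1 / (2 * of_real pi * \<i> * z) * z powi m * analytic_kernel N \<mu> x (Suc K)
      (y(Suc K := z)))
    has_contour_integral (if m \<ge> 0 then fps_nth (column_series N \<mu> x K y) (nat m) else 0)
        * analytic_kernel N \<mu> x K y)
      (circlepath 0 (r (Suc K)))"
proof -
  note pos = nested_contoursD(1)[OF assms(1)] and mono = nested_contoursD(2)[OF assms(1)]
    and bound = nested_contoursD(3)[OF assms(1)]
  define H where "H w = (\<Prod>j=1..K. (1 - y j * w) powr \<mu>) * (\<Prod>i=1..N. (1 - x i * w) powr (- \<mu>))" for w
  \<comment> \<open>The maximum s dominates every coefficient c of the factors 1 - c w, so these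
    stay off the branch cut for |w| < 1 / s, a disc that contains the circle |w| = 1 / r (Suc K).
    The entry \<open>r (Suc K) / 2\<close> secures s > 0.\<close>
  let ?S = "(\<lambda>j. cmod (y j)) ` {1..K} \<union> (\<lambda>i. cmod (x i)) ` {1..N} \<union> {r (Suc K) / 2}"
  define s where "s = Max ?S"
  have fin: "finite ?S" by simp
  have s: "s < r (Suc K)"
    unfolding s_def using y pos[of "Suc K"] mono[of _ "Suc K"] bound[of _ "Suc K"]
    by (subst Max_less_iff[OF fin]) (auto simp: torus_def)
  have "s \<ge> r (Suc K) / 2" unfolding s_def by (intro Max_ge fin) simp
  then have s0: "s > 0" using pos[of "Suc K"] by linarith
  have cs: "cmod (c * w) < 1" if "cmod c \<le> s" "w \<in> ball 0 (1 / s)" for c w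
  proof -
    have "cmod (c * w) \<le> s * cmod w" using that by (simp add: norm_mult mult_right_mono)
    also have "\<dots> < 1" using that s0 by (simp add: field_simps)
    finally show ?thesis .
  qed
  have ys: "cmod (y j) \<le> s" if "j \<in> {1..K}" for j
    unfolding s_def using that by (intro Max_ge fin) auto
  have xs: "cmod (x i) \<le> s" if "i \<in> {1..N}" for i
    unfolding s_def using that by (intro Max_ge fin) auto
  have hol: "H holomorphic_on ball 0 (1 / s)"
    unfolding H_def by (intro holomorphic_intros holomorphic_on_bps cs ys xs)
  have "H has_fps_expansion column_series N \<mu> x K y"
    unfolding H_def column_series_def
    by (intro has_fps_expansion_mult has_fps_expansion_prod has_fps_expansion_bps)
  then have "((\<lambda>z. 1 / (2 * of_real pi * \<i> * z) * z powi m * H (1 / z)) has_contour_integral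
      (if m \<ge> 0 then fps_nth (column_series N \<mu> x K y) (nat m) else 0)) (circlepath 0 (r (Suc K)))"
    by (rule has_contour_integral_coefficient[OF hol]) (use pos s s0 in \<open>auto simp: frac_less2\<close>)
  from has_contour_integral_rmul[OF this, of "analytic_kernel N \<mu> x K y"]
  show ?thesis by (simp add: analytic_kernel_Suc H_def mult_ac)
qed

text \<open>Induction on J. The factor with y_J expands in powers of y_J / y_{K+1}. Under the
  integrals the a-th power raises the exponent at J by a and leaves the coefficient of order m - a
  to the other factors; in the series it shifts the index in the same way. Both sides obey the same
  Cauchy product.\<close>

lemma has_circle_integrals_column:
  assumes pos: "\<And>j. r j > 0"
    and IH: "\<And>n. n \<in> int_lattice K \<Longrightarrow> has_circle_integrals r n K (analytic_kernel N \<mu> x K) (cf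
      (kernel_series N \<mu> x K) n)"
    and "J \<le> K" "n \<in> int_lattice K"
  shows "has_circle_integrals r n K
     (\<lambda>y. fps_nth (column_series N \<mu> x J y) m * analytic_kernel N \<mu> x K y)
     (cf ((\<Prod>j=1..J. Rpow \<mu> j (Suc K)) * ((\<Prod>i=1..N. Tpow (- \<mu>) x i (Suc K)) * kernel_series N \<mu> x K))
         (n(Suc K := int m)))"
  using assms(3,4)
proof (induction J arbitrary: n m)
  case 0
  define F where "F = (\<Prod>i=1..N. bps (x i) (- \<mu>))"
  let ?n = "n(Suc K := int m)"
  have "cf (ev F (expT (Suc K)) * kernel_series N \<mu> x K) ?n
      = (\<Sum>a\<le>m. fps_nth F a * cf (kernel_series N \<mu> x K) (\<lambda>i. ?n i - int a * weight (expT
          (Suc K)) i))"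
    by (intro cf_ev_mult expT_nz not_in_range_weight[of _ "Suc K"])
       (use 0 in \<open>auto simp: weight_expT int_lattice_def\<close>)
  \<comment> \<open>The series in the first K variables contains no power of y_{K+1}, so only a = m
    contributes.\<close>
  also have "\<dots> = (\<Sum>a\<in>{m}. fps_nth F a * cf (kernel_series N \<mu> x K) (\<lambda>i. ?n i - int a * weight (expT
      (Suc K)) i))"
    by (rule sum.mono_neutral_right) (auto simp: weight_expT intro!: cf_kernel_eq_0[of _ "Suc K"])
  finally have "cf (ev F (expT (Suc K)) * kernel_series N \<mu> x K) ?n
      = fps_nth F m * cf (kernel_series N \<mu> x K) (\<lambda>i. ?n i - int m * weight (expT (Suc K)) i)"
    by simp
  moreover have "(\<lambda>i. ?n i - int m * weight (expT (Suc K)) i) = n"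
    using 0 by (auto simp: weight_expT int_lattice_def)
  ultimately have "cf (ev F (expT (Suc K)) * kernel_series N \<mu> x K) ?n = fps_nth F m * cf
      (kernel_series N \<mu> x K) n"
    by simp
  then show ?case using has_circle_integrals_cmult[OF IH[OF 0(2)], of "fps_nth F m"]
    by (simp add: column_series_def F_def ev_prod Tpow_def del: fun_upd_apply)
next
  case (Suc J)
  let ?n = "n(Suc K := int m)"
  let ?P = "\<lambda>J. (\<Prod>j=1..J. Rpow \<mu> j (Suc K)) * ((\<Prod>i=1..N. Tpow (- \<mu>) x i (Suc K))
      * kernel_series N \<mu> x K)"
  let ?n' = "\<lambda>a. n(Suc J := n (Suc J) + int a)"
  have JK: "Suc J < Suc K" using Suc by simp
  have "cf (?P (Suc J)) ?n = cf (ev (bps 1 \<mu>) (expR (Suc J) (Suc K)) * ?P J) ?n"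
    by (simp add: Rpow_def mult_ac)
  also have "\<dots> = (\<Sum>a\<le>m. fps_nth (bps 1 \<mu>) a * cf (?P J) (\<lambda>i. ?n i - int a * weight (expR (Suc J)
      (Suc K)) i))"
    by (intro cf_ev_mult expR_nz JK not_in_range_weight[of _ "Suc K"])
       (use Suc.prems in \<open>auto simp: weight_expR JK int_lattice_def\<close>)
  also have "\<dots> = (\<Sum>a\<le>m. fps_nth (bps 1 \<mu>) a * cf (?P J) ((?n' a)(Suc K := int (m - a))))"
  proof (rule sum.cong[OF refl])
    fix a assume "a \<in> {..m}"
    then have "(\<lambda>i. ?n i - int a * weight (expR (Suc J) (Suc K)) i) = (?n' a)(Suc K := int (m - a))"
      using JK by (auto simp: weight_expR of_nat_diff)
    then show "fps_nth (bps 1 \<mu>) a * cf (?P J) (\<lambda>i. ?n i - int a * weight (expR (Suc J) (Suc K)) i)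
       = fps_nth (bps 1 \<mu>) a * cf (?P J) ((?n' a)(Suc K := int (m - a)))" by simp
  qed
  finally have cf: "cf (?P (Suc J)) ?n = (\<Sum>a\<le>m. fps_nth (bps 1 \<mu>) a * cf (?P J)
      ((?n' a)(Suc K := int (m - a))))" .
  have "fps_nth (column_series N \<mu> x (Suc J) y) m
      = (\<Sum>a\<le>m. fps_nth (bps 1 \<mu>) a * (y (Suc J) ^ a * fps_nth (column_series N \<mu> x J y) (m
          - a)))" for y
  proof -
    have "column_series N \<mu> x (Suc J) y = bps (y (Suc J)) \<mu> * column_series N \<mu> x J y"
      by (simp add: column_series_def mult_ac)
    moreover have "fps_nth (bps (y (Suc J)) \<mu>) a = fps_nth (bps 1 \<mu>) a * y (Suc J) ^ a" for a
      by (simp add: bps_def power_mult_distrib[symmetric])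
    ultimately show ?thesis by (simp add: fps_mult_nth atLeast0AtMost mult.assoc)
  qed
  then have eq: "fps_nth (column_series N \<mu> x (Suc J) y) m * analytic_kernel N \<mu> x K y
      = (\<Sum>a\<le>m. fps_nth (bps 1 \<mu>) a * (y (Suc J) ^ a * (fps_nth (column_series N \<mu> x J y) (m - a)
          * analytic_kernel N \<mu> x K y)))" for y
    by (simp add: sum_distrib_right mult.assoc)
  show ?case unfolding eq cf
  proof (intro has_circle_integrals_sum has_circle_integrals_cmult has_circle_integrals_monomial
      Suc.IH)
    fix a show "?n' a \<in> int_lattice K" using Suc.prems by (auto simp: int_lattice_def)
  qed (use Suc.prems pos in auto)
qed

text \<open>The last variable is the innermost one. Integrating it out leaves one coefficient of
  \<open>column_series\<close> times the kernel with one variable fewer, to which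
  \<open>has_circle_integrals_column\<close> applies; for a negative exponent both sides are
  0.\<close>

lemma has_circle_integrals_kernel:
  assumes contours: "nested_contours N r x" and "n \<in> int_lattice K"
  shows "has_circle_integrals r n K (analytic_kernel N \<mu> x K) (cf (kernel_series N \<mu> x K) n)"
  using assms(2)
proof (induction K arbitrary: n)
  case 0
  then have "n = weight 0" by (auto simp: int_lattice_def weight_def)
  then show ?case by (simp only: has_circle_integrals.simps cf_weight)
      (simp add: analytic_kernel_def kernel_series_def coef_one)
next
  case (Suc K)
  define m where "m = n (Suc K)"
  define n' where "n' = n(Suc K := 0)"
  have n': "n' \<in> int_lattice K" using Suc.prems by (auto simp: n'_def int_lattice_def)
  have n: "n = n'(Suc K := m)" by (auto simp: n'_def m_def)
  have P: "kernel_series N \<mu> x (Suc K)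
     = (\<Prod>j=1..K. Rpow \<mu> j (Suc K)) * ((\<Prod>i=1..N. Tpow (- \<mu>) x i (Suc K)) * kernel_series N \<mu> x K)"
    by (simp add: kernel_series_def atLeastLessThanSuc_atLeastAtMost mult_ac)
  have "has_circle_integrals r n' K
     (\<lambda>y. (if m \<ge> 0 then fps_nth (column_series N \<mu> x K y) (nat m) else 0) * analytic_kernel N \<mu> x K
         y) (cf (kernel_series N \<mu> x (Suc K)) n)"
  proof (cases "m \<ge> 0")
    case True
    then show ?thesis
      using has_circle_integrals_column[OF nested_contoursD(1)[OF contours] Suc.IH le_refl n', where m = "nat m"] unfolding P n
          by simp
  next
    case False
    have "cf (kernel_series N \<mu> x (Suc K)) n = 0"
      by (rule cf_eq_0, rule not_in_range_weight[of _ "Suc K"])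
         (use False Suc.prems in \<open>auto simp: m_def int_lattice_def\<close>)
    then show ?thesis using False has_circle_integrals_0 by simp
  qed
  then have "has_circle_integrals r n K
     (\<lambda>y. (if m \<ge> 0 then fps_nth (column_series N \<mu> x K y) (nat m) else 0) * analytic_kernel N \<mu> x K
         y) (cf (kernel_series N \<mu> x (Suc K)) n)"
    by (rule has_circle_integrals_cong[rotated 3]) (use nested_contoursD(1)[OF contours] in \<open>auto simp: n'_def\<close>)
  then show ?case
    unfolding has_circle_integrals.simps m_def[symmetric]
    by (intro exI conjI ballI) (rule inner_integral[OF contours])
qed

theorem f_fun_eq_cf:
  assumes "N \<ge> 1" "\<epsilon> > 0" "n \<in> int_lattice N"
  shows "f_fun N lam \<epsilon> n x = cf (kernel_series N (of_real lam) (\<lambda>i. of_real (x i)) N) n"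
proof -
  define M where "M = Max ((\<lambda>k. \<bar>x k\<bar>) ` {1..N})"
  have M: "\<bar>x i\<bar> \<le> M" if "i \<in> {1..N}" for i
    unfolding M_def using that by (intro Max_ge) auto
  have M0: "M \<ge> 0" using M[of 1] assms by force
  \<comment> \<open>At index 0 the contour radius would be M, which may be 0 and does not exceed
    every |x_i|. No circle has index 0, so a value strictly between M and M + \<epsilon> is put
    there to satisfy \<open>nested_contours\<close>.\<close>
  define r where "r j = (if j = 0 then M + \<epsilon> / 2 else M + \<epsilon> * real j)" for j
  have contours: "nested_contours N r (\<lambda>i. of_real (x i))"
    unfolding nested_contours_def
  proof (intro conjI allI impI ballI)
    have Mr: "M < r j" for j using assms by (simp add: r_def)
    fix i j
    show "r j > 0" using M0 Mr[of j] by simp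
    show "r i < r j" if "i < j"
    proof -
      have "\<epsilon> * real 1 \<le> \<epsilon> * real j" "\<epsilon> * real i < \<epsilon> * real j" using that assms by (simp_all)
      then show ?thesis using that assms by (auto simp: r_def)
    qed
    show "cmod (of_real (x i)) < r j" if "i \<in> {1..N}" using M[OF that] Mr[of j] by simp
  qed
  have "circle_integrals r n N (analytic_kernel N (of_real lam) (\<lambda>i. of_real (x i)) N)
      = cf (kernel_series N (of_real lam) (\<lambda>i. of_real (x i)) N) n"
    by (rule circle_integrals_unique) (use nested_contoursD(1)[OF contours] has_circle_integrals_kernel[OF contours] assms in auto)
  moreover have "circle_integrals r n k F = circle_integrals (contour_radius N \<epsilon> x) n k F" for k F
    by (induction k arbitrary: F) (simp_all add: r_def contour_radius_def M_def)
  ultimately show ?thesis unfolding f_fun_def analytic_kernel_def by simp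
qed

section \<open>Derivatives of the coefficients\<close>

text \<open>Differentiation coefficient by coefficient: coefficients of products are finite sums, so
  the product rule requires no convergence.\<close>

definition has_coef_derivative :: "(real \<Rightarrow> mps) \<Rightarrow> mps \<Rightarrow> real \<Rightarrow> bool" where
  "has_coef_derivative F F' s \<longleftrightarrow> (\<forall>t. ((\<lambda>u. coef (F u) t) has_vector_derivative coef F' t) (at s))"

lemma has_coef_derivative_const: "has_coef_derivative (\<lambda>_. P) 0 s"
  by (simp add: has_coef_derivative_def)

lemma has_coef_derivative_mult:
  assumes "has_coef_derivative F F' s" "has_coef_derivative G G' s"
  shows "has_coef_derivative (\<lambda>u. F u * G u) (F' * G s + F s * G') s"
  unfolding has_coef_derivative_def
proof
  fix t
  have "((\<lambda>u. coef (F u) (fst p) * coef (G u) (snd p)) has_vector_derivative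
      (coef (F s) (fst p) * coef G' (snd p) + coef F' (fst p) * coef (G s) (snd p))) (at s)" for p
    using assms by (intro has_vector_derivative_mult) (auto simp: has_coef_derivative_def)
  then have "((\<lambda>u. \<Sum>p\<in>decompositions t. coef (F u) (fst p) * coef (G u) (snd p))
      has_vector_derivative
     (\<Sum>p\<in>decompositions t. coef (F s) (fst p) * coef G' (snd p) + coef F' (fst p) * coef (G s)
         (snd p))) (at s)"
    by (intro has_vector_derivative_sum)
  then show "((\<lambda>u. coef (F u * G u) t) has_vector_derivative coef (F' * G s + F s * G') t) (at s)"
    by (simp add: coef_mult case_prod_unfold sum.distrib add.commute)
qed

lemma has_coef_derivative_cmult:
  "has_coef_derivative F F' s \<Longrightarrow> has_coef_derivative (\<lambda>u. P * F u) (P * F') s"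
  using has_coef_derivative_mult[OF has_coef_derivative_const[of P s], of F F'] by simp

lemma has_coef_derivative_sum:
  "(\<And>i. i \<in> I \<Longrightarrow> has_coef_derivative (F i) (F' i) s) \<Longrightarrow>
   has_coef_derivative (\<lambda>u. \<Sum>i\<in>I. F i u) (\<Sum>i\<in>I. F' i) s"
  by (auto simp: has_coef_derivative_def coef_sum intro!: has_vector_derivative_sum)

lemma has_coef_derivative_prod:
  assumes "finite I" "\<And>i. i \<in> I \<Longrightarrow> has_coef_derivative (F i) (F i s * g i) s"
  shows "has_coef_derivative (\<lambda>u. \<Prod>i\<in>I. F i u) ((\<Prod>i\<in>I. F i s) * (\<Sum>i\<in>I. g i)) s"
  using assms
proof (induction I rule: finite_induct)
  case empty
  show ?case using has_coef_derivative_const[of 1 s] by simp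
next
  case (insert i I)
  then have "has_coef_derivative (\<lambda>u. F i u * (\<Prod>i\<in>I. F i u))
      (F i s * g i * (\<Prod>i\<in>I. F i s) + F i s * ((\<Prod>i\<in>I. F i s) * (\<Sum>i\<in>I. g i))) s"
    by (intro has_coef_derivative_mult) auto
  then show ?case using insert by (simp add: algebra_simps)
qed

lemma cf_has_vector_derivative:
  "has_coef_derivative F F' s \<Longrightarrow> ((\<lambda>u. cf (F u) n) has_vector_derivative cf F' n) (at s)"
  by (cases "n \<in> range weight") (auto simp: has_coef_derivative_def cf_eq_0)

definition cx :: "(nat \<Rightarrow> real) \<Rightarrow> nat \<Rightarrow> complex" where
  "cx x i = of_real (x i)"

lemma has_coef_derivative_Tpow:
  "has_coef_derivative (\<lambda>u. Tpow \<mu> (cx (x(i := u))) i k)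
     (Tpow \<mu> (cx x) i k * (cst (- \<mu>) * xdiff_inv (cx x) k i)) (x i)"
proof -
  have eq: "Tpow \<mu> (cx x) i k * (cst (- \<mu>) * xdiff_inv (cx x) k i)
      = ev (fps_const (- \<mu>) * (fps_X * bps (x i) (\<mu> - 1))) (expT k)" (is "_ = ev ?F _")
  proof -
    have "bps (x i) (\<mu> - 1) = bps (x i) \<mu> * bps (x i) (- 1)" by (simp add: bps_mult)
    then show ?thesis
      by (simp add: ev_const_mult ev_const ev_mult cst_minus yinv_def xdiff_inv_def Tpow_def
          xgeom_def cx_def mult_ac)
  qed
  have "((\<lambda>u. fps_nth (bps (of_real u) \<mu>) a) has_vector_derivative fps_nth ?F a) (at (x i))" for a
  proof -
    have "((\<lambda>z. (\<mu> gchoose a) * (- z) ^ a) has_field_derivative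
        (\<mu> gchoose a) * (of_nat a * (- of_real (x i)) ^ (a - 1) * (- 1))) (at (of_real (x i)))"
      by (auto intro!: derivative_eq_intros)
    then have "((\<lambda>u. (\<mu> gchoose a) * (- of_real u) ^ a) has_vector_derivative
        (\<mu> gchoose a) * (of_nat a * (- of_real (x i)) ^ (a - 1) * (- 1))) (at (x i))"
      by (rule has_vector_derivative_real_field)
    moreover have "(\<mu> gchoose a) * (of_nat a * (- of_real (x i)) ^ (a - 1) * (- 1)) = fps_nth ?F a"
    proof (cases a)
      case (Suc m)
      have "of_nat (Suc m) * (\<mu> gchoose Suc m) = \<mu> * ((\<mu> - 1) gchoose m)"
        using gbinomial_absorption[of m \<mu>] by simp
      moreover have "(\<mu> gchoose a) * (of_nat a * (- of_real (x i)) ^ (a - 1) * (- 1))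
          = - (of_nat (Suc m) * (\<mu> gchoose Suc m)) * (- of_real (x i)) ^ m"
        by (simp add: Suc algebra_simps)
      ultimately have "(\<mu> gchoose a) * (of_nat a * (- of_real (x i)) ^ (a - 1) * (- 1))
          = - (\<mu> * ((\<mu> - 1) gchoose m)) * (- of_real (x i)) ^ m"
        by simp
      then show ?thesis using Suc by (simp add: bps_def del: fps_const_neg fps_const_mult)
    qed (simp add: mult.assoc[symmetric])
    ultimately show ?thesis by (simp add: bps_def)
  qed
  then have "((\<lambda>u. coef (ev (bps (of_real u) \<mu>) (expT k)) t) has_vector_derivative coef (ev ?F
      (expT k)) t) (at (x i))" for t
    unfolding ev_def coef_Mps by (intro has_vector_derivative_sum)
  then show ?thesis unfolding eq has_coef_derivative_def by (simp add: Tpow_def cx_def)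
qed

text \<open>The first derivative in x_i of the kernel, divided by the kernel; \<open>khess\<close>
  is the same for the second derivative.\<close>

definition kgrad :: "complex \<Rightarrow> nat \<Rightarrow> (nat \<Rightarrow> complex) \<Rightarrow> nat \<Rightarrow> mps" where
  "kgrad \<mu> K x i = cst \<mu> * (\<Sum>k=1..K. xdiff_inv x k i)"

definition khess :: "complex \<Rightarrow> nat \<Rightarrow> (nat \<Rightarrow> complex) \<Rightarrow> nat \<Rightarrow> mps" where
  "khess \<mu> K x i = (kgrad \<mu> K x i)\<^sup>2 + cst \<mu> * (\<Sum>k=1..K. (xdiff_inv x k i)\<^sup>2)"

lemma has_coef_derivative_kernel:
  assumes i: "i \<in> {1..N}"
  shows "has_coef_derivative (\<lambda>u. kernel_series N \<mu> (cx (x(i := u))) K) (kernel_series N \<mu> (cx x) K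
      * kgrad \<mu> K (cx x) i) (x i)"
proof -
  let ?g = "\<lambda>k j. of_bool (j = i) * (cst \<mu> * xdiff_inv (cx x) k i)"
  have factor: "has_coef_derivative (\<lambda>u. Tpow (- \<mu>) (cx (x(i := u))) j k) (Tpow (- \<mu>) (cx
      (x(i := x i))) j k * ?g k j) (x i)" for j k
  proof (cases "j = i")
    case True
    then show ?thesis using has_coef_derivative_Tpow[of "- \<mu>" x i k] by simp
  next
    case False
    then have "(\<lambda>u. Tpow (- \<mu>) (cx (x(i := u))) j k) = (\<lambda>_. Tpow (- \<mu>) (cx x) j k)"
      by (simp add: Tpow_def cx_def)
    then show ?thesis using False has_coef_derivative_const by simp
  qed
  have c: "has_coef_derivative (\<lambda>u. (\<Prod>j\<in>{1..<k}. Rpow \<mu> j k) * (\<Prod>j=1..N. Tpow (- \<mu>) (cx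
      (x(i := u))) j k))
    (((\<Prod>j\<in>{1..<k}. Rpow \<mu> j k) * (\<Prod>j=1..N. Tpow (- \<mu>) (cx (x(i := x i))) j k)) * (cst \<mu> * xdiff_inv
        (cx x) k i)) (x i)" for k
  proof -
    have "has_coef_derivative (\<lambda>u. (\<Prod>j\<in>{1..<k}. Rpow \<mu> j k) * (\<Prod>j=1..N. Tpow (- \<mu>) (cx
        (x(i := u))) j k))
      ((\<Prod>j\<in>{1..<k}. Rpow \<mu> j k) * ((\<Prod>j=1..N. Tpow (- \<mu>) (cx (x(i := x i))) j k) *
          (\<Sum>j=1..N. ?g k j))) (x i)"
      by (intro has_coef_derivative_cmult has_coef_derivative_prod factor) simp
    moreover have "(\<Sum>j=1..N. ?g k j) = cst \<mu> * xdiff_inv (cx x) k i"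
      using i by (subst sum.remove[of _ i]) (auto intro!: sum.neutral)
    ultimately show ?thesis by (simp only: mult.assoc)
  qed
  have "has_coef_derivative (\<lambda>u. kernel_series N \<mu> (cx (x(i := u))) K)
     (kernel_series N \<mu> (cx (x(i := x i))) K * (\<Sum>k=1..K. cst \<mu> * xdiff_inv (cx x) k i)) (x i)"
    unfolding kernel_series_def by (intro has_coef_derivative_prod c) simp
  then show ?thesis by (simp add: kgrad_def sum_distrib_left)
qed

lemma has_coef_derivative_kgrad:
  "has_coef_derivative (\<lambda>u. kgrad \<mu> K (cx (x(i := u))) i) (cst \<mu> * (\<Sum>k=1..K. (xdiff_inv
      (cx x) k i)\<^sup>2)) (x i)"
proof -
  have "has_coef_derivative (\<lambda>u. xdiff_inv (cx (x(i := u))) k i) ((xdiff_inv (cx x) k i)\<^sup>2)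
      (x i)" for k
    using has_coef_derivative_cmult[OF has_coef_derivative_Tpow[of "- 1" x i k], of "yinv k"]
    by (simp add: xdiff_inv_def xgeom_Tpow power2_eq_square mult_ac)
  then show ?thesis unfolding kgrad_def
    by (intro has_coef_derivative_cmult has_coef_derivative_sum)
qed

lemma has_coef_derivative_kernel_kgrad:
  assumes "i \<in> {1..N}"
  shows "has_coef_derivative (\<lambda>u. kernel_series N \<mu> (cx (x(i := u))) K * kgrad \<mu> K (cx
      (x(i := u))) i)
     (kernel_series N \<mu> (cx x) K * khess \<mu> K (cx x) i) (x i)"
  using has_coef_derivative_mult[OF has_coef_derivative_kernel[OF assms, of \<mu> x K]
      has_coef_derivative_kgrad[of \<mu> K x i]]
  by (simp add: khess_def algebra_simps power2_eq_square)

lemma sum_off_diagonal_swap: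
  assumes "finite I"
  shows "(\<Sum>i\<in>I. \<Sum>j\<in>I - {i}. f i j) = (\<Sum>i\<in>I. \<Sum>j\<in>I - {i}. f j i)"
  using assms
  by (subst (1 2) sum.Sigma) (auto intro!: sum.reindex_bij_witness[of _ prod.swap prod.swap])

text \<open>Adding the sum with i and j exchanged produces the quotients (G_i - G_j) / (x_i - x_j)
  of the gradient entries, and the factor 2. By \<open>xdiff_inv_diff\<close> the division is exact,
  so the poles at coinciding coordinates disappear.\<close>

lemma kgrad_off_diagonal:
  assumes inj: "inj_on x {1..N}"
  shows "cst 2 * (\<Sum>i=1..N. \<Sum>j\<in>{1..N} - {i}. cst (1 / (x i - x j)) * kgrad \<mu> K x i)
       = cst \<mu> * (\<Sum>k=1..K. \<Sum>i=1..N. \<Sum>j\<in>{1..N} - {i}. xdiff_inv x k i * xdiff_inv x k j)"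
proof -
  let ?Y = "\<Sum>i=1..N. \<Sum>j\<in>{1..N} - {i}. cst (1 / (x i - x j)) * kgrad \<mu> K x i"
  have "?Y = (\<Sum>i=1..N. \<Sum>j\<in>{1..N} - {i}. cst (1 / (x j - x i)) * kgrad \<mu> K x j)"
    by (rule sum_off_diagonal_swap) simp
  then have "cst 2 * ?Y = ?Y + (\<Sum>i=1..N. \<Sum>j\<in>{1..N} - {i}. cst (1 / (x j - x i)) * kgrad \<mu> K x j)"
    using cst_of_nat[of 2] by simp
  also have "\<dots> = (\<Sum>i=1..N. \<Sum>j\<in>{1..N} - {i}. cst (1 / (x i - x j)) * (kgrad \<mu> K x i
      - kgrad \<mu> K x j))"
  proof -
    have flip: "cst (1 / (x j - x i)) = - cst (1 / (x i - x j))" for i j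
      by (metis cst_minus minus_diff_eq minus_divide_right)
    have "(\<Sum>i=1..N. \<Sum>j\<in>{1..N} - {i}. cst (1 / (x j - x i)) * kgrad \<mu> K x j)
        = (\<Sum>i=1..N. \<Sum>j\<in>{1..N} - {i}. - (cst (1 / (x i - x j)) * kgrad \<mu> K x j))"
      by (intro sum.cong refl) (subst flip, simp)
    then show ?thesis by (simp add: right_diff_distrib sum_subtractf sum_negf)
  qed
  also have "\<dots> = (\<Sum>i=1..N. \<Sum>j\<in>{1..N} - {i}. cst \<mu> * (\<Sum>k=1..K. xdiff_inv x k i * xdiff_inv x k j))"
  proof (intro sum.cong refl)
    fix i j assume "i \<in> {1..N}" "j \<in> {1..N} - {i}"
    then have "x i - x j \<noteq> 0" using inj by (auto dest: inj_onD)
    then have "cst (1 / (x i - x j)) * (xdiff_inv x k i - xdiff_inv x k j) = xdiff_inv x k i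
        * xdiff_inv x k j" for k
      by (simp add: xdiff_inv_diff[symmetric] mult.assoc[symmetric] cst_mult[symmetric])
    then show "cst (1 / (x i - x j)) * (kgrad \<mu> K x i - kgrad \<mu> K x j) = cst \<mu> *
        (\<Sum>k=1..K. xdiff_inv x k i * xdiff_inv x k j)"
      by (simp add: kgrad_def right_diff_distrib[symmetric] sum_subtractf[symmetric]
          sum_distrib_left
          mult.left_commute[of _ "cst \<mu>"])
  qed
  also have "\<dots> = cst \<mu> * (\<Sum>i=1..N. \<Sum>k=1..K. \<Sum>j\<in>{1..N} - {i}. xdiff_inv x k i * xdiff_inv x k j)"
    by (simp add: sum_distrib_left[symmetric] sum.swap[of _ "{Suc 0..K}" "{Suc 0..N} - {_}"])
  also have "\<dots> = cst \<mu> * (\<Sum>k=1..K. \<Sum>i=1..N. \<Sum>j\<in>{1..N} - {i}. xdiff_inv x k i * xdiff_inv x k j)"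
    by (subst sum.swap) simp
  finally show ?thesis .
qed

text \<open>F depends only on ratios of the x_i and y_k, so its degree in x is minus its degree in
  y. In the logarithmic derivatives each term in y_j / y_k occurs once with either sign and
  cancels.\<close>

lemma sum_kgrad: "kernel_series N \<mu> x K * (\<Sum>i=1..N. cst (x i) * kgrad \<mu> K x i) = (\<Sum>k=1..K. euler k
    (kernel_series N \<mu> x K))"
proof -
  have "(\<Sum>k=1..K. \<Sum>j\<in>{k<..K}. yquot k j * yquot_geom k j) = (\<Sum>k=1..K. \<Sum>j\<in>{1..<k}. yquot j k
      * yquot_geom j k)"
    by (subst (1 2) sum.Sigma) (auto intro!: sum.reindex_bij_witness[of _ prod.swap prod.swap])
  then have "(\<Sum>k=1..K. logd N \<mu> x K k) = cst \<mu> * (\<Sum>k=1..K. \<Sum>i=1..N. cst (x i) * xdiff_inv x k i)"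
    by (simp add: logd_def sum_distrib_left[symmetric] sum.distrib sum_subtractf)
  also have "\<dots> = (\<Sum>i=1..N. cst (x i) * kgrad \<mu> K x i)"
    by (subst sum.swap) (simp add: kgrad_def sum_distrib_left mult_ac)
  finally show ?thesis by (simp add: euler_kernel sum_distrib_left[symmetric])
qed

section \<open>Recurrence and homogeneity of the functions f_n\<close>

abbreviation kernel_cf :: "nat \<Rightarrow> real \<Rightarrow> (nat \<Rightarrow> real) \<Rightarrow> (nat \<Rightarrow> int) \<Rightarrow> complex" where
  "kernel_cf N lam x n \<equiv> cf (kernel_series N (of_real lam) (cx x) N) n"

lemma cf_yinv_mult: "cf (yinv k * P) n = cf P (n(k := n k - 1))"
proof -
  have "(\<lambda>i. n i - weight (expT k) i) = n(k := n k - 1)" by (auto simp: weight_expT)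
  then show ?thesis by (simp add: yinv_def cf_mon_mult)
qed

lemma cf_tilde: "cf (tilde N \<mu> k P) n = (of_int (n k) + K_shift N \<mu> k) * cf P n"
  by (simp add: tilde_def cf_linear cf_euler distrib_right)

lemma fps_nth_bps_minus1: "fps_nth (bps 1 (- 1)) a = 1"
proof -
  have "(- 1 :: complex) gchoose a = (- 1) ^ a * (of_nat a gchoose a)"
    by (subst gbinomial_minus) simp
  also have "(of_nat a :: complex) gchoose a = 1"
    by (metis binomial_gbinomial binomial_n_n of_nat_1)
  finally show ?thesis by (simp add: bps_def power_mult_distrib[symmetric])
qed

text \<open>1 / (y_k - y_l)^2 is the sum of \<nu> y_l^(\<nu> - 1) y_k^(- \<nu> - 1): this is the
  origin of the vectors E_{lk}^\<nu> and of the factor \<nu> in \<open>g_coeff\<close>. M is large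
  enough that beyond it the tail from k on of the shifted index is negative.\<close>

lemma cf_ydiff_inv_square:
  assumes lk: "l < k" and n: "n \<in> int_lattice N" and k: "k \<le> N" and M: "int M > (\<Sum>i=k..N. n i)"
  shows "cf ((ydiff_inv k l)\<^sup>2 * P) n = (\<Sum>\<nu>\<le>Suc M. of_nat \<nu> * cf P (\<lambda>i. n i - E_vec l k \<nu> i))"
proof -
  have "(yquot_geom l k)\<^sup>2 = ev (bps 1 (- 2)) (expR l k)"
    using bps_mult[of 1 "- 1" "- 1"] lk by (simp add: yquot_geom_def power2_eq_square
        ev_mult[symmetric])
  then have "(ydiff_inv k l)\<^sup>2 * P = yinv k * (yinv k * (ev (bps 1 (- 2)) (expR l k) * P))"
    using lk by (simp add: ydiff_inv_def power_mult_distrib power2_eq_square[of "yinv k"] mult_ac)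
  moreover define n2 where "n2 = n(k := n k - 2)"
  ultimately have "cf ((ydiff_inv k l)\<^sup>2 * P) n = cf (ev (bps 1 (- 2)) (expR l k) * P) n2"
    by (simp add: cf_yinv_mult)
  also have "\<dots> = (\<Sum>a\<le>M. fps_nth (bps 1 (- 2)) a * cf P (\<lambda>i. n2 i - int a * weight (expR l k) i))"
  proof (intro cf_ev_mult expR_nz lk)
    show "(\<lambda>i. n2 i - int (Suc M) * weight (expR l k) i) \<notin> range weight"
    proof
      assume "(\<lambda>i. n2 i - int (Suc M) * weight (expR l k) i) \<in> range weight"
      then obtain t where "(\<lambda>i. n2 i - int (Suc M) * weight (expR l k) i) = weight t" by auto
      then have t: "weight t i = n2 i - int (Suc M) * weight (expR l k) i" for i by metis
      \<comment> \<open>Of y_l / y_k only y_k counts in the tail from k > l on, so two factors 1 /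
        y_k and M + 1 such ratios lower it by M + 3.\<close>
      have "int (Poly_Mapping.lookup t k) = (\<Sum>i=k..N. weight t i)"
      proof (rule lookup_eq_sum_weight)
        fix i assume "i > N"
        then show "weight t i = 0" using n k lk by (auto simp: t n2_def weight_expR int_lattice_def)
      qed
      also have "\<dots> = (\<Sum>i=k..N. n i - (if i = k then 2 + int (Suc M) else 0))"
        using lk by (intro sum.cong) (auto simp: t n2_def weight_expR)
      also have "\<dots> < 0" using M k by (simp add: sum_subtractf)
      finally show False by simp
    qed
  qed
  also have "\<dots> = (\<Sum>a\<le>M. of_nat (Suc a) * cf P (\<lambda>i. n i - E_vec l k (Suc a) i))"
  proof (intro sum.cong refl)
    fix a
    have "fps_nth (bps 1 (- 2)) a = of_nat (Suc a)"
      using bps_mult[of 1 "- 1" "- 1", symmetric] by (simp add: fps_mult_nth fps_nth_bps_minus1)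
    moreover have "(\<lambda>i. n2 i - int a * weight (expR l k) i) = (\<lambda>i. n i - E_vec l k (Suc a) i)"
      using lk by (auto simp: n2_def weight_expR E_vec_def algebra_simps)
    ultimately show "fps_nth (bps 1 (- 2)) a * cf P (\<lambda>i. n2 i - int a * weight (expR l k) i)
       = of_nat (Suc a) * cf P (\<lambda>i. n i - E_vec l k (Suc a) i)" by simp
  qed
  finally show ?thesis by (simp add: sum.atMost_Suc_shift del: sum.atMost_Suc)
qed

lemma sum_index_pairs:
  "(\<Sum>p\<in>index_pairs N. f p) = (\<Sum>k=1..N. f (k, k)) + (\<Sum>k=1..N. \<Sum>j\<in>{1..<k}. f (j, k))"
proof -
  let ?D = "(\<lambda>k. (k, k)) ` {1..N}" and ?L = "(\<lambda>(k, j). (j, k)) ` (SIGMA k:{1..N}. {1..<k})"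
  have "index_pairs N = ?D \<union> ?L" by (force simp: index_pairs_def image_iff)
  moreover have "?D \<inter> ?L = {}" by auto
  ultimately have "(\<Sum>p\<in>index_pairs N. f p) = sum f ?D + sum f ?L"
    by (simp add: sum.union_disjoint)
  also have "sum f ?D = (\<Sum>k=1..N. f (k, k))" by (subst sum.reindex) (auto simp: inj_on_def)
  also have "sum f ?L = (\<Sum>k=1..N. \<Sum>j\<in>{1..<k}. f (j, k))"
    by (subst sum.reindex) (auto simp: inj_on_def sum.Sigma case_prod_unfold)
  finally show ?thesis .
qed

lemma sum_ydiff_inv_square: "(\<Sum>k=1..K. \<Sum>l=1..K. (ydiff_inv k l)\<^sup>2) = cst 2 * (\<Sum>k=1..K. \<Sum>l\<in>{1..<k}.
    (ydiff_inv k l)\<^sup>2)"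
proof -
  have "(\<Sum>l=1..K. (ydiff_inv k l)\<^sup>2) = (\<Sum>l\<in>{1..<k}. (ydiff_inv k l)\<^sup>2) + (\<Sum>l\<in>{k<..K}.
      (ydiff_inv k l)\<^sup>2)" if "k \<in> {1..K}" for k
  proof -
    have "{1..K} = insert k ({1..<k} \<union> {k<..K})" using that by auto
    then show ?thesis by (simp, subst sum.union_disjoint) auto
  qed
  moreover have "(\<Sum>k=1..K. \<Sum>l\<in>{k<..K}. (ydiff_inv k l)\<^sup>2) = (\<Sum>k=1..K. \<Sum>l\<in>{1..<k}.
      (ydiff_inv k l)\<^sup>2)"
  proof -
    have "(ydiff_inv k l)\<^sup>2 = (ydiff_inv l k)\<^sup>2" for k l using ydiff_inv_antisym[of k l] by simp
    then show ?thesis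
      by (subst (1 2) sum.Sigma) (auto intro!: sum.reindex_bij_witness[of _ prod.swap prod.swap])
  qed
  ultimately show ?thesis using cst_of_nat[of 2] by (simp add: sum.distrib)
qed

lemma cf_mult_of_real: "cf (P * (cst c * Q)) n = c * cf (P * Q) n"
  by (subst mult.left_commute) (rule cf_linear(3))

text \<open>The left side is D f_n. Diagonal pairs come from the second derivatives in y_k,
  off-diagonal ones from the potential. The coefficients g are taken at the shifted index because
  the powers of 1 / y_k are stripped off before the Euler operators are evaluated.\<close>

theorem kernel_cf_recurrence:
  fixes lam :: real
  assumes inj: "inj_on x {1..N}" and n: "n \<in> int_lattice N"
    and M: "\<And>k. k \<in> {1..N} \<Longrightarrow> int M > (\<Sum>i=k..N. n i)"
  defines "F \<equiv> kernel_series N (of_real lam) (cx x) N"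
  shows "(\<Sum>i=1..N. cf (F * khess (of_real lam) N (cx x) i) n)
      + 2 * of_real lam * (\<Sum>i=1..N. \<Sum>j\<in>{1..N} - {i}. cf (F * kgrad (of_real lam) N
          (cx x) i) n / of_real (x i - x j))
    = - (\<Sum>(j, k)\<in>index_pairs N. \<Sum>\<nu>\<le>Suc M. of_real (g_coeff N lam j k \<nu> (\<lambda>i. n i - E_vec j k \<nu> i))
          * kernel_cf N lam x (\<lambda>i. n i - E_vec j k \<nu> i))"
proof -
  let ?\<mu> = "of_real lam :: complex" and ?x = "cx x"
  have inj': "inj_on ?x {1..N}"
  proof (rule inj_onI)
    fix i j assume ij: "i \<in> {1..N}" "j \<in> {1..N}" "cx x i = cx x j"
    then have "x i = x j" by (simp only: cx_def of_real_eq_iff)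
    then show "i = j" using ij by (intro inj_onD[OF inj])
  qed
  have "(\<Sum>i=1..N. cf (F * khess ?\<mu> N ?x i) n)
      + 2 * ?\<mu> * (\<Sum>i=1..N. \<Sum>j\<in>{1..N} - {i}. cf (F * kgrad ?\<mu> N ?x i) n / of_real (x i - x j))
    = cf (F * ((\<Sum>i=1..N. khess ?\<mu> N ?x i)
        + cst ?\<mu> * (cst 2 * (\<Sum>i=1..N. \<Sum>j\<in>{1..N} - {i}. cst (1 / (?x i - ?x j))
            * kgrad ?\<mu> N ?x i)))) n"
  proof -
    have "cf (F * (\<Sum>i=1..N. \<Sum>j\<in>{1..N} - {i}. cst (1 / (?x i - ?x j)) * kgrad ?\<mu> N ?x i)) n
        = (\<Sum>i=1..N. \<Sum>j\<in>{1..N} - {i}. 1 / (?x i - ?x j) * cf (F * kgrad ?\<mu> N ?x i) n)"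
      by (simp only: sum_distrib_left cf_linear(4) cf_mult_of_real)
    moreover have "cf (F * (\<Sum>i=1..N. khess ?\<mu> N ?x i)) n = (\<Sum>i=1..N. cf (F * khess ?\<mu> N ?x i) n)"
      by (simp only: sum_distrib_left cf_linear(4))
    ultimately show ?thesis
      by (simp only: distrib_left cf_linear(1) cf_mult_of_real) (simp add: cx_def)
  qed
  also have "\<dots> = cf (F * ((\<Sum>i=1..N. (cst ?\<mu> * (\<Sum>k=1..N. xdiff_inv ?x k i))\<^sup>2 + cst ?\<mu> * (\<Sum>k=1..N.
      (xdiff_inv ?x k i)\<^sup>2))
        + (cst ?\<mu>)\<^sup>2 * (\<Sum>k=1..N. \<Sum>i=1..N. \<Sum>j\<in>{1..N} - {i}. xdiff_inv ?x k i * xdiff_inv ?x k j))) n"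
    unfolding kgrad_off_diagonal[OF inj'] by (simp add: khess_def kgrad_def power2_eq_square
        mult_ac)
  also have "\<dots> = cf ((\<Sum>k=1..N. yinv k * yinv k * (tilde N ?\<mu> k (tilde N ?\<mu> k F) + tilde N ?\<mu> k F))
     - cst (?\<mu> * (?\<mu> - 1)) * (\<Sum>k=1..N. \<Sum>l=1..N. (ydiff_inv k l)\<^sup>2) * F) n"
    unfolding F_def kernel_function_identity ..
  also have "\<dots> = (\<Sum>k=1..N. cf (yinv k * yinv k * (tilde N ?\<mu> k (tilde N ?\<mu> k F)
      + tilde N ?\<mu> k F)) n)
     - 2 * (?\<mu> * (?\<mu> - 1)) * (\<Sum>k=1..N. \<Sum>l\<in>{1..<k}. cf ((ydiff_inv k l)\<^sup>2 * F) n)"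
    unfolding sum_ydiff_inv_square by (simp add: cf_linear mult.assoc sum_distrib_right)
  also have "(\<Sum>k=1..N. cf (yinv k * yinv k * (tilde N ?\<mu> k (tilde N ?\<mu> k F) + tilde N ?\<mu> k F)) n)
     = (\<Sum>k=1..N. - (\<Sum>\<nu>\<le>Suc M. of_real (g_coeff N lam k k \<nu> (\<lambda>i. n i - E_vec k k \<nu> i)) * cf F
         (\<lambda>i. n i - E_vec k k \<nu> i)))"
  proof (rule sum.cong[OF refl])
    fix k assume "k \<in> {1..N}"
    \<comment> \<open>E_{kk}^0 = 2 e_k is the shift caused by the two factors 1 / y_k; on the
      diagonal g vanishes for all other \<nu>.\<close>
    define n2 where "n2 = (\<lambda>i. n i - E_vec k k 0 i)"
    have n2: "n2 = (n(k := n k - 1))(k := (n(k := n k - 1)) k - 1)" by (auto simp: n2_def E_vec_def)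
    have "m_tilde N lam n2 k = of_int (n k) - 2 + lam * (real N + 1 - real k)"
      by (simp add: m_tilde_def n2_def E_vec_def)
    then have mt: "of_real (m_tilde N lam n2 k) = of_int (n2 k) + K_shift N ?\<mu> k"
      by (simp add: K_shift_def n2_def E_vec_def)
    have "(\<Sum>\<nu>\<le>Suc M. of_real (g_coeff N lam k k \<nu> (\<lambda>i. n i - E_vec k k \<nu> i)) * cf F (\<lambda>i. n i
        - E_vec k k \<nu> i))
        = (\<Sum>\<nu>\<in>{0}. of_real (g_coeff N lam k k \<nu> (\<lambda>i. n i - E_vec k k \<nu> i)) * cf F (\<lambda>i. n i
            - E_vec k k \<nu> i))"
      by (rule sum.mono_neutral_right) (auto simp: g_coeff_def)
    also have "\<dots> = - (of_real (m_tilde N lam n2 k) * (of_real (m_tilde N lam n2 k) + 1) * cf F n2)"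
      by (simp add: g_coeff_def n2_def)
    finally have sum: "(\<Sum>\<nu>\<le>Suc M. of_real (g_coeff N lam k k \<nu> (\<lambda>i. n i - E_vec k k \<nu> i)) * cf F
        (\<lambda>i. n i - E_vec k k \<nu> i))
      = - (of_real (m_tilde N lam n2 k) * (of_real (m_tilde N lam n2 k) + 1) * cf F n2)" .
    show "cf (yinv k * yinv k * (tilde N ?\<mu> k (tilde N ?\<mu> k F) + tilde N ?\<mu> k F)) n
      = - (\<Sum>\<nu>\<le>Suc M. of_real (g_coeff N lam k k \<nu> (\<lambda>i. n i - E_vec k k \<nu> i)) * cf F (\<lambda>i. n i
          - E_vec k k \<nu> i))"
      unfolding sum unfolding mult.assoc cf_yinv_mult n2[symmetric] cf_linear cf_tilde mt by
          (simp add: algebra_simps)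
  qed
  also have "2 * (?\<mu> * (?\<mu> - 1)) * (\<Sum>k=1..N. \<Sum>l\<in>{1..<k}. cf ((ydiff_inv k l)\<^sup>2 * F) n)
     = (\<Sum>k=1..N. \<Sum>j\<in>{1..<k}. \<Sum>\<nu>\<le>Suc M. of_real (g_coeff N lam j k \<nu> (\<lambda>i. n i - E_vec j k \<nu> i))
         * cf F (\<lambda>i. n i - E_vec j k \<nu> i))"
  proof -
    have "2 * (?\<mu> * (?\<mu> - 1)) * cf ((ydiff_inv k l)\<^sup>2 * F) n
      = (\<Sum>\<nu>\<le>Suc M. of_real (g_coeff N lam l k \<nu> (\<lambda>i. n i - E_vec l k \<nu> i)) * cf F (\<lambda>i. n i
          - E_vec l k \<nu> i))"
      if "k \<in> {1..N}" "l \<in> {1..<k}" for k l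
      using that by (subst cf_ydiff_inv_square[OF _ n _ M])
        (auto simp: sum_distrib_left g_coeff_def mult_ac simp del: sum.atMost_Suc intro!: sum.cong)
    then show ?thesis by (simp add: sum_distrib_left del: sum.atMost_Suc)
  qed
  finally show ?thesis by (simp add: sum_index_pairs sum_negf F_def del: sum.atMost_Suc)
qed

lemma kernel_cf_homogeneous:
  "(\<Sum>i=1..N. of_real (x i) * cf (kernel_series N \<mu> (cx x) K * kgrad \<mu> K (cx x) i) n)
   = of_int (\<Sum>k=1..K. n k) * cf (kernel_series N \<mu> (cx x) K) n"
proof -
  have "(\<Sum>i=1..N. of_real (x i) * cf (kernel_series N \<mu> (cx x) K * kgrad \<mu> K (cx x) i) n)
     = cf (kernel_series N \<mu> (cx x) K * (\<Sum>i=1..N. cst (cx x i) * kgrad \<mu> K (cx x) i)) n"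
    by (simp add: sum_distrib_left cf_linear cf_mult_of_real cx_def)
  then show ?thesis unfolding sum_kgrad by (simp add: cf_linear cf_euler sum_distrib_right)
qed

section \<open>The coefficients are symmetric polynomials\<close>

definition monomial :: "nat \<Rightarrow> (nat \<Rightarrow> nat) \<Rightarrow> (nat \<Rightarrow> real) \<Rightarrow> complex" where
  "monomial N a x = (\<Prod>j=1..N. of_real (x j) ^ a j)"

text \<open>Here exponents may repeat, whereas \<open>polynomial_in\<close> sums over a set of
  exponent vectors; the coefficients over each fibre of e are collected. Sums and products of
  polynomials then need no care about coinciding monomials.\<close>

lemma polynomial_inI:
  assumes "finite I" "\<And>x. P x = (\<Sum>i\<in>I. c i * monomial N (e i) x)"
  shows "polynomial_in N P"
proof -
  have "P x = (\<Sum>a\<in>e ` I. (\<Sum>i | i \<in> I \<and> e i = a. c i) * (\<Prod>j=1..N. of_real (x j) ^ a j))" for x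
  proof -
    have "P x = (\<Sum>a\<in>e ` I. \<Sum>i | i \<in> I \<and> e i = a. c i * monomial N (e i) x)"
      unfolding assms(2) using assms(1) by (rule sum.image_gen)
    also have "\<dots> = (\<Sum>a\<in>e ` I. (\<Sum>i | i \<in> I \<and> e i = a. c i) * monomial N a x)"
      by (intro sum.cong refl) (simp add: sum_distrib_right)
    finally show ?thesis by (simp add: monomial_def)
  qed
  moreover have "finite (e ` I)" using assms(1) by simp
  ultimately show ?thesis unfolding polynomial_in_def by (intro exI[of _ "e ` I"] exI conjI allI)
qed

lemma polynomial_inE:
  assumes "polynomial_in N P"
  obtains I c where "finite I" "P = (\<lambda>x. \<Sum>a\<in>I. c a * monomial N a x)"
proof -
  obtain I c where "finite I" "\<forall>x. P x = (\<Sum>a\<in>I. c a * monomial N a x)"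
    using assms unfolding polynomial_in_def monomial_def[symmetric] by blast
  then show ?thesis by (intro that[of I c] ext) auto
qed

lemma polynomial_in_const: "polynomial_in N (\<lambda>_. c)"
  by (rule polynomial_inI[of "{()}" _ "\<lambda>_. c" _ "\<lambda>_ _. 0"]) (auto simp: monomial_def)

lemma polynomial_in_power:
  assumes "i \<in> {1..N}"
  shows "polynomial_in N (\<lambda>x. c * of_real (x i) ^ b)"
proof (rule polynomial_inI[of "{()}" _ "\<lambda>_. c" _ "\<lambda>_ j. if j = i then b else 0"])
  fix x :: "nat \<Rightarrow> real"
  have "monomial N (\<lambda>j. if j = i then b else 0) x = (\<Prod>j\<in>{1..N}. if j = i then of_real
      (x i) ^ b else 1)"
    unfolding monomial_def by (intro prod.cong) auto
  then show "c * of_real (x i) ^ b = (\<Sum>_\<in>{()}. c * monomial N (\<lambda>j. if j = i then b else 0) x)"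
    using assms by (simp add: prod.delta)
qed simp

lemma polynomial_in_add:
  assumes "polynomial_in N P" "polynomial_in N Q"
  shows "polynomial_in N (\<lambda>x. P x + Q x)"
proof -
  obtain I c where P: "finite I" "P = (\<lambda>x. \<Sum>a\<in>I. c a * monomial N a x)"
    using assms(1) by (rule polynomial_inE)
  obtain J d where Q: "finite J" "Q = (\<lambda>x. \<Sum>a\<in>J. d a * monomial N a x)"
    using assms(2) by (rule polynomial_inE)
  show ?thesis
    by (rule polynomial_inI[of "I <+> J" _ "case_sum c d" _ "case_sum id id"])
       (simp_all add: P Q sum.Plus)
qed

lemma polynomial_in_mult:
  assumes "polynomial_in N P" "polynomial_in N Q"
  shows "polynomial_in N (\<lambda>x. P x * Q x)"
proof -
  obtain I c where P: "finite I" "P = (\<lambda>x. \<Sum>a\<in>I. c a * monomial N a x)"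
    using assms(1) by (rule polynomial_inE)
  obtain J d where Q: "finite J" "Q = (\<lambda>x. \<Sum>a\<in>J. d a * monomial N a x)"
    using assms(2) by (rule polynomial_inE)
  have mon: "monomial N a x * monomial N b x = monomial N (\<lambda>j. a j + b j) x" for a b x
    by (simp add: monomial_def power_add prod.distrib)
  have "P x * Q x = (\<Sum>p\<in>I \<times> J. (c (fst p) * d (snd p)) * monomial N (\<lambda>j. fst p j
      + snd p j) x)" for x
    unfolding P Q sum_product sum.cartesian_product
    by (intro sum.cong) (auto simp: mon[symmetric] mult_ac)
  then show ?thesis using P Q
    by (intro polynomial_inI[of "I \<times> J" _ "\<lambda>p. c (fst p) * d (snd p)" _ "\<lambda>p j. fst p j
        + snd p j"]) auto
qed

lemma polynomial_in_sum:
  "(\<And>i. i \<in> I \<Longrightarrow> polynomial_in N (P i)) \<Longrightarrow> polynomial_in N (\<lambda>x. \<Sum>i\<in>I. P i x)"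
  by (induction I rule: infinite_finite_induct) (auto intro: polynomial_in_const polynomial_in_add)

lemma polynomial_coef_mult:
  assumes "\<And>t. polynomial_in N (\<lambda>x. coef (F x) t)" "\<And>t. polynomial_in N (\<lambda>x. coef (G x) t)"
  shows "polynomial_in N (\<lambda>x. coef (F x * G x) t)"
  unfolding coef_mult case_prod_unfold by (intro polynomial_in_sum polynomial_in_mult assms)

lemma polynomial_coef_prod:
  assumes "\<And>i t. i \<in> I \<Longrightarrow> polynomial_in N (\<lambda>x. coef (F i x) t)"
  shows "polynomial_in N (\<lambda>x. coef (\<Prod>i\<in>I. F i x) t)"
  using assms
proof (induction I arbitrary: t rule: infinite_finite_induct)
  case (insert i I)
  then show ?case by (simp add: polynomial_coef_mult)
qed (simp_all add: polynomial_in_const)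

lemma polynomial_kernel_cf: "polynomial_in N (\<lambda>x. cf (kernel_series N \<mu> (cx x) K) n)"
proof -
  have "polynomial_in N (\<lambda>x. coef (Tpow (- \<mu>) (cx x) i k) t)" if "i \<in> {1..N}" for i k t
  proof -
    have "polynomial_in N (\<lambda>x. fps_nth (bps (of_real (x i)) (- \<mu>)) a)" for a
      using polynomial_in_power[OF that, of "(- \<mu> gchoose a) * (- 1) ^ a" a]
      by (simp add: bps_def power_minus[of "of_real _"] mult.assoc)
    then show ?thesis unfolding Tpow_def ev_def coef_Mps cx_def by (intro polynomial_in_sum)
  qed
  then have "polynomial_in N (\<lambda>x. coef (kernel_series N \<mu> (cx x) K) t)" for t
    unfolding kernel_series_def by (intro polynomial_coef_prod polynomial_coef_mult
        polynomial_in_const)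
  then show ?thesis by (cases "n \<in> range weight") (auto simp: cf_eq_0 intro: polynomial_in_const)
qed

lemma kernel_symmetric:
  assumes "\<sigma> permutes {1..N}"
  shows "kernel_series N \<mu> (cx (x \<circ> \<sigma>)) K = kernel_series N \<mu> (cx x) K"
proof -
  have "(\<Prod>i=1..N. Tpow (- \<mu>) (cx (x \<circ> \<sigma>)) i k) = (\<Prod>i=1..N. Tpow (- \<mu>) (cx x) i k)" for k
    using prod.permute[OF assms, of "\<lambda>i. Tpow (- \<mu>) (cx x) i k"] by (simp add: Tpow_def cx_def
        o_def)
  then show ?thesis by (simp add: kernel_series_def)
qed

section \<open>The coefficients of the eigenfunctions\<close>

abbreviation tail :: "nat \<Rightarrow> nat \<Rightarrow> (nat \<Rightarrow> int) \<Rightarrow> int" where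
  "tail N l n \<equiv> \<Sum>i=l..N. n i"

text \<open>E_{jk}^\<nu> has total 2 whatever \<nu> is, so totals bound the number s of steps but
  not the \<nu>_r. The first moment grows by \<nu> (k - j) with \<nu> and supplies that
  bound.\<close>

definition moment :: "nat \<Rightarrow> (nat \<Rightarrow> int) \<Rightarrow> int" where
  "moment N n = (\<Sum>i=1..N. int i * n i)"

lemma finite_index_pairs: "finite (index_pairs N)"
  by (rule finite_subset[of _ "{1..N} \<times> {1..N}"]) (auto simp: index_pairs_def)

lemma sum_E_vec:
  assumes "finite I" 
  shows "(\<Sum>i\<in>I. c i * E_vec j k \<nu> i) = (1 - int \<nu>) * (of_bool (j \<in> I) * c j) + (1 + int \<nu>) *
      (of_bool (k \<in> I) * c k)"
proof -
  have "(\<Sum>i\<in>I. c i * E_vec j k \<nu> i) = (\<Sum>i\<in>I. if i = j then (1 - int \<nu>) * c j else 0)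
      + (\<Sum>i\<in>I. if i = k then (1 + int \<nu>) * c k else 0)"
    unfolding sum.distrib[symmetric] by (rule sum.cong) (auto simp: E_vec_def algebra_simps)
  then show ?thesis using assms by (simp add: sum.delta)
qed

lemma tail_E_vec:
  assumes "(j, k) \<in> index_pairs N"
  shows "tail N l (E_vec j k \<nu>) = (1 - int \<nu>) * of_bool (l \<le> j) + (1 + int \<nu>) * of_bool (l \<le> k)"
  using assms sum_E_vec[of "{l..N}" "\<lambda>_. 1" j k \<nu>] by (auto simp: index_pairs_def)

text \<open>The tail is 2 for l \<le> j, 1 + \<nu> for j < l \<le> k and 0 beyond: a possibly
  negative entry 1 - \<nu> at j is always counted together with 1 + \<nu> at k. This is what makes
  \<alpha>_n triangular.\<close>

lemma tail_E_vec_nonneg: "(j, k) \<in> index_pairs N \<Longrightarrow> tail N l (E_vec j k \<nu>) \<ge> 0"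
  by (subst tail_E_vec) (auto simp: index_pairs_def)

lemma tail_E_vec_1: "(j, k) \<in> index_pairs N \<Longrightarrow> tail N 1 (E_vec j k \<nu>) = 2"
  by (subst tail_E_vec) (auto simp: index_pairs_def)

lemma moment_E_vec:
  assumes "(j, k) \<in> index_pairs N"
  shows "moment N (E_vec j k \<nu>) = int j + int k + int \<nu> * (int k - int j)"
  using assms sum_E_vec[of "{1..N}" int j k \<nu>]
  by (auto simp: index_pairs_def moment_def algebra_simps)

lemma moment_E_vec_nonneg: "(j, k) \<in> index_pairs N \<Longrightarrow> moment N (E_vec j k \<nu>) \<ge> 0"
  by (subst moment_E_vec) (auto simp: index_pairs_def)

text \<open>For j < k the factor k - j is at least 1. For j = k the moment does not see \<nu>, but
  there a nonzero g forces \<nu> = 0.\<close>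

lemma moment_E_vec_ge:
  assumes "(j, k) \<in> index_pairs N" "g_coeff N lam j k \<nu> m \<noteq> 0"
  shows "int \<nu> \<le> moment N (E_vec j k \<nu>)"
proof (cases "j = k")
  case True
  then have "\<nu> = 0" using assms by (auto simp: g_coeff_def)
  then show ?thesis using moment_E_vec_nonneg[OF assms(1)] by simp
next
  case False
  then have "int \<nu> * 1 \<le> int \<nu> * (int k - int j)"
    using assms by (intro mult_left_mono) (auto simp: index_pairs_def)
  then show ?thesis using assms by (subst moment_E_vec) auto
qed

lemma E_vec_int_lattice: "(j, k) \<in> index_pairs N \<Longrightarrow> E_vec j k \<nu> \<in> int_lattice N"
  by (auto simp: index_pairs_def int_lattice_def E_vec_def)

text \<open>A nonzero term writes n as m plus s of the vectors E, over which tails, totals and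
  moments are additive.\<close>

lemma alpha_term_nonzeroD:
  assumes p: "p \<in> {1..s} \<rightarrow>\<^sub>E index_pairs N" and nz: "alpha_term N lam n m s p v \<noteq> 0"
  shows "\<And>l. tail N l m \<le> tail N l n" "tail N 1 n - tail N 1 m = 2 * int s"
    "\<And>r. r \<in> {1..s} \<Longrightarrow> int (v r) \<le> moment N n - moment N m"
proof -
  define E where "E r = E_vec (fst (p r)) (snd (p r)) (v r)" for r
  have pr: "(fst (p r), snd (p r)) \<in> index_pairs N" if "r \<in> {1..s}" for r
    using PiE_mem[OF p that] by simp
  have n: "n = (\<lambda>i. m i + (\<Sum>r=1..s. E r i))"
    using nz by (auto simp: alpha_term_def E_sum_def E_def split: if_splits)
  have t: "tail N l n = tail N l m + (\<Sum>r=1..s. tail N l (E r))" for l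
    by (simp add: n sum.distrib) (rule sum.swap)
  show "tail N l m \<le> tail N l n" for l
    unfolding t using pr tail_E_vec_nonneg by (simp add: E_def) (rule sum_nonneg, simp)
  show "tail N 1 n - tail N 1 m = 2 * int s"
    unfolding t using pr by (simp add: E_def tail_E_vec_1[unfolded One_nat_def])
  have "moment N n = moment N m + (\<Sum>r=1..s. moment N (E r))"
    by (simp add: n moment_def distrib_left sum.distrib sum_distrib_left) (rule sum.swap)
  then have mom: "moment N n - moment N m = (\<Sum>r=1..s. moment N (E r))" by simp
  fix r assume r: "r \<in> {1..s}"
  have "g_coeff N lam (fst (p r)) (snd (p r)) (v r) (\<lambda>i. n i - E_sum p v r i) \<noteq> 0"
    using nz r by (auto simp: alpha_term_def)
  then have "int (v r) \<le> moment N (E r)" unfolding E_def by (rule moment_E_vec_ge[OF pr[OF r]])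
  also have "\<dots> \<le> (\<Sum>r=1..s. moment N (E r))"
    using r pr by (intro member_le_sum) (auto simp: E_def moment_E_vec_nonneg)
  finally show "int (v r) \<le> moment N n - moment N m" using mom by simp
qed

lemma finite_alpha_terms:
  "finite {(s, p, v). s \<ge> 1 \<and> p \<in> {1..s} \<rightarrow>\<^sub>E index_pairs N \<and> v \<in> {1..s} \<rightarrow>\<^sub>E UNIV \<and>
                               alpha_term N lam n m s p v \<noteq> 0}"
proof -
  define M where "M = nat (moment N n - moment N m)"
  let ?S = "SIGMA s:{..nat (tail N 1 n - tail N 1 m)}. ({1..s} \<rightarrow>\<^sub>E index_pairs N) \<times>
      ({1..s} \<rightarrow>\<^sub>E {..M})"
  show ?thesis
  proof (rule finite_subset[of _ ?S])
    show "finite ?S" by (intro finite_SigmaI finite_cartesian_product finite_PiE finite_index_pairs)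
        auto
    show "{(s, p, v). s \<ge> 1 \<and> p \<in> {1..s} \<rightarrow>\<^sub>E index_pairs N \<and> v \<in> {1..s} \<rightarrow>\<^sub>E UNIV \<and>
                               alpha_term N lam n m s p v \<noteq> 0} \<subseteq> ?S"
    proof
      fix w
      assume w: "w \<in> {(s, p, v). s \<ge> 1 \<and> p \<in> {1..s} \<rightarrow>\<^sub>E index_pairs N \<and> v \<in> {1..s} \<rightarrow>\<^sub>E UNIV \<and>
                               alpha_term N lam n m s p v \<noteq> 0}"
      obtain s p v where spv: "w = (s, p, v)" by (cases w)
      have p: "p \<in> {1..s} \<rightarrow>\<^sub>E index_pairs N" and v: "v \<in> {1..s} \<rightarrow>\<^sub>E UNIV"
        and nz: "alpha_term N lam n m s p v \<noteq> 0"
        using w spv by simp_all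
      have "v r \<le> M" if "r \<in> {1..s}" for r
        using alpha_term_nonzeroD(3)[OF p nz that] by (simp add: M_def le_nat_iff)
      then have "v \<in> {1..s} \<rightarrow>\<^sub>E {..M}" using v by (auto simp: PiE_iff)
      then show "w \<in> ?S" unfolding spv using alpha_term_nonzeroD(2)[OF p nz] p by simp
    qed
  qed
qed

text \<open>The coefficient that f_m receives when the recurrence for - D is applied s times to f_n.
  The weights 1 / (4^s s!) are left out, so that one level follows linearly from the previous
  one.\<close>

definition alpha_level :: "nat \<Rightarrow> real \<Rightarrow> (nat \<Rightarrow> int) \<Rightarrow> nat \<Rightarrow> (nat \<Rightarrow> int) \<Rightarrow> real" where
  "alpha_level N lam n s m = (\<Sum>p\<in>{1..s} \<rightarrow>\<^sub>E index_pairs N. \<Sum>\<^sub>\<infinity>v\<in>{1..s} \<rightarrow>\<^sub>E UNIV. alpha_term N lam n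
      m s p v)"

lemma alpha_level_eq:
  assumes M: "moment N n - moment N m \<le> int M"
  shows "alpha_level N lam n s m
    = (\<Sum>p\<in>{1..s} \<rightarrow>\<^sub>E index_pairs N. \<Sum>v\<in>{1..s} \<rightarrow>\<^sub>E {..M}. alpha_term N lam n m s p v)"
  unfolding alpha_level_def
proof (rule sum.cong[OF refl])
  fix p assume p: "p \<in> {1..s} \<rightarrow>\<^sub>E index_pairs N"
  have "(\<Sum>\<^sub>\<infinity>v\<in>{1..s} \<rightarrow>\<^sub>E UNIV. alpha_term N lam n m s p v) = (\<Sum>\<^sub>\<infinity>v\<in>{1..s} \<rightarrow>\<^sub>E {..M}. alpha_term N
      lam n m s p v)"
  proof (rule infsum_cong_neutral)
    fix v assume v: "v \<in> ({1..s} \<rightarrow>\<^sub>E UNIV) - ({1..s} \<rightarrow>\<^sub>E {..M})"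
    show "alpha_term N lam n m s p v = 0"
    proof (rule ccontr)
      assume nz: "alpha_term N lam n m s p v \<noteq> 0"
      have "v r \<le> M" if "r \<in> {1..s}" for r
        using alpha_term_nonzeroD(3)[OF p nz that] M by simp
      then show False using v by (auto simp: PiE_iff)
    qed
  qed (auto simp: PiE_iff)
  then show "(\<Sum>\<^sub>\<infinity>v\<in>{1..s} \<rightarrow>\<^sub>E UNIV. alpha_term N lam n m s p v) = (\<Sum>v\<in>{1..s} \<rightarrow>\<^sub>E {..M}. alpha_term N
      lam n m s p v)"
    by (simp add: finite_PiE)
qed

lemma alpha_level_0: "alpha_level N lam n 0 m = of_bool (m = n)"
  by (simp add: alpha_level_def alpha_term_def E_sum_def)

lemma alpha_level_nonzeroD:
  assumes "alpha_level N lam n s m \<noteq> 0"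
  shows "tail N l m \<le> tail N l n" "tail N 1 n - tail N 1 m = 2 * int s"
proof -
  define M where "M = nat (moment N n - moment N m)"
  have "(\<Sum>p\<in>{1..s} \<rightarrow>\<^sub>E index_pairs N. \<Sum>v\<in>{1..s} \<rightarrow>\<^sub>E {..M}. alpha_term N lam n m s p v) \<noteq> 0"
    using assms alpha_level_eq[of N n m M] by (simp add: M_def)
  then obtain p v where p: "p \<in> {1..s} \<rightarrow>\<^sub>E index_pairs N" and nz: "alpha_term N lam n m s p v \<noteq> 0"
    by (metis (no_types, lifting) sum.neutral)
  show "tail N l m \<le> tail N l n" "tail N 1 n - tail N 1 m = 2 * int s"
    using alpha_term_nonzeroD[OF p nz] by auto
qed

text \<open>The last of the s + 1 steps arrives at m, which is where its coefficient g is evaluated;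
  the first s steps lead from n to m + E.\<close>

lemma alpha_term_Suc:
  "alpha_term N lam n m (Suc s) (p(Suc s := q)) (v(Suc s := \<nu>))
   = g_coeff N lam (fst q) (snd q) \<nu> m * alpha_term N lam n (\<lambda>i. m i + E_vec (fst q)
       (snd q) \<nu> i) s p v"
proof -
  let ?p = "p(Suc s := q)" and ?v = "v(Suc s := \<nu>)"
  have E: "E_sum ?p ?v r = E_sum p v r" if "r \<le> s" for r
    using that unfolding E_sum_def by (intro ext sum.cong) auto
  have ES: "E_sum ?p ?v (Suc s) = (\<lambda>i. E_sum p v s i + E_vec (fst q) (snd q) \<nu> i)"
    using E[of s] by (auto simp: E_sum_def fun_eq_iff)
  have prod: "(\<Prod>r=1..s. g_coeff N lam (fst (?p r)) (snd (?p r)) (?v r) (\<lambda>i. n i - E_sum ?p ?v r i))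
    = (\<Prod>r=1..s. g_coeff N lam (fst (p r)) (snd (p r)) (v r) (\<lambda>i. n i - E_sum p v r i))"
    by (intro prod.cong refl) (auto simp: E)
  show ?thesis
  proof (cases "(\<lambda>i. m i + E_sum ?p ?v (Suc s) i) = n")
    case True
    then have "(\<lambda>i. n i - E_sum ?p ?v (Suc s) i) = m" by auto
    moreover have "(\<lambda>i. m i + E_vec (fst q) (snd q) \<nu> i + E_sum p v s i) = n"
      using True unfolding ES by (simp add: add_ac)
    ultimately show ?thesis using True prod
      by (simp add: alpha_term_def)
  next
    case False
    moreover have "(\<lambda>i. m i + E_vec (fst q) (snd q) \<nu> i + E_sum p v s i) \<noteq> n"
      using False unfolding ES by (simp add: add_ac)
    ultimately show ?thesis by (simp add: alpha_term_def)
  qed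
qed

lemma sum_PiE_insert:
  assumes "x \<notin> I"
  shows "(\<Sum>f\<in>insert x I \<rightarrow>\<^sub>E U. h f) = (\<Sum>y\<in>U. \<Sum>f\<in>I \<rightarrow>\<^sub>E U. h (f(x := y)))"
proof -
  have "(\<Sum>f\<in>insert x I \<rightarrow>\<^sub>E U. h f) = (\<Sum>(y, f)\<in>U \<times> (I \<rightarrow>\<^sub>E U). h (f(x := y)))"
    unfolding PiE_insert_eq using inj_combinator[OF assms, of "\<lambda>_. U"]
    by (subst sum.reindex) (auto simp: case_prod_unfold)
  then show ?thesis by (simp add: sum.cartesian_product)
qed

lemma alpha_level_Suc:
  assumes M: "moment N n - moment N m \<le> int M"
  shows "alpha_level N lam n (Suc s) m
    = (\<Sum>(j, k)\<in>index_pairs N. \<Sum>\<nu>\<le>M. g_coeff N lam j k \<nu> m * alpha_level N lam n s (\<lambda>i. m i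
        + E_vec j k \<nu> i))"
proof -
  have ins: "{1..Suc s} = insert (Suc s) {1..s}" by auto
  have "alpha_level N lam n (Suc s) m
    = (\<Sum>q\<in>index_pairs N. \<Sum>p\<in>{1..s} \<rightarrow>\<^sub>E index_pairs N. \<Sum>\<nu>\<le>M. \<Sum>v\<in>{1..s} \<rightarrow>\<^sub>E {..M}.
         alpha_term N lam n m (Suc s) (p(Suc s := q)) (v(Suc s := \<nu>)))"
    unfolding alpha_level_eq[OF M] ins by (simp add: sum_PiE_insert)
  also have "\<dots> = (\<Sum>q\<in>index_pairs N. \<Sum>\<nu>\<le>M. \<Sum>p\<in>{1..s} \<rightarrow>\<^sub>E index_pairs N. \<Sum>v\<in>{1..s} \<rightarrow>\<^sub>E {..M}.
         alpha_term N lam n m (Suc s) (p(Suc s := q)) (v(Suc s := \<nu>)))"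
    by (intro sum.cong refl sum.swap)
  also have "\<dots> = (\<Sum>q\<in>index_pairs N. \<Sum>\<nu>\<le>M. g_coeff N lam (fst q) (snd q) \<nu> m
      * alpha_level N lam n s (\<lambda>i. m i + E_vec (fst q) (snd q) \<nu> i))"
  proof (intro sum.cong refl)
    fix q \<nu> assume q: "q \<in> index_pairs N"
    \<comment> \<open>Moments of the vectors E are nonnegative, so the bound M also serves the
      shorter chains.\<close>
    have "moment N (\<lambda>i. m i + E_vec (fst q) (snd q) \<nu> i) = moment N m + moment N (E_vec (fst q)
        (snd q) \<nu>)"
      by (simp add: moment_def distrib_left sum.distrib)
    then have "moment N n - moment N (\<lambda>i. m i + E_vec (fst q) (snd q) \<nu> i) \<le> int M"
      using M moment_E_vec_nonneg[of "fst q" "snd q" N \<nu>] q by simp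
    then show "(\<Sum>p\<in>{1..s} \<rightarrow>\<^sub>E index_pairs N. \<Sum>v\<in>{1..s} \<rightarrow>\<^sub>E {..M}.
         alpha_term N lam n m (Suc s) (p(Suc s := q)) (v(Suc s := \<nu>)))
      = g_coeff N lam (fst q) (snd q) \<nu> m * alpha_level N lam n s (\<lambda>i. m i + E_vec (fst q)
          (snd q) \<nu> i)"
      by (simp only: alpha_level_eq alpha_term_Suc sum_distrib_left)
  qed
  finally show ?thesis by (simp add: case_prod_unfold)
qed

lemma alpha_conv_alpha_level:
  "alpha N lam n m = of_bool (m = n) + (\<Sum>\<^sub>\<infinity>s\<in>{1..}. 1 / (4 ^ s * fact s) * alpha_level N lam n s m)"
  by (simp only: alpha_def alpha_level_def)

lemma alpha_eq:
  assumes L: "tail N 1 n - tail N 1 m \<le> int L"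
  shows "alpha N lam n m = (\<Sum>s\<le>L. alpha_level N lam n s m / (4 ^ s * fact s))"
proof -
  have "(\<Sum>\<^sub>\<infinity>s\<in>{1..}. 1 / (4 ^ s * fact s) * alpha_level N lam n s m)
      = (\<Sum>\<^sub>\<infinity>s\<in>{1..L}. 1 / (4 ^ s * fact s) * alpha_level N lam n s m)"
  proof (rule infsum_cong_neutral)
    fix s assume "s \<in> {1..} - {1..L}"
    then have "\<not> tail N 1 n - tail N 1 m = 2 * int s" using L by auto
    then show "1 / (4 ^ s * fact s) * alpha_level N lam n s m = 0"
      using alpha_level_nonzeroD(2)[of N lam n s m] by auto
  qed auto
  also have "\<dots> = (\<Sum>s=1..L. alpha_level N lam n s m / (4 ^ s * fact s))" by simp
  finally have "alpha N lam n m = alpha_level N lam n 0 m / (4 ^ 0 * fact 0) +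
      (\<Sum>s=1..L. alpha_level N lam n s m / (4 ^ s * fact s))"
    by (simp add: alpha_conv_alpha_level alpha_level_0)
  also have "\<dots> = (\<Sum>s=0..L. alpha_level N lam n s m / (4 ^ s * fact s))"
    by (simp add: sum.atLeast_Suc_atMost)
  finally show ?thesis by (simp add: atLeast0AtMost)
qed

lemma alpha_nonzeroD:
  assumes "alpha N lam n m \<noteq> 0"
  shows "tail N l m \<le> tail N l n"
proof -
  have "\<exists>s. alpha_level N lam n s m \<noteq> 0"
  proof (rule ccontr)
    assume "\<not> ?thesis"
    then show False using assms alpha_eq[where N = N and n = n and m = m and L = "nat (tail N 1 n
        - tail N 1 m)" and lam = lam] by simp
  qed
  then show ?thesis using alpha_level_nonzeroD(1) by blast
qed

text \<open>Level s is nonzero only if the totals of n and m differ by 2 s, so the factor on the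
  left acts on it as 4 s. Since 4 s / (4^s s!) = 1 / (4^(s-1) (s-1)!), the weights reproduce
  themselves one level lower. This is the coefficient form of 2 A - D being conjugate to 2
  A.\<close>

lemma alpha_recurrence:
  assumes M: "moment N n - moment N m \<le> int M"
  shows "2 * of_int (tail N 1 n - tail N 1 m) * alpha N lam n m
    = (\<Sum>(j, k)\<in>index_pairs N. \<Sum>\<nu>\<le>M. g_coeff N lam j k \<nu> m * alpha N lam n (\<lambda>i. m i
        + E_vec j k \<nu> i))"
proof -
  define L where "L = nat (tail N 1 n - tail N 1 m)"
  define c :: "nat \<Rightarrow> real" where "c s = 4 ^ s * fact s" for s
  have c_Suc: "c (Suc s) = 4 * of_nat (Suc s) * c s" for s by (simp add: c_def algebra_simps)
  have c_nz: "c s \<noteq> 0" for s by (simp add: c_def)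
  have "2 * of_int (tail N 1 n - tail N 1 m) * alpha N lam n m
      = (\<Sum>s\<le>Suc L. 2 * of_int (tail N 1 n - tail N 1 m) * alpha_level N lam n s m / c s)"
    by (subst alpha_eq[where N = N and n = n and m = m and L = "Suc L"]) (simp_all add: L_def c_def
        sum_distrib_left del: sum.atMost_Suc)
  also have "\<dots> = (\<Sum>s\<le>Suc L. 4 * of_nat s * alpha_level N lam n s m / c s)"
  proof (rule sum.cong[OF refl])
    fix s
    show "2 * of_int (tail N 1 n - tail N 1 m) * alpha_level N lam n s m / c s = 4 * of_nat s
        * alpha_level N lam n s m / c s"
      using alpha_level_nonzeroD(2)[of N lam n s m] by (cases "alpha_level N lam n s m = 0") auto
  qed
  also have "\<dots> = (\<Sum>s\<le>L. alpha_level N lam n (Suc s) m / c s)"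
    using c_nz by (simp add: sum.atMost_Suc_shift c_Suc divide_simps del: sum.atMost_Suc of_nat_Suc)
  also have "\<dots> = (\<Sum>s\<le>L. \<Sum>q\<in>index_pairs N. \<Sum>\<nu>\<le>M.
      g_coeff N lam (fst q) (snd q) \<nu> m * (alpha_level N lam n s (\<lambda>i. m i + E_vec (fst q)
          (snd q) \<nu> i) / c s))"
    by (simp add: alpha_level_Suc[OF M] case_prod_unfold sum_divide_distrib)
  also have "\<dots> = (\<Sum>q\<in>index_pairs N. \<Sum>\<nu>\<le>M. \<Sum>s\<le>L.
      g_coeff N lam (fst q) (snd q) \<nu> m * (alpha_level N lam n s (\<lambda>i. m i + E_vec (fst q)
          (snd q) \<nu> i) / c s))"
    by (subst sum.swap) (intro sum.cong refl sum.swap)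
  also have "\<dots> = (\<Sum>q\<in>index_pairs N. \<Sum>\<nu>\<le>M.
      g_coeff N lam (fst q) (snd q) \<nu> m * alpha N lam n (\<lambda>i. m i + E_vec (fst q) (snd q) \<nu> i))"
  proof (intro sum.cong refl)
    fix q \<nu> assume "q \<in> index_pairs N"
    then have "tail N 1 (\<lambda>i. m i + E_vec (fst q) (snd q) \<nu> i) = tail N 1 m + 2"
      using tail_E_vec_1[of "fst q" "snd q" N \<nu>] by (simp add: sum.distrib)
    then have "tail N 1 n - tail N 1 (\<lambda>i. m i + E_vec (fst q) (snd q) \<nu> i) \<le> int L"
      by (simp add: L_def)
    from alpha_eq[OF this]
    show "(\<Sum>s\<le>L. g_coeff N lam (fst q) (snd q) \<nu> m * (alpha_level N lam n s (\<lambda>i. m i + E_vec (fst q)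
        (snd q) \<nu> i) / c s))
      = g_coeff N lam (fst q) (snd q) \<nu> m * alpha N lam n (\<lambda>i. m i + E_vec (fst q) (snd q) \<nu> i)"
      by (simp add: c_def sum_distrib_left)
  qed
  finally show ?thesis by (simp add: case_prod_unfold)
qed

section \<open>Finite support and summation by parts\<close>

lemma kernel_cf_nonzeroD:
  assumes "cf P m \<noteq> 0" "m \<in> int_lattice N"
  shows "tail N l m \<ge> 0"
proof -
  obtain t where t: "m = weight t" using assms(1) cf_eq_0 by blast
  have "int (Poly_Mapping.lookup t l) = (\<Sum>i=l..N. weight t i)"
    by (rule lookup_eq_sum_weight) (use assms(2) t in \<open>auto simp: int_lattice_def\<close>)
  then show ?thesis unfolding t by simp
qed

text \<open>The lower bounds hold where f_m is nonzero, the upper ones where \<alpha>_n(m) is. The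
  set is finite because each entry of m is a difference of consecutive tails.\<close>

definition support_box :: "nat \<Rightarrow> (nat \<Rightarrow> int) \<Rightarrow> (nat \<Rightarrow> int) set" where
  "support_box N n = {m \<in> int_lattice N. \<forall>l. 0 \<le> tail N l m \<and> tail N l m \<le> tail N l n}"

lemma finite_support_box: "finite (support_box N n)"
proof -
  define C where "C = (\<Sum>l\<le>Suc N. \<bar>tail N l n\<bar>)"
  have C: "tail N l n \<le> C" if "l \<le> Suc N" for l
  proof -
    have "tail N l n \<le> \<bar>tail N l n\<bar>" by simp
    also have "\<dots> \<le> C" unfolding C_def using that by (intro member_le_sum) auto
    finally show ?thesis .
  qed
  have "finite {f. \<forall>i. (i \<in> {1..N} \<longrightarrow> f i \<in> {- C..C}) \<and> (i \<notin> {1..N} \<longrightarrow> f i = 0)}"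
    by (intro finite_set_of_finite_funs) auto
  moreover have "support_box N n \<subseteq> {f. \<forall>i. (i \<in> {1..N} \<longrightarrow> f i \<in> {- C..C}) \<and> (i \<notin> {1..N} \<longrightarrow> f i = 0)}"
  proof clarify
    fix m i assume m: "m \<in> support_box N n"
    have "m i \<in> {- C..C}" if i: "i \<in> {1..N}"
    proof -
      have "tail N i m = m i + tail N (Suc i) m"
        using i by (simp add: sum.atLeast_Suc_atMost)
      moreover have "0 \<le> tail N i m" "tail N i m \<le> C" "0 \<le> tail N (Suc i) m" "tail N (Suc i) m \<le> C"
        using m C[of i] C[of "Suc i"] i by (auto simp: support_box_def intro: order_trans)
      ultimately show ?thesis by auto
    qed
    then show "(i \<in> {1..N} \<longrightarrow> m i \<in> {- C..C}) \<and> (i \<notin> {1..N} \<longrightarrow> m i = 0)"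
      using m by (auto simp: support_box_def int_lattice_def)
  qed
  ultimately show ?thesis by (rule rev_finite_subset)
qed

lemma in_support_boxI:
  "m \<in> int_lattice N \<Longrightarrow> alpha N lam n m \<noteq> 0 \<Longrightarrow> cf P m \<noteq> 0 \<Longrightarrow> m \<in> support_box N n"
  by (auto simp: support_box_def intro: kernel_cf_nonzeroD alpha_nonzeroD)

text \<open>Summation by parts under m to m - E. The box is not invariant, but nonzero terms do not
  leave it: E has nonnegative tails, so upper bounds survive subtraction and lower bounds survive
  addition, while the remaining bounds follow from the nonvanishing of the coefficient of P or of
  \<alpha>.\<close>

lemma sum_alpha_transpose:
  assumes q: "(j, k) \<in> index_pairs N"
  shows "(\<Sum>m\<in>support_box N n. of_real (alpha N lam n m) * (of_real (g_coeff N lam j k \<nu> (\<lambda>i. m i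
      - E_vec j k \<nu> i)) * cf P (\<lambda>i. m i - E_vec j k \<nu> i)))
    = (\<Sum>m\<in>support_box N n. of_real (g_coeff N lam j k \<nu> m * alpha N lam n (\<lambda>i. m i + E_vec j k \<nu> i))
        * cf P m)"
proof -
  let ?E = "E_vec j k \<nu>"
  let ?f = "\<lambda>m. of_real (alpha N lam n m) * (of_real (g_coeff N lam j k \<nu> (\<lambda>i. m i - ?E i)) * cf P
      (\<lambda>i. m i - ?E i))"
  let ?g = "\<lambda>m. of_real (g_coeff N lam j k \<nu> m * alpha N lam n (\<lambda>i. m i + ?E i)) * cf P m"
  let ?B = "support_box N n"
  have lat: "(\<lambda>i. m i - ?E i) \<in> int_lattice N" "(\<lambda>i. m i + ?E i) \<in> int_lattice N" if "m
      \<in> int_lattice N" for m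
    using that E_vec_int_lattice[OF q, of \<nu>] by (auto simp: int_lattice_def)
  have t: "tail N l (\<lambda>i. m i - ?E i) \<le> tail N l m" "tail N l (\<lambda>i. m i + ?E i) \<ge> tail N l m" for l m
    using tail_E_vec_nonneg[OF q, where l = l and \<nu> = \<nu>] by (simp_all add: sum.distrib
        sum_subtractf)
  show ?thesis
  proof (rule sum.reindex_bij_witness_not_neutral[where S' = "{m \<in> ?B. ?f m = 0}" and T' = "{m
      \<in> ?B. ?g m = 0}"
        and i = "\<lambda>m i. m i + ?E i" and j = "\<lambda>m i. m i - ?E i"])
    show "finite {m \<in> ?B. ?f m = 0}" "finite {m \<in> ?B. ?g m = 0}"
      using finite_support_box[of N n] by auto
    fix m
    show "?g (\<lambda>i. m i - ?E i) = ?f m" by simp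
    {
      assume m: "m \<in> ?B - {m \<in> ?B. ?f m = 0}"
      then have ml: "m \<in> int_lattice N" "cf P (\<lambda>i. m i - ?E i) \<noteq> 0" "\<And>l. tail N l m \<le> tail N l n"
        by (auto simp: support_box_def)
      have "(\<lambda>i. m i - ?E i) \<in> ?B"
        unfolding support_box_def
        by (intro CollectI conjI allI lat(1) kernel_cf_nonzeroD[OF ml(2)] order_trans[OF t(1) ml(3)]
            ml(1))
      then show "(\<lambda>i. m i - ?E i) \<in> ?B - {m \<in> ?B. ?g m = 0}" using m by auto
    }
    {
      assume m: "m \<in> ?B - {m \<in> ?B. ?g m = 0}"
      then have ml: "m \<in> int_lattice N" "alpha N lam n (\<lambda>i. m i + ?E i) \<noteq> 0" "\<And>l. 0 \<le> tail N l m"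
        by (auto simp: support_box_def)
      have "(\<lambda>i. m i + ?E i) \<in> ?B"
        unfolding support_box_def
        by (intro CollectI conjI allI lat(2) alpha_nonzeroD[OF ml(2)] order_trans[OF ml(3) t(2)]
            ml(1))
      then show "(\<lambda>i. m i + ?E i) \<in> ?B - {m \<in> ?B. ?f m = 0}" using m by auto
    }
  qed auto
qed

theorem sum_alpha_recurrence:
  fixes lam :: real
  assumes inj: "inj_on x {1..N}"
  defines "F \<equiv> kernel_series N (of_real lam) (cx x) N"
  shows "(\<Sum>m\<in>support_box N n. of_real (alpha N lam n m)
        * ((\<Sum>i=1..N. cf (F * khess (of_real lam) N (cx x) i) m)
        + 2 * of_real lam * (\<Sum>i=1..N. \<Sum>j\<in>{1..N} - {i}. cf (F * kgrad (of_real lam) N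
            (cx x) i) m / of_real (x i - x j))))
    = - (\<Sum>m\<in>support_box N n. 2 * of_int (tail N 1 n - tail N 1 m) * of_real (alpha N lam n m)
        * cf F m)"
proof -
  \<comment> \<open>One M for the whole box: the first sum dominates the moment differences required
    by \<open>alpha_recurrence\<close>, the second the tails required by
    \<open>kernel_cf_recurrence\<close>.\<close>
  define M where "M = (\<Sum>m\<in>support_box N n. nat (moment N n - moment N m)) + (\<Sum>l\<le>N. Suc (nat
      (tail N l n)))"
  have M1: "moment N n - moment N m \<le> int (Suc M)" if "m \<in> support_box N n" for m
  proof -
    have "nat (moment N n - moment N m) \<le> (\<Sum>m\<in>support_box N n. nat (moment N n - moment N m))"
      using that finite_support_box by (intro member_le_sum) auto
    then show ?thesis unfolding M_def by linarith
  qed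
  have M2: "int M > tail N l m" if "m \<in> support_box N n" "l \<in> {1..N}" for m l
  proof -
    have "Suc (nat (tail N l n)) \<le> (\<Sum>l\<le>N. Suc (nat (tail N l n)))"
      using that by (intro member_le_sum) auto
    moreover have "tail N l m \<le> tail N l n" using that by (auto simp: support_box_def)
    ultimately show ?thesis unfolding M_def by linarith
  qed
  have "(\<Sum>m\<in>support_box N n. of_real (alpha N lam n m)
        * ((\<Sum>i=1..N. cf (F * khess (of_real lam) N (cx x) i) m)
        + 2 * of_real lam * (\<Sum>i=1..N. \<Sum>j\<in>{1..N} - {i}. cf (F * kgrad (of_real lam) N
            (cx x) i) m / of_real (x i - x j))))
    = (\<Sum>m\<in>support_box N n. of_real (alpha N lam n m)
        * - (\<Sum>(j, k)\<in>index_pairs N. \<Sum>\<nu>\<le>Suc M. of_real (g_coeff N lam j k \<nu> (\<lambda>i. m i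
            - E_vec j k \<nu> i))
          * cf F (\<lambda>i. m i - E_vec j k \<nu> i)))"
    unfolding F_def using M2
    by (intro sum.cong refl arg_cong2[where f = "(*)"] kernel_cf_recurrence inj)
        (auto simp: support_box_def)
  also have "\<dots> = - (\<Sum>m\<in>support_box N n. \<Sum>q\<in>index_pairs N. \<Sum>\<nu>\<le>Suc M. of_real (alpha N lam n m) *
      (of_real (g_coeff N lam (fst q) (snd q) \<nu> (\<lambda>i. m i - E_vec (fst q) (snd q) \<nu> i))
          * cf F (\<lambda>i. m i - E_vec (fst q) (snd q) \<nu> i)))"
    by (simp add: sum_distrib_left sum_negf case_prod_unfold del: sum.atMost_Suc)
  also have "(\<Sum>m\<in>support_box N n. \<Sum>q\<in>index_pairs N. \<Sum>\<nu>\<le>Suc M. of_real (alpha N lam n m) * (of_real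
      (g_coeff N lam (fst q) (snd q) \<nu> (\<lambda>i. m i - E_vec (fst q) (snd q) \<nu> i))
          * cf F (\<lambda>i. m i - E_vec (fst q) (snd q) \<nu> i)))
     = (\<Sum>q\<in>index_pairs N. \<Sum>\<nu>\<le>Suc M. \<Sum>m\<in>support_box N n. of_real (alpha N lam n m) * (of_real
         (g_coeff N lam (fst q) (snd q) \<nu> (\<lambda>i. m i - E_vec (fst q) (snd q) \<nu> i))
          * cf F (\<lambda>i. m i - E_vec (fst q) (snd q) \<nu> i)))"
    by (subst sum.swap) (intro sum.cong refl sum.swap)
  also have "\<dots> = (\<Sum>q\<in>index_pairs N. \<Sum>\<nu>\<le>Suc M. \<Sum>m\<in>support_box N n.
      of_real (g_coeff N lam (fst q) (snd q) \<nu> m * alpha N lam n (\<lambda>i. m i + E_vec (fst q)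
          (snd q) \<nu> i)) * cf F m)"
    by (intro sum.cong refl sum_alpha_transpose) simp
  also have "\<dots> = (\<Sum>m\<in>support_box N n. \<Sum>q\<in>index_pairs N. \<Sum>\<nu>\<le>Suc M.
      of_real (g_coeff N lam (fst q) (snd q) \<nu> m * alpha N lam n (\<lambda>i. m i + E_vec (fst q)
          (snd q) \<nu> i)) * cf F m)"
    by (subst sum.swap[of _ _ "support_box N n"]) (intro sum.cong refl sum.swap)
  also have "\<dots> = (\<Sum>m\<in>support_box N n. of_real (2 * of_int (tail N 1 n - tail N 1 m)
      * alpha N lam n m) * cf F m)"
    by (intro sum.cong refl, subst alpha_recurrence[OF M1])
       (simp_all add: case_prod_unfold sum_distrib_right del: sum.atMost_Suc)
  finally show ?thesis by simp
qed

section \<open>Conjugation of the Hamiltonian by the ground state\<close>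

text \<open>On the negative axis, which is the branch cut, the principal power restricted to real t
  is exp(\<i> pi \<lambda>) times the power of - t. The phase is constant, so the logarithmic
  derivative is \<lambda> / t on either side of 0.\<close>

lemma of_real_powr_has_vector_derivative:
  fixes lam :: complex
  assumes s: "s \<noteq> 0"
  shows "((\<lambda>t. of_real t powr lam) has_vector_derivative of_real s powr lam * (lam / of_real s))
      (at s)"
proof (cases "s > 0")
  case True
  have "((\<lambda>z. z powr lam) has_field_derivative lam * of_real s powr (lam - 1)) (at (of_real s))"
    by (rule has_field_derivative_powr) (use True in auto)
  from has_vector_derivative_real_field[OF this] show ?thesis
    using True by (simp add: powr_diff mult.commute)
next
  case False
  then have s: "s < 0" using s by simp
  define c where "c = exp (\<i> * of_real pi * lam)"
  have eq: "of_real t powr lam = c * (- of_real t) powr lam" if "t < 0" for t :: real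
  proof -
    have "Ln (of_real t) = of_real (ln (- t)) + \<i> * of_real pi" "Ln (- of_real t) = of_real (ln
        (- t))"
      using that Ln_of_real[of "- t"] by (simp_all add: Ln_minus Ln_of_real' del: Ln_of_real)
    then show ?thesis using that by (simp add: powr_def c_def exp_add[symmetric] algebra_simps)
  qed
  have "((\<lambda>z. c * (- z) powr lam) has_field_derivative c * (lam * (- of_real s) powr (lam - 1) *
      - 1)) (at (of_real s))"
    by (rule derivative_eq_intros refl | use s in simp)+
  then have "((\<lambda>t. c * (- of_real t) powr lam) has_vector_derivative c * (lam * (- of_real s) powr
      (lam - 1) * - 1)) (at s)"
    by (rule has_vector_derivative_real_field)
  moreover have "c * (lam * (- of_real s) powr (lam - 1) * - 1) = of_real s powr lam *
      (lam / of_real s)"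
    unfolding eq[OF s] using s by (simp add: powr_diff)
  ultimately have "((\<lambda>t. c * (- of_real t) powr lam) has_vector_derivative of_real s powr lam *
      (lam / of_real s)) (at s)"
    by simp
  then show ?thesis
  proof (rule has_vector_derivative_transform_within_open)
    show "open {..<0::real}" "s \<in> {..<0}" using s by auto
    show "c * (- of_real t) powr lam = of_real t powr lam" if "t \<in> {..<0}" for t
      using eq[of t] that by simp
  qed
qed

lemma has_vector_derivative_prod_log:
  fixes F :: "'i \<Rightarrow> real \<Rightarrow> complex"
  assumes "finite I" "\<And>i. i \<in> I \<Longrightarrow> (F i has_vector_derivative F i s * g i) (at s)"
  shows "((\<lambda>u. \<Prod>i\<in>I. F i u) has_vector_derivative (\<Prod>i\<in>I. F i s) * (\<Sum>i\<in>I. g i)) (at s)"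
  using assms
proof (induction I rule: finite_induct)
  case (insert i I)
  then have "((\<lambda>u. F i u * (\<Prod>i\<in>I. F i u)) has_vector_derivative
      F i s * ((\<Prod>i\<in>I. F i s) * (\<Sum>i\<in>I. g i)) + F i s * g i * (\<Prod>i\<in>I. F i s)) (at s)"
    by (intro has_vector_derivative_mult) auto
  then show ?case using insert by (simp add: algebra_simps)
qed simp

text \<open>The term \<open>k = j\<close> is \<open>1 / 0 = 0\<close>.\<close>

definition psi0_log :: "nat \<Rightarrow> real \<Rightarrow> (nat \<Rightarrow> real) \<Rightarrow> nat \<Rightarrow> real" where
  "psi0_log N lam x j = lam * (\<Sum>k=1..N. 1 / (x j - x k)) - x j"

lemma sum_of_bool_eq:
  fixes c :: "'a::semiring_1"
  shows "finite I \<Longrightarrow> (\<Sum>k\<in>I. of_bool (j = k) * c) = (if j \<in> I then c else 0)"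
  by (induction I rule: finite_induct) auto

lemma psi0_has_vector_derivative:
  assumes inj: "inj_on x {1..N}" and j: "j \<in> {1..N}"
  shows "((\<lambda>t. psi0 N lam (x(j := t))) has_vector_derivative psi0 N lam x * of_real
      (psi0_log N lam x j)) (at (x j))"
proof -
  let ?y = "\<lambda>t. x(j := t)"
  \<comment> \<open>The variable moved may be the larger or the smaller index of the pair; in both
    cases the logarithmic derivative is \<lambda> divided by x_j minus the other coordinate.\<close>
  let ?g = "\<lambda>i k. of_bool (j = k) * of_real (lam / (x j - x i)) + of_bool (j = i) * of_real (lam /
      (x j - x k)) :: complex"
  have gauss: "((\<lambda>t. \<Prod>i=1..N. of_real (exp (- (?y t i)\<^sup>2 / 2)) :: complex) has_vector_derivative
     (\<Prod>i=1..N. of_real (exp (- (?y (x j) i)\<^sup>2 / 2))) * (\<Sum>i=1..N. of_bool (i = j) * of_real (- x j)))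
         (at (x j))"
  proof (rule has_vector_derivative_prod_log)
    fix i
    have "((\<lambda>t. exp (- t\<^sup>2 / 2)) has_real_derivative exp (- (x j)\<^sup>2 / 2) * (- x j)) (at (x j))"
      by (auto intro!: derivative_eq_intros)
    from has_vector_derivative_of_real[OF this]
    show "((\<lambda>t. of_real (exp (- (?y t i)\<^sup>2 / 2)) :: complex) has_vector_derivative
       of_real (exp (- (?y (x j) i)\<^sup>2 / 2)) * (of_bool (i = j) * of_real (- x j))) (at (x j))"
      by (cases "i = j") auto
  qed simp
  have pair: "((\<lambda>t. of_real (?y t k - ?y t i) powr of_real lam :: complex) has_vector_derivative
      of_real (?y (x j) k - ?y (x j) i) powr of_real lam * ?g i k) (at (x j))"
    if "i \<in> {1..N}" "k \<in> {i<..N}" for i k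
  proof -
    have ik: "x k - x i \<noteq> 0" "i \<noteq> k" using inj that by (auto dest: inj_onD)
    let ?p = "\<lambda>t. of_real t powr of_real lam :: complex"
    have d: "(?p has_vector_derivative ?p (x k - x i) * (of_real lam / of_real (x k - x i))) (at
        (x k - x i))"
      by (rule of_real_powr_has_vector_derivative[OF ik(1)])
    have chain: "((\<lambda>t. ?p (u t)) has_vector_derivative c *\<^sub>R (?p (x k - x i) *
        (of_real lam / of_real (x k - x i)))) (at (x j))"
      if "(u has_vector_derivative c) (at (x j))" "u (x j) = x k - x i" for u c
      using vector_diff_chain_at[OF that(1), of ?p] d that(2) by (simp add: o_def)
    consider "j = k" | "j = i" | "j \<noteq> i" "j \<noteq> k" by blast
    then show ?thesis
    proof cases
      case 1
      have "((\<lambda>t. t - x i) has_vector_derivative 1) (at (x j))" by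
          (auto intro!: derivative_eq_intros)
      from chain[OF this] show ?thesis using 1 ik by simp
    next
      case 2
      have "((\<lambda>t. x k - t) has_vector_derivative - 1) (at (x j))" by
          (auto intro!: derivative_eq_intros)
      moreover have "- (of_real lam / of_real (x k - x i)) = (of_real (lam / (x i
          - x k)) :: complex)"
        by (metis minus_diff_eq minus_divide_right of_real_divide of_real_minus)
      ultimately have "((\<lambda>t. ?p (x k - t)) has_vector_derivative ?p (x k - x i) * of_real (lam /
          (x i - x k))) (at (x j))"
        using chain[of "\<lambda>t. x k - t" "- 1"] 2 by (metis mult_minus_right scaleR_minus1_left)
      then show ?thesis using 2 ik by simp
    qed auto
  qed
  have "((\<lambda>t. \<Prod>i=1..N. \<Prod>k\<in>{i<..N}. of_real (?y t k - ?y t i) powr of_real lam :: complex)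
      has_vector_derivative
     (\<Prod>i=1..N. \<Prod>k\<in>{i<..N}. of_real (?y (x j) k - ?y (x j) i) powr of_real lam) * (\<Sum>i=1..N.
         \<Sum>k\<in>{i<..N}. ?g i k)) (at (x j))"
    by (intro has_vector_derivative_prod_log pair) auto
  from has_vector_derivative_mult[OF gauss this]
  have "((\<lambda>t. psi0 N lam (?y t)) has_vector_derivative
     psi0 N lam x * ((\<Sum>i=1..N. of_bool (i = j) * of_real (- x j)) + (\<Sum>i=1..N. \<Sum>k\<in>{i<..N}. ?g i k)))
         (at (x j))"
    unfolding psi0_def by (simp add: algebra_simps)
  moreover have "(\<Sum>i=1..N. of_bool (i = j) * of_real (- x j)) = (of_real (- x j) :: complex)"
    using j by (subst sum.remove[of _ j]) (auto intro!: sum.neutral)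
  moreover have "(\<Sum>i=1..N. \<Sum>k\<in>{i<..N}. ?g i k) = of_real (lam * (\<Sum>k=1..N. 1 / (x j - x k)))"
  proof -
    have "(\<Sum>i=1..N. \<Sum>k\<in>{i<..N}. of_bool (j = k) * of_real (lam / (x j - x i)) :: complex)
        = (\<Sum>i=1..N. if i < j then of_real (lam / (x j - x i)) else 0)"
      using j by (intro sum.cong refl) (simp add: sum_of_bool_eq del: of_real_divide)
    moreover have "(\<Sum>i=1..N. \<Sum>k\<in>{i<..N}. of_bool (j = i) * of_real (lam / (x j - x k)) :: complex)
        = (\<Sum>k\<in>{j<..N}. of_real (lam / (x j - x k)))"
      using j by (subst sum.remove[of _ j]) (auto intro!: sum.neutral)
    moreover have "(\<Sum>k\<in>{j<..N}. of_real (lam / (x j - x k)) :: complex) = (\<Sum>k=1..N.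
        if k > j then of_real (lam / (x j - x k)) else 0)"
      by (rule sum.mono_neutral_cong_left) auto
    ultimately have "(\<Sum>i=1..N. \<Sum>k\<in>{i<..N}. ?g i k)
       = (\<Sum>k=1..N. (if k < j then of_real (lam / (x j - x k)) else 0) + (if k > j then of_real
           (lam / (x j - x k)) else 0))"
      by (simp only: sum.distrib)
    also have "\<dots> = (\<Sum>k=1..N. of_real (lam / (x j - x k)))"
      by (intro sum.cong refl) auto
    finally show ?thesis by (simp add: sum_distrib_left)
  qed
  ultimately show ?thesis by (simp add: psi0_log_def algebra_simps)
qed

lemma psi0_log_has_real_derivative:
  assumes inj: "inj_on x {1..N}" and j: "j \<in> {1..N}"
  shows "((\<lambda>t. psi0_log N lam (x(j := t)) j) has_real_derivative - lam * (\<Sum>k=1..N. (1 / (x j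
      - x k))\<^sup>2) - 1) (at (x j))"
proof -
  have "((\<lambda>t. 1 / ((x(j := t)) j - (x(j := t)) k)) has_real_derivative - ((1 / (x j - x k))\<^sup>2)) (at
      (x j))"
    if "k \<in> {1..N}" for k
  proof (cases "k = j")
    case False
    then have "x j - x k \<noteq> 0" using inj j that by (auto dest: inj_onD)
    then show ?thesis using False
      by (auto intro!: derivative_eq_intros simp: power2_eq_square)
  qed simp
  then have "((\<lambda>t. lam * (\<Sum>k=1..N. 1 / ((x(j := t)) j - (x(j := t)) k)) - t) has_real_derivative
      lam * (\<Sum>k=1..N. - ((1 / (x j - x k))\<^sup>2)) - 1) (at (x j))"
    by (intro DERIV_diff DERIV_cmult DERIV_sum DERIV_ident)
  then show ?thesis
    by (simp add: psi0_log_def sum_negf)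
qed

text \<open>The left side is the Laplacian of \<psi>_0 divided by \<psi>_0, so this is the ground
  state equation. Three-body terms vanish by \<open>sum_square_of_pair_sum\<close>; the remaining
  squares have coefficient \<lambda>^2 - \<lambda>; the cross terms with x_j pair up, x_j / (x_j -
  x_k) + x_k / (x_k - x_j) = 1, and give the constant \<lambda> N (N - 1).\<close>

lemma sum_psi0_log:
  assumes inj: "inj_on x {1..N}"
  shows "(\<Sum>j=1..N. (psi0_log N lam x j)\<^sup>2 + (- lam * (\<Sum>k=1..N. (1 / (x j - x k))\<^sup>2) - 1))
    = (\<Sum>j=1..N. (x j)\<^sup>2) + 2 * lam * (lam - 1) * (\<Sum>j=1..N. \<Sum>k\<in>{j<..N}. 1 / (x j - x k)\<^sup>2)
      - real N * (1 + lam * (real N - 1))"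
proof -
  have square: "(\<Sum>j=1..N. (\<Sum>k=1..N. 1 / (x j - x k))\<^sup>2) = (\<Sum>j=1..N. \<Sum>k=1..N. (1 / (x j - x k))\<^sup>2)"
  proof (rule sum_square_of_pair_sum)
    fix k l m assume "k \<in> {1..N}" "l \<in> {1..N}" "m \<in> {1..N}" "k \<noteq> l" "l \<noteq> m" "k \<noteq> m"
    then have "x k - x l \<noteq> 0" "x l - x m \<noteq> 0" "x k - x m \<noteq> 0"
      by (simp_all add: inj_on_eq_iff[OF inj])
    moreover have "1 / a * (1 / (a + b)) + 1 / (- a) * (1 / b) + 1 / (- (a + b)) * (1 / (- b)) = 0"
      if "a \<noteq> 0" "b \<noteq> 0" "a + b \<noteq> 0" for a b :: real
      using that by (simp add: divide_simps)
    from this[of "x k - x l" "x l - x m"]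
    show "1 / (x k - x l) * (1 / (x k - x m)) + 1 / (x l - x k) * (1 / (x l - x m))
        + 1 / (x m - x k) * (1 / (x m - x l)) = 0"
      using calculation by (simp add: algebra_simps)
  qed auto
  have pairs: "(\<Sum>j=1..N. \<Sum>k=1..N. (1 / (x j - x k))\<^sup>2) = 2 * (\<Sum>j=1..N. \<Sum>k\<in>{j<..N}. 1 / (x j
      - x k)\<^sup>2)"
  proof -
    let ?f = "\<lambda>j k. 1 / (x j - x k)\<^sup>2"
    have "(\<Sum>k=1..N. (1 / (x j - x k))\<^sup>2) = (\<Sum>k\<in>{1..<j}. ?f j k) + (\<Sum>k\<in>{j<..N}. ?f j k)" if "j
        \<in> {1..N}" for j
    proof -
      have "{1..N} = insert j ({1..<j} \<union> {j<..N})" using that by auto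
      then show ?thesis by (simp add: power_divide, subst sum.union_disjoint) auto
    qed
    moreover have "(\<Sum>j=1..N. \<Sum>k\<in>{1..<j}. ?f j k) = (\<Sum>j=1..N. \<Sum>k\<in>{j<..N}. ?f j k)"
      by (subst (1 2) sum.Sigma)
         (auto intro!: sum.reindex_bij_witness[of _ prod.swap prod.swap] simp: power2_commute)
    ultimately show ?thesis by (simp add: sum.distrib)
  qed
  have cross: "2 * (\<Sum>j=1..N. x j * (\<Sum>k=1..N. 1 / (x j - x k))) = real N * (real N - 1)"
  proof -
    have "(\<Sum>j=1..N. x j * (\<Sum>k=1..N. 1 / (x j - x k))) = (\<Sum>j=1..N. \<Sum>k=1..N. x j / (x j - x k))"
      by (simp add: sum_distrib_left)
    moreover have "(\<Sum>j=1..N. \<Sum>k=1..N. x j / (x j - x k)) = (\<Sum>j=1..N. \<Sum>k=1..N. x k / (x k - x j))"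
      by (rule sum.swap)
    ultimately have "2 * (\<Sum>j=1..N. x j * (\<Sum>k=1..N. 1 / (x j - x k)))
       = (\<Sum>j=1..N. \<Sum>k=1..N. x j / (x j - x k) + x k / (x k - x j))"
      by (simp add: sum.distrib)
    also have "\<dots> = (\<Sum>j=1..N. \<Sum>k=1..N. of_bool (k \<noteq> j))"
    proof (intro sum.cong refl)
      fix j k assume "j \<in> {1..N}" "k \<in> {1..N}"
      then have "x j - x k \<noteq> 0" if "k \<noteq> j" using inj that by (auto dest: inj_onD)
      moreover have "x k / (x k - x j) = - (x k / (x j - x k))"
        by (metis minus_diff_eq minus_divide_right)
      ultimately show "x j / (x j - x k) + x k / (x k - x j) = of_bool (k \<noteq> j)"
        by (cases "k = j") (simp_all add: diff_divide_distrib[symmetric])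
    qed
    also have "\<dots> = (\<Sum>j=1..N. real (N - 1))"
    proof (intro sum.cong refl)
      fix j assume "j \<in> {1..N}"
      then show "(\<Sum>k=1..N. of_bool (k \<noteq> j)) = real (N - 1)"
        by (subst sum.remove[of _ j]) auto
    qed
    also have "\<dots> = real N * (real N - 1)" by (cases N) auto
    finally show ?thesis .
  qed
  define u where "u j = (\<Sum>k=1..N. 1 / (x j - x k))" for j
  define q where "q j = (\<Sum>k=1..N. (1 / (x j - x k))\<^sup>2)" for j
  have "(\<Sum>j=1..N. (psi0_log N lam x j)\<^sup>2 + (- lam * q j - 1))
    = (\<Sum>j=1..N. lam\<^sup>2 * (u j)\<^sup>2 - lam * (2 * (x j * u j)) + (x j)\<^sup>2 - lam * q j - 1)"
    unfolding psi0_log_def u_def[symmetric]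
    by (intro sum.cong refl) (simp add: power2_eq_square algebra_simps)
  also have "\<dots> = lam\<^sup>2 * (\<Sum>j=1..N. (u j)\<^sup>2) - lam * (2 * (\<Sum>j=1..N. x j * u j))
      + (\<Sum>j=1..N. (x j)\<^sup>2) - lam * (\<Sum>j=1..N. q j) - real N"
    by (simp add: sum.distrib sum_subtractf sum_distrib_left)
  finally show ?thesis
    unfolding u_def q_def square pairs cross by (simp add: algebra_simps power2_eq_square)
qed

text \<open>With L_j the logarithmic derivative of \<psi>_0, the terms L_j^2 + L_j' cancel the
  potentials up to the ground energy by \<open>sum_psi0_log\<close>, and the cross terms - 2 L_j
  P1_j split into the Euler operator and the first-order part of D.\<close>

theorem calogero_H_psi0_mult:
  fixes P :: "(nat \<Rightarrow> real) \<Rightarrow> complex" and P1 P2 :: "nat \<Rightarrow> (nat \<Rightarrow> real) \<Rightarrow> complex"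
  assumes P1: "\<And>j x. j \<in> {1..N} \<Longrightarrow> ((\<lambda>t. P (x(j := t))) has_vector_derivative P1 j x) (at (x j))"
    and P2: "\<And>j x. j \<in> {1..N} \<Longrightarrow> ((\<lambda>t. P1 j (x(j := t))) has_vector_derivative P2 j x) (at (x j))"
    and inj: "inj_on x {1..N}"
  shows "calogero_H N lam (\<lambda>x. psi0 N lam x * P x) x
    = psi0 N lam x * (of_real (real N * (1 + lam * (real N - 1))) * P x
        + 2 * (\<Sum>j=1..N. of_real (x j) * P1 j x)
        - ((\<Sum>j=1..N. P2 j x) + 2 * of_real lam * (\<Sum>j=1..N. \<Sum>k=1..N. P1 j x / of_real (x j - x k))))"
proof -
  let ?F = "\<lambda>x. psi0 N lam x * P x"
  let ?L = "\<lambda>x j. of_real (psi0_log N lam x j) :: complex"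
  let ?L' = "\<lambda>j. of_real (- lam * (\<Sum>k=1..N. (1 / (x j - x k))\<^sup>2) - 1) :: complex"
  let ?G = "\<lambda>j x. psi0 N lam x * (?L x j * P x + P1 j x)"
  have first: "partial_deriv j ?F y = ?G j y" if "inj_on y {1..N}" "j \<in> {1..N}" for y j
  proof -
    have "((\<lambda>t. ?F (y(j := t))) has_vector_derivative psi0 N lam (y(j := y j)) * P1 j y
        + psi0 N lam y * ?L y j * P (y(j := y j))) (at (y j))"
      by (intro has_vector_derivative_mult psi0_has_vector_derivative P1 that)
    then show ?thesis unfolding partial_deriv_def
      by (subst vector_derivative_at) (auto simp: algebra_simps)
  qed
  have L: "((\<lambda>t. ?L (x(j := t)) j) has_vector_derivative ?L' j) (at (x j))" if "j \<in> {1..N}" for j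
    by (rule has_vector_derivative_of_real[OF psi0_log_has_real_derivative[OF inj that]])
  have second: "partial_deriv j (partial_deriv j ?F) x = psi0 N lam x * (((?L x j)\<^sup>2 + ?L' j) * P x
      + 2 * ?L x j * P1 j x + P2 j x)"
    if j: "j \<in> {1..N}" for j
  proof -
    have "((\<lambda>t. ?L (x(j := t)) j * P (x(j := t)) + P1 j (x(j := t))) has_vector_derivative
        (?L (x(j := x j)) j * P1 j x + ?L' j * P (x(j := x j)) + P2 j x)) (at (x j))"
      by (intro has_vector_derivative_add has_vector_derivative_mult P1 P2 j L)
    then have "((\<lambda>t. ?G j (x(j := t))) has_vector_derivative
       psi0 N lam (x(j := x j)) * (?L (x(j := x j)) j * P1 j x + ?L' j * P (x(j := x j)) + P2 j x)
       + psi0 N lam x * ?L x j * (?L (x(j := x j)) j * P (x(j := x j)) + P1 j (x(j := x j)))) (at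
           (x j))"
      by (intro has_vector_derivative_mult psi0_has_vector_derivative inj j)
    then have "((\<lambda>t. ?G j (x(j := t))) has_vector_derivative
        psi0 N lam x * (((?L x j)\<^sup>2 + ?L' j) * P x + 2 * ?L x j * P1 j x + P2 j x)) (at (x j))"
      by (simp only: fun_upd_triv) (simp only: power2_eq_square algebra_simps mult_2)
    then have "((\<lambda>t. partial_deriv j ?F (x(j := t))) has_vector_derivative
        psi0 N lam x * (((?L x j)\<^sup>2 + ?L' j) * P x + 2 * ?L x j * P1 j x + P2 j x)) (at (x j))"
    proof (rule has_vector_derivative_transform_within_open)
      \<comment> \<open>A second derivative needs the first one near x_j. As long as t avoids the
        other coordinates the moved point still has distinct coordinates, so the formula
        \<open>first\<close> applies to it.\<close>
      show "open (- (x ` ({1..N} - {j})))" by (intro open_Compl finite_imp_closed) auto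
      show "x j \<in> - (x ` ({1..N} - {j}))" using inj j by (auto dest: inj_onD)
      fix t assume t: "t \<in> - (x ` ({1..N} - {j}))"
      define J where "J = {1..N} - {j}"
      have J: "{1..N} = insert j J" "j \<notin> J" "t \<notin> x ` J" using j t by (auto simp: J_def)
      have "inj_on (x(j := t)) J \<longleftrightarrow> inj_on x J" "(x(j := t)) ` J = x ` J"
        using J(2) by (auto intro!: inj_on_cong)
      moreover have "inj_on x J" using inj unfolding J(1) by simp
      ultimately have "inj_on (x(j := t)) {1..N}" using J by simp
      then show "?G j (x(j := t)) = partial_deriv j ?F (x(j := t))" using first j by simp
    qed
    then show ?thesis unfolding partial_deriv_def[of j "partial_deriv j ?F"] by
        (rule vector_derivative_at)
  qed
  define W where "W = 2 * lam * (lam - 1) * (\<Sum>j=1..N. \<Sum>k\<in>{j<..N}. 1 / (x j - x k)\<^sup>2)"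
  have "calogero_H N lam ?F x
      = (\<Sum>j=1..N. - (psi0 N lam x * (((?L x j)\<^sup>2 + ?L' j) * P x + 2 * ?L x j * P1 j x + P2 j x))
          + of_real ((x j)\<^sup>2) * (psi0 N lam x * P x)) + of_real W * (psi0 N lam x * P x)"
    unfolding calogero_H_def W_def by (simp add: second)
  also have "\<dots> = psi0 N lam x * (of_real ((\<Sum>j=1..N. (x j)\<^sup>2) + W - (\<Sum>j=1..N. (psi0_log N lam x j)\<^sup>2
      + (- lam * (\<Sum>k=1..N. (1 / (x j - x k))\<^sup>2) - 1))) * P x
       - 2 * (\<Sum>j=1..N. ?L x j * P1 j x) - (\<Sum>j=1..N. P2 j x))"
    by (simp add: sum.distrib sum_subtractf sum_negf sum_distrib_left sum_distrib_right
        algebra_simps)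
  also have "(\<Sum>j=1..N. (x j)\<^sup>2) + W - (\<Sum>j=1..N. (psi0_log N lam x j)\<^sup>2 + (- lam * (\<Sum>k=1..N. (1 /
      (x j - x k))\<^sup>2) - 1))
     = real N * (1 + lam * (real N - 1))"
    unfolding sum_psi0_log[OF inj] W_def by simp
  also have "(\<Sum>j=1..N. ?L x j * P1 j x) = of_real lam * (\<Sum>j=1..N. \<Sum>k=1..N. P1 j x / of_real (x j
      - x k)) - (\<Sum>j=1..N. of_real (x j) * P1 j x)"
  proof -
    have "(\<Sum>k=1..N. P1 j x / of_real (x j - x k)) = P1 j x * of_real (\<Sum>k=1..N. 1 / (x j
        - x k))" for j
      by (simp add: sum_distrib_left)
    then show ?thesis
      by (simp add: psi0_log_def sum_subtractf sum_distrib_left[of "of_real lam"] algebra_simps del: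
          of_real_sum)
  qed
  finally show ?thesis by (simp add: algebra_simps)
qed

section \<open>The functions P_n as finite sums, and the eigenvalue equation\<close>

lemma P_fun_eq:
  assumes "N \<ge> 1" "\<epsilon> > 0"
  shows "P_fun N lam \<epsilon> n x = (\<Sum>m\<in>support_box N n. of_real (alpha N lam n m) * kernel_cf N lam x m)"
proof -
  have "P_fun N lam \<epsilon> n x = (\<Sum>\<^sub>\<infinity>m\<in>support_box N n. of_real (alpha N lam n m) * kernel_cf N lam x m)"
    unfolding P_fun_def
  proof (rule infsum_cong_neutral)
    fix m
    have f: "f_fun N lam \<epsilon> m x = kernel_cf N lam x m" if "m \<in> int_lattice N"
      using f_fun_eq_cf[OF assms that] by (simp add: cx_def[abs_def])
    \<comment> \<open>Outside the box a tail bound fails, so \<alpha> or the coefficient of the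
      kernel vanishes.\<close>
    show "of_real (alpha N lam n m) * f_fun N lam \<epsilon> m x = 0" if "m \<in> int_lattice N
        - support_box N n"
      using that f in_support_boxI[of m N lam n] by auto
    show "of_real (alpha N lam n m) * f_fun N lam \<epsilon> m x = of_real (alpha N lam n m)
        * kernel_cf N lam x m"
      if "m \<in> int_lattice N \<inter> support_box N n" using that f by simp
    show "of_real (alpha N lam n m) * kernel_cf N lam x m = 0" if "m \<in> support_box N n
        - int_lattice N"
      using that by (auto simp: support_box_def)
  qed
  then show ?thesis by (simp add: finite_support_box)
qed

lemma finite_support:
  assumes "N \<ge> 1" "\<epsilon> > 0"
  shows "finite {m \<in> int_lattice N. \<exists>x. of_real (alpha N lam n m) * f_fun N lam \<epsilon> m x \<noteq> 0}"
proof (rule finite_subset[OF _ finite_support_box[of N n]], clarify)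
  fix m x assume m: "m \<in> int_lattice N" and nz: "of_real (alpha N lam n m) * f_fun N lam \<epsilon> m x \<noteq> 0"
  then show "m \<in> support_box N n"
    using f_fun_eq_cf[OF assms m] by (intro in_support_boxI) auto
qed

lemma P_fun_symmetric_polynomial:
  assumes "N \<ge> 1" "\<epsilon> > 0"
  shows "symmetric_polynomial_in N (P_fun N lam \<epsilon> n)"
proof -
  have "polynomial_in N (P_fun N lam \<epsilon> n)"
    unfolding P_fun_eq[OF assms, abs_def]
    by (intro polynomial_in_sum polynomial_in_mult polynomial_in_const polynomial_kernel_cf)
  then show ?thesis
    unfolding symmetric_polynomial_in_def by (auto simp: P_fun_eq[OF assms] kernel_symmetric)
qed

lemma P_fun_eigenfunction:
  assumes N: "N \<ge> 1" and \<epsilon>: "\<epsilon> > 0" and inj: "inj_on x {1..N}"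
  shows "calogero_H N lam (\<lambda>x. psi0 N lam x * P_fun N lam \<epsilon> n x) x
    = of_real (eigenvalue N lam n) * (psi0 N lam x * P_fun N lam \<epsilon> n x)"
proof -
  let ?a = "\<lambda>m. of_real (alpha N lam n m) :: complex"
  let ?K = "\<lambda>x. kernel_series N (of_real lam) (cx x) N"
  let ?B = "support_box N n"
  define P1 where "P1 j x = (\<Sum>m\<in>?B. ?a m * cf (?K x * kgrad (of_real lam) N (cx x) j) m)" for j x
  define P2 where "P2 j x = (\<Sum>m\<in>?B. ?a m * cf (?K x * khess (of_real lam) N (cx x) j) m)" for j x
  have d1: "((\<lambda>t. P_fun N lam \<epsilon> n (x(j := t))) has_vector_derivative P1 j x) (at (x j))" if "j
      \<in> {1..N}" for j x
    unfolding P_fun_eq[OF N \<epsilon>] P1_def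
    by (intro has_vector_derivative_sum has_vector_derivative_mult_right cf_has_vector_derivative
        has_coef_derivative_kernel that)
  have d2: "((\<lambda>t. P1 j (x(j := t))) has_vector_derivative P2 j x) (at (x j))" if "j
      \<in> {1..N}" for j x
    unfolding P1_def P2_def
    by (intro has_vector_derivative_sum has_vector_derivative_mult_right cf_has_vector_derivative
        has_coef_derivative_kernel_kgrad that)
  have euler: "(\<Sum>j=1..N. of_real (x j) * P1 j x) = (\<Sum>m\<in>?B. of_int (tail N 1 m) * (?a m * cf
      (?K x) m))"
  proof -
    have "(\<Sum>j=1..N. of_real (x j) * P1 j x)
       = (\<Sum>m\<in>?B. ?a m * (\<Sum>j=1..N. of_real (x j) * cf (?K x * kgrad (of_real lam) N (cx x) j) m))"
      unfolding P1_def sum_distrib_left by (subst sum.swap) (simp add: mult_ac)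
    then show ?thesis unfolding kernel_cf_homogeneous by (simp add: mult_ac)
  qed
  have laplace: "(\<Sum>j=1..N. P2 j x) + 2 * of_real lam * (\<Sum>j=1..N. \<Sum>k=1..N. P1 j x / of_real (x j
      - x k))
     = - (\<Sum>m\<in>?B. 2 * of_int (tail N 1 n - tail N 1 m) * ?a m * cf (?K x) m)"
  proof -
    \<comment> \<open>At k = j the denominator is 0, and division by 0 gives 0.\<close>
    have off: "(\<Sum>k=1..N. c / of_real (x j - x k)) = (\<Sum>k\<in>{1..N} - {j}. c / of_real (x j
        - x k))" for c :: complex and j
      by (rule sum.mono_neutral_right) auto
    have s1: "(\<Sum>j=1..N. P2 j x) = (\<Sum>m\<in>?B. ?a m * (\<Sum>j=1..N. cf (?K x * khess (of_real lam) N
        (cx x) j) m))"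
      unfolding P2_def sum_distrib_left by (rule sum.swap)
    have "(\<Sum>k\<in>{1..N} - {j}. P1 j x / of_real (x j - x k)) = (\<Sum>m\<in>?B. \<Sum>k\<in>{1..N} - {j}. ?a m * (cf
        (?K x * kgrad (of_real lam) N (cx x) j) m / of_real (x j - x k)))" for j
      unfolding P1_def sum_divide_distrib by (subst sum.swap) simp
    then have s2: "(\<Sum>j=1..N. \<Sum>k\<in>{1..N} - {j}. P1 j x / of_real (x j - x k))
      = (\<Sum>m\<in>?B. ?a m * (\<Sum>j=1..N. \<Sum>k\<in>{1..N} - {j}. cf (?K x * kgrad (of_real lam) N
          (cx x) j) m / of_real (x j - x k)))"
      unfolding sum_distrib_left by (simp only:) (rule sum.swap)
    show ?thesis
      unfolding off s1 s2 sum_alpha_recurrence[OF inj, symmetric] sum_distrib_left[of "2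
          * of_real lam" _ ?B] sum.distrib[symmetric]
      by (simp only: distrib_left mult.left_commute)
  qed
  \<comment> \<open>Homogeneity gives twice the total of m, and - D gives twice the difference of
    the totals of n and m; their sum no longer depends on m.\<close>
  have total: "2 * (\<Sum>m\<in>?B. of_int (tail N 1 m) * (?a m * cf (?K x) m))
      + (\<Sum>m\<in>?B. 2 * of_int (tail N 1 n - tail N 1 m) * ?a m * cf (?K x) m)
      = 2 * of_int (tail N 1 n) * P_fun N lam \<epsilon> n x"
    unfolding P_fun_eq[OF N \<epsilon>] sum_distrib_left sum.distrib[symmetric]
    by (intro sum.cong refl) (simp add: algebra_simps)
  have "calogero_H N lam (\<lambda>x. psi0 N lam x * P_fun N lam \<epsilon> n x) x
     = psi0 N lam x * (of_real (real N * (1 + lam * (real N - 1))) * P_fun N lam \<epsilon> n x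
        + 2 * (\<Sum>j=1..N. of_real (x j) * P1 j x)
        - ((\<Sum>j=1..N. P2 j x) + 2 * of_real lam * (\<Sum>j=1..N. \<Sum>k=1..N. P1 j x / of_real (x j - x k))))"
    by (rule calogero_H_psi0_mult[OF d1 d2 inj])
  also have "\<dots> = psi0 N lam x * (of_real (real N * (1 + lam * (real N - 1))) * P_fun N lam \<epsilon> n x
      + 2 * of_int (tail N 1 n) * P_fun N lam \<epsilon> n x)"
    unfolding euler laplace total[symmetric] by simp
  also have "\<dots> = of_real (eigenvalue N lam n) * (psi0 N lam x * P_fun N lam \<epsilon> n x)"
    by (simp add: eigenvalue_def algebra_simps)
  finally show ?thesis .
qed

theorem theorem1p1:
  fixes N :: nat and lam \<epsilon> :: real and n :: "nat \<Rightarrow> int"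
  assumes "N \<ge> 1" and "lam > 0" and "\<epsilon> > 0" and "n \<in> int_lattice N"
  shows "(\<forall>m\<in>int_lattice N.
            finite {(s, p, v). s \<ge> 1 \<and> p \<in> {1..s} \<rightarrow>\<^sub>E index_pairs N \<and> v \<in> {1..s} \<rightarrow>\<^sub>E UNIV \<and>
                               alpha_term N lam n m s p v \<noteq> 0})
       \<and> finite {m \<in> int_lattice N. \<exists>x. of_real (alpha N lam n m) * f_fun N lam \<epsilon> m x \<noteq> 0}
       \<and> reduced_polynomial_eigenfunction N lam (eigenvalue N lam n) (P_fun N lam \<epsilon> n)"
  unfolding reduced_polynomial_eigenfunction_def
  using finite_alpha_terms finite_support P_fun_symmetric_polynomial P_fun_eigenfunction assms
      by auto

end
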